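(* Let $n\ge 2$, let $r:\mathbb{S}^n\to[-1,1]$ be an isoparametric function on the unit sphere $\mathbb{S}^n$ (normalized as in the context), let $k$ be the number of distinct principal curvatures of the compact isoparametric hypersurface given by a regular level set of $r$, and let $m$ be the multiplicity of its smallest principal curvature. Put $$R:=\begin{cases}0 & (k=1,3,6)\\ -1+\dfrac{km}{n-1} & (k=2,4),\end{cases}$$ so that $R\in(-1,1)$. Let $V$ be a $C^\infty$ function on a (non-degenerate) interval $J\subset r(\mathbb{S}^n)=[-1,1]$, and suppose that the mean curvature flow starting from the graph of $u=(V\circ r)|_{r^{-1}(J)}$ is a translating soliton in $\mathbb{S}^n\times\mathbb{R}$. Then $V$ is the restriction to $J$ of a $C^\infty$ function $\hat V$ on an interval $\hat J\supset J$ having one of the following shapes (for some $a,b$ with $-1<a<R<b<1$). (1) $\hat J=(a,b)$, $\hat V'<0$ on $(a,R)$, $\hat V'(R)=0$, $\hat V'>0$ on $(R,b)$, $\lim_{r\downarrow a}\hat V'(r)=-\infty$ and $\lim_{r\uparrow b}\hat V'(r)=+\infty$. (2) $\hat J=(a,b)$ and there is $c\in(a,R)$ with $\hat V'<0$ on $(a,c)$, $\hat V'(c)=0$, $\hat V'>0$ on $(c,b)$, $\lim_{r\downarrow a}\hat V'(r)=-\infty$ and $\lim_{r\uparrow b}\hat V'(r)=+\infty$. (3) $\hat J=(a,b)$ and there is $c\in(R,b)$ with $\hat V'<0$ on $(a,c)$, $\hat V'(c)=0$, $\hat V'>0$ on $(c,b)$, $\lim_{r\downarrow a}\hat V'(r)=-\infty$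 and $\lim_{r\uparrow b}\hat V'(r)=+\infty$. (4) $\hat J=(a,b)$, $\hat V'>0$ on $(a,b)$, $\lim_{r\downarrow a}\hat V'(r)=\lim_{r\uparrow b}\hat V'(r)=+\infty$. (5) $\hat J=(a,b)$, $\hat V'<0$ on $(a,b)$, $\lim_{r\downarrow a}\hat V'(r)=\lim_{r\uparrow b}\hat V'(r)=-\infty$. (6) $\hat J=[-1,b)$, $\hat V'>0$ on $[-1,b)$ and $\lim_{r\uparrow b}\hat V'(r)=+\infty$. (7) $\hat J=(a,1]$, $\hat V'<0$ on $(a,1]$ and $\lim_{r\downarrow a}\hat V'(r)=-\infty$.
   Context: Isoparametric functions. A non-constant $C^\infty$ function $r$ on a Riemannian manifold $N$ is isoparametric if there are $C^\infty$ functions $\alpha,\beta$ with $\|\nabla r\|^2=\alpha\circ r$ and $\Delta r=\beta\circ r$. On $N=\mathbb{S}^n$ the paper uses Münzner's normalization: $r$ is the restriction to $\mathbb{S}^n$ of a homogeneous polynomial (of degree $k$) on $\mathbb{R}^{n+1}$, where $k\in\{1,2,3,4,6\}$ is the number of distinct principal curvatures $\lambda_1>\dots>\lambda_k$ of the regular level sets, with multiplicities $m_1,\dots,m_k$, and $$\|\nabla r\|^2=k^2(1-r^2),\qquad \Delta r=\frac{m_2-m_1}{2}k^2-k(n+k-1)r .$$ Then $r(\mathbb{S}^n)=[-1,1]$. If $k=1,3,6$ all multiplicities are equal (and $m_2-m_1$ is read as $0$); if $k=2,4$ the multiplicities are $m_1,m_2$ alternately, so that $\frac{k}{2}(m_1+m_2)=n-1$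 and $m=m_2$ is the multiplicity of the smallest principal curvature. Solitons. For a function $u$ on a domain $M$ of a Riemannian manifold $N$, let $f(x)=(x,u(x))\in N\times\mathbb{R}$ and let $\Gamma$ be its graph. A smooth family of immersions $f_t:M\to N\times\mathbb{R}$, $t\in I$ ($I$ an open interval containing $0$), with $f_0=f$ and $(\partial f_t/\partial t)^{\bot_{f_t}}=H_t$ (normal component; $H_t$ the mean curvature vector field of $f_t$) is the mean curvature flow starting from $\Gamma$. It is a translating soliton if $\tilde f_t=\phi_t^{-1}\circ f_t$ satisfies $(\partial\tilde f_t/\partial t)^{\bot_{\tilde f_t}}=0$, where $\phi_t(x,s)=(x,s+t)$ is the one-parameter group of the Killing field $X=(0,1)\in TN\oplus T\mathbb{R}$. *)

theory Defs
  imports "HOL-Analysis.Analysis"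
begin

section \<open>Smoothness\<close>

text \<open>\<open>C\<^sup>j\<close> on an open set of a finite-dimensional space: \<open>f\<close> is differentiable and every
  directional derivative is \<open>C\<^sup>j\<^sup>-\<^sup>1\<close>.\<close>

primrec Ck_open :: "nat \<Rightarrow> ('a::real_normed_vector \<Rightarrow> 'b::real_normed_vector) \<Rightarrow> 'a set \<Rightarrow> bool" where
  "Ck_open 0 f U \<longleftrightarrow> continuous_on U f"
| "Ck_open (Suc j) f U \<longleftrightarrow> (\<forall>x\<in>U. f differentiable (at x)) \<and>
      (\<forall>v. Ck_open j (\<lambda>x. frechet_derivative f (at x) v) U)"

text \<open>The usual notion of a smooth map on an arbitrary subset of a Euclidean space (locally the
  restriction of a smooth map on an open set). It covers submanifolds, also with boundary.\<close>

definition smooth_map_on :: "'a::euclidean_space set \<Rightarrow> ('a \<Rightarrow> 'b::euclidean_space) \<Rightarrow> bool" where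
  "smooth_map_on A f \<longleftrightarrow> (\<forall>p\<in>A. \<exists>U g. open U \<and> p \<in> U \<and> (\<forall>j. Ck_open j g U) \<and> (\<forall>q\<in>A \<inter> U. g q = f q))"

text \<open>\<open>C\<^sup>\<infinity>\<close> functions of one variable on a non-degenerate interval; derivatives at end points
  belonging to the interval are one-sided.\<close>

definition smooth_on_interval :: "real set \<Rightarrow> (real \<Rightarrow> real) \<Rightarrow> bool" where
  "smooth_on_interval J V \<longleftrightarrow> (\<exists>D :: nat \<Rightarrow> real \<Rightarrow> real. (\<forall>x\<in>J. D 0 x = V x) \<and>
      (\<forall>j. \<forall>x\<in>J. (D j has_real_derivative D (Suc j) x) (at x within J)))"


section \<open>Calculus on the unit sphere\<close>

definition orth_proj :: "'a::euclidean_space set \<Rightarrow> 'a \<Rightarrow> 'a" where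
  "orth_proj S w = (THE p. p \<in> S \<and> w - p \<in> orthogonal_comp S)"

definition sphere_tangent :: "'a::euclidean_space \<Rightarrow> 'a set" where
  "sphere_tangent x = {v. v \<bullet> x = 0}"

text \<open>Maps on a subset \<open>M\<close> of the unit sphere are differentiated through their radially constant
  extension \<open>g \<circ> sgn\<close> (\<open>sgn y = y / norm y\<close>) to the cone \<open>sgn -` M\<close> over \<open>M\<close>. For \<open>x \<in> M\<close> and
  \<open>v\<close> tangent to the sphere at \<open>x\<close>, \<open>dS M g x v\<close> is the differential. Since
  \<open>sgn (x + t v)\<close> has acceleration \<open>- (norm v)\<^sup>2 x\<close> at \<open>t = 0\<close>, with no tangential part,
  \<open>d2S M g x\<close> on tangent vectors is the Hessian of \<open>g\<close> with respect to the
  Levi-Civita connection of the sphere. Derivatives are taken within the cone so that they also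
  make sense at boundary points of \<open>M\<close>; at points interior to \<open>M\<close> relative to the sphere this is
  the full derivative.\<close>

definition dS :: "'a::euclidean_space set \<Rightarrow> ('a \<Rightarrow> 'b::euclidean_space) \<Rightarrow> 'a \<Rightarrow> 'a \<Rightarrow> 'b" where
  "dS M g x v = frechet_derivative (g \<circ> sgn) (at x within sgn -` M) v"

definition d2S :: "'a::euclidean_space set \<Rightarrow> ('a \<Rightarrow> 'b::euclidean_space) \<Rightarrow> 'a \<Rightarrow> 'a \<Rightarrow> 'a \<Rightarrow> 'b" where
  "d2S M g x v w = frechet_derivative (\<lambda>y. dS M g y w) (at x within sgn -` M) v"

text \<open>Trace of a bilinear map \<open>Q\<close> on the subspace \<open>T\<close> with respect to the inner product \<open>G\<close> on
  \<open>T\<close>; it does not depend on the chosen \<open>G\<close>-orthonormal basis.\<close>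

definition trace_wrt :: "('a \<Rightarrow> 'a \<Rightarrow> real) \<Rightarrow> 'a::euclidean_space set \<Rightarrow> ('a \<Rightarrow> 'a \<Rightarrow> 'b) \<Rightarrow> 'b::real_vector" where
  "trace_wrt G T Q =
     (\<Sum>e\<in>(SOME B. span B = T \<and> (\<forall>a\<in>B. \<forall>b\<in>B. G a b = (if a = b then 1 else 0))). Q e e)"

definition gradS :: "('a::euclidean_space \<Rightarrow> real) \<Rightarrow> 'a \<Rightarrow> 'a" where
  "gradS r x = (THE D. D \<in> sphere_tangent x \<and> (\<forall>v\<in>sphere_tangent x. dS (sphere 0 1) r x v = D \<bullet> v))"

definition laplS :: "('a::euclidean_space \<Rightarrow> real) \<Rightarrow> 'a \<Rightarrow> real" where
  "laplS r x = trace_wrt (\<bullet>) (sphere_tangent x) (d2S (sphere 0 1) r x)"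


section \<open>Isoparametric functions on the unit sphere\<close>

definition isoparametric :: "('a::euclidean_space \<Rightarrow> real) \<Rightarrow> bool" where
  "isoparametric r \<longleftrightarrow> smooth_map_on (sphere 0 1) r \<and> \<not> r constant_on sphere 0 1 \<and>
     (\<exists>\<alpha> \<beta> :: real \<Rightarrow> real. smooth_on_interval UNIV \<alpha> \<and> smooth_on_interval UNIV \<beta> \<and>
        (\<forall>x\<in>sphere 0 1. (norm (gradS r x))\<^sup>2 = \<alpha> (r x) \<and> laplS r x = \<beta> (r x)))"

definition level_tangent :: "('a::euclidean_space \<Rightarrow> real) \<Rightarrow> 'a \<Rightarrow> 'a set" where
  "level_tangent r x = {v \<in> sphere_tangent x. v \<bullet> gradS r x = 0}"

text \<open>Shape operator \<open>A v = - \<nabla>\<^sub>v \<nu>\<close> of the level set of \<open>r\<close> through \<open>x\<close>, for the unit normal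
  \<open>\<nu> = \<nabla>r / |\<nabla>r|\<close>. This orientation is the one compatible with the sign of \<open>m\<^sub>2 - m\<^sub>1\<close> in
  Muenzner's normalization below: for \<open>r x = |x'|\<^sup>2 - |x''|\<^sup>2\<close> with \<open>x'\<close> in a space of dimension
  \<open>p + 1\<close> and \<open>x''\<close> in one of dimension \<open>q + 1\<close>, the principal curvatures at \<open>r = cos 2t\<close> are
  \<open>cot t\<close> (multiplicity \<open>m\<^sub>1 = q\<close>) and \<open>- tan t\<close> (multiplicity \<open>m\<^sub>2 = p\<close>).\<close>

definition shape_op :: "('a::euclidean_space \<Rightarrow> real) \<Rightarrow> 'a \<Rightarrow> 'a \<Rightarrow> 'a" where
  "shape_op r x v = - orth_proj (sphere_tangent x) (dS (sphere 0 1) (\<lambda>y. sgn (gradS r y)) x v)"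

definition principal_space :: "('a::euclidean_space \<Rightarrow> real) \<Rightarrow> 'a \<Rightarrow> real \<Rightarrow> 'a set" where
  "principal_space r x \<kappa> = {v \<in> level_tangent r x. shape_op r x v = \<kappa> *\<^sub>R v}"

definition principal_curvatures :: "('a::euclidean_space \<Rightarrow> real) \<Rightarrow> 'a \<Rightarrow> real set" where
  "principal_curvatures r x = {\<kappa>. \<exists>v\<in>principal_space r x \<kappa>. v \<noteq> 0}"

definition regular_value :: "('a::euclidean_space \<Rightarrow> real) \<Rightarrow> real \<Rightarrow> bool" where
  "regular_value r c \<longleftrightarrow> c \<in> r ` sphere 0 1 \<and> (\<forall>x\<in>sphere 0 1. r x = c \<longrightarrow> gradS r x \<noteq> 0)"

definition muenzner_normalized ::
    "nat \<Rightarrow> nat \<Rightarrow> (nat \<Rightarrow> nat) \<Rightarrow> ('a::euclidean_space \<Rightarrow> real) \<Rightarrow> bool" where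
  "muenzner_normalized n k mu r \<longleftrightarrow>
     isoparametric r \<and>
     (\<exists>F. real_polynomial_function F \<and> (\<forall>c x. F (c *\<^sub>R x) = c ^ k * F x) \<and> (\<forall>x\<in>sphere 0 1. r x = F x)) \<and>
     k \<in> {1, 2, 3, 4, 6} \<and>
     (\<forall>c. regular_value r c \<longrightarrow>
        (\<exists>\<kappa> :: nat \<Rightarrow> real. (\<forall>i\<in>{1..k}. \<forall>j\<in>{1..k}. i < j \<longrightarrow> \<kappa> j < \<kappa> i) \<and>
           (\<forall>x\<in>sphere 0 1. r x = c \<longrightarrow>
              principal_curvatures r x = \<kappa> ` {1..k} \<and>
              (\<forall>i\<in>{1..k}. dim (principal_space r x (\<kappa> i)) = mu i)))) \<and>
     (k \<in> {1, 3, 6} \<longrightarrow> (\<forall>i\<in>{1..k}. mu i = mu 1)) \<and>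
     (k \<in> {2, 4} \<longrightarrow> (\<forall>i\<in>{1..k}. mu i = (if odd i then mu 1 else mu 2))) \<and>
     (\<forall>x\<in>sphere 0 1. (norm (gradS r x))\<^sup>2 = (real k)\<^sup>2 * (1 - (r x)\<^sup>2)) \<and>
     (\<forall>x\<in>sphere 0 1. laplS r x =
        (if k \<in> {2, 4} then real (mu 2) - real (mu 1) else 0) / 2 * (real k)\<^sup>2
          - real k * (real n + real k - 1) * r x)"


section \<open>Mean curvature flow and translating solitons in the product of the sphere with the line\<close>

text \<open>Here \<open>M\<close> is a subset of the unit sphere, and \<open>g :: 'a \<Rightarrow> 'a \<times> real\<close> restricts to an
  immersion of \<open>M\<close> into \<open>sphere 0 1 \<times> UNIV\<close>.\<close>

definition normal_space :: "'a::euclidean_space set \<Rightarrow> ('a \<Rightarrow> 'a \<times> real) \<Rightarrow> 'a \<Rightarrow> ('a \<times> real) set" where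
  "normal_space M g x = {w. fst w \<in> sphere_tangent (fst (g x)) \<and> (\<forall>v\<in>sphere_tangent x. w \<bullet> dS M g x v = 0)}"

definition normal_part :: "'a::euclidean_space set \<Rightarrow> ('a \<Rightarrow> 'a \<times> real) \<Rightarrow> 'a \<Rightarrow> 'a \<times> real \<Rightarrow> 'a \<times> real" where
  "normal_part M g x w = orth_proj (normal_space M g x) w"

text \<open>Because the normal space is contained in the tangent space of \<open>sphere 0 1 \<times> UNIV\<close>, the normal
  part of the flat second derivative equals the normal part of the covariant derivative in
  \<open>sphere 0 1 \<times> UNIV\<close>.\<close>

definition second_fundamental_form ::
    "'a::euclidean_space set \<Rightarrow> ('a \<Rightarrow> 'a \<times> real) \<Rightarrow> 'a \<Rightarrow> 'a \<Rightarrow> 'a \<Rightarrow> 'a \<times> real" where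
  "second_fundamental_form M g x v w = normal_part M g x (d2S M g x v w)"

text \<open>The mean curvature vector is the (unnormalized) trace with respect to the induced metric.\<close>

definition mean_curvature_vector ::
    "'a::euclidean_space set \<Rightarrow> ('a \<Rightarrow> 'a \<times> real) \<Rightarrow> 'a \<Rightarrow> 'a \<times> real" where
  "mean_curvature_vector M g x =
     trace_wrt (\<lambda>v w. dS M g x v \<bullet> dS M g x w) (sphere_tangent x) (second_fundamental_form M g x)"

definition mean_curvature_flow_from_graph ::
    "'a::euclidean_space set \<Rightarrow> ('a \<Rightarrow> real) \<Rightarrow> real set \<Rightarrow> (real \<Rightarrow> 'a \<Rightarrow> 'a \<times> real) \<Rightarrow> bool" where
  "mean_curvature_flow_from_graph M u I f \<longleftrightarrow>
     open I \<and> is_interval I \<and> 0 \<in> I \<and>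
     smooth_map_on (I \<times> M) (\<lambda>(t, x). f t x) \<and>
     (\<forall>t\<in>I. \<forall>x\<in>M. f t x \<in> sphere 0 1 \<times> UNIV \<and> inj_on (dS M (f t) x) (sphere_tangent x)) \<and>
     (\<forall>x\<in>M. f 0 x = (x, u x)) \<and>
     (\<forall>t\<in>I. \<forall>x\<in>M. normal_part M (f t) x (vector_derivative (\<lambda>s. f s x) (at t)) =
                   mean_curvature_vector M (f t) x)"

definition vertical_shift :: "real \<Rightarrow> 'a \<times> real \<Rightarrow> 'a \<times> real" where
  "vertical_shift t = (\<lambda>(x, s). (x, s + t))"

definition is_translating_soliton ::
    "'a::euclidean_space set \<Rightarrow> real set \<Rightarrow> (real \<Rightarrow> 'a \<Rightarrow> 'a \<times> real) \<Rightarrow> bool" where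
  "is_translating_soliton M I f \<longleftrightarrow>
     (let h = (\<lambda>t. inv (vertical_shift t) \<circ> f t) in
        \<forall>t\<in>I. \<forall>x\<in>M. normal_part M (h t) x (vector_derivative (\<lambda>s. h s x) (at t)) = 0)"

end

theory Submission
  imports Defs
begin

text \<open>The normal space of the graph of \<open>V \<circ> r\<close> is a line, so at time \<open>0\<close> the soliton condition becomes
  one scalar equation. The identities for \<open>|\<nabla>r|\<^sup>2\<close> and \<open>\<Delta>r\<close>, the first one differentiated along
  \<open>\<nabla>r\<close>, turn it into an ODE for \<open>w = V'\<close>, cubic in \<open>w\<close>, with leading coefficient
  \<open>k (n - 1) (x - R)\<close>. At a zero of \<open>w\<close> the derivative is positive, so \<open>w\<close> changes sign at most once, from
  negative to positive. To the right, a maximal solution either blows up at some \<open>b < 1\<close>, and then \<open>b > R\<close>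
  because the cubic term has the wrong sign left of \<open>R\<close>, or it reaches the singular point \<open>1\<close>; in
  this case \<open>Z = |\<nabla>r|\<^sup>2 w\<^sup>2\<close> would satisfy a Riccati inequality unless \<open>w\<close> is negative and bounded, and
  bounded solutions of the singular ODE are smooth up to the end point. The reflection
  \<open>w(x) \<mapsto> - w(- x)\<close>, \<open>R \<mapsto> - R\<close> gives the same at the left end. That \<open>R\<close> lies in \<open>(-1, 1)\<close> follows from
  the spectral theorem for the shape operator: the multiplicities add up to \<open>n - 1\<close>.\<close>

section \<open>Smooth functions on intervals\<close>


text \<open>\<open>R\<close> is the level whose hypersurface is minimal: up to sign, the mean
  curvature of a level of \<open>r\<close> is
  \<open>(\<beta> - \<alpha>' / 2) / sqrt \<alpha>\<close>, with numerator
  \<open>- N * (x - R)\<close> for \<open>N = k * (n - 1)\<close>. For steep graphs this term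
  dominates the equation, so a solution can blow up at its right end only to the right of
  \<open>R\<close>, and at its left end only to the left.

  Three levels need special care. At 1 and -1, the focal levels, \<alpha> vanishes to first order:
  continuation stops there, and regularity up to the end point needs a linear theory of its own. The
  Riccati argument works because the integral of \<open>1 / \<alpha>\<close> diverges at these
  points. At \<open>R\<close> itself the cubic term vanishes, so its sign alone cannot exclude a
  positive blow-up exactly there; the oscillation of the linearized equation for
  \<open>1 / w\<close> does.

  The ODE is derived only at levels interior to \<open>J\<close>, where the domain of the graph is a
  neighbourhood in the sphere. An end point belonging to \<open>J\<close> is recovered afterwards:
  \<open>V'\<close> is continuous there, whereas a maximal solution tends to infinity at an end that
  its domain does not contain.\<close>

primrec ck_on :: "nat \<Rightarrow> (real \<Rightarrow> real) \<Rightarrow> real set \<Rightarrow> bool" where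
  "ck_on 0 f S \<longleftrightarrow> continuous_on S f"
| "ck_on (Suc j) f S \<longleftrightarrow>
    (\<exists>f'. (\<forall>x\<in>S. (f has_real_derivative f' x) (at x within S)) \<and> ck_on j f' S)"

lemma ck_on_cong: "(\<And>x. x \<in> S \<Longrightarrow> f x = g x) \<Longrightarrow> ck_on j f S \<longleftrightarrow> ck_on j g S"
proof (cases j)
  case 0
  assume "\<And>x. x \<in> S \<Longrightarrow> f x = g x"
  then show ?thesis using 0 by (simp cong: continuous_on_cong)
next
  case (Suc i)
  assume *: "\<And>x. x \<in> S \<Longrightarrow> f x = g x"
  have "(f has_real_derivative d) (at x within S) \<longleftrightarrow> (g has_real_derivative d) (at x within S)"
    if "x \<in> S" for x d
    using has_field_derivative_cong_ev[of x x S f g d d] that * by (auto intro: always_eventually)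
  then show ?thesis using Suc by simp
qed

lemma ck_on_SucD: "ck_on (Suc j) f S \<Longrightarrow> ck_on j f S"
proof (induction j arbitrary: f)
  case 0
  then show ?case by (auto simp: continuous_on_eq_continuous_within intro: DERIV_continuous)
next
  case (Suc j)
  then show ?case by (metis ck_on.simps(2))
qed

lemma ck_on_continuous: "ck_on j f S \<Longrightarrow> continuous_on S f"
  by (induction j) (auto dest: ck_on_SucD simp del: ck_on.simps(2))

lemma ck_on_const [intro]: "ck_on j (\<lambda>x. c) S"
  by (induction j arbitrary: c) (auto intro!: exI[of _ "\<lambda>x. 0"])

lemma ck_on_ident [intro]: "ck_on j (\<lambda>x. x) S"
  by (cases j) (auto intro!: exI[of _ "\<lambda>x. 1"])

lemma ck_on_add [intro]: "ck_on j f S \<Longrightarrow> ck_on j g S \<Longrightarrow> ck_on j (\<lambda>x. f x + g x) S"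
proof (induction j arbitrary: f g)
  case 0
  then show ?case by (auto intro: continuous_on_add)
next
  case (Suc j)
  then obtain f' g' where "\<forall>x\<in>S. (f has_real_derivative f' x) (at x within S)" "ck_on j f' S"
    "\<forall>x\<in>S. (g has_real_derivative g' x) (at x within S)" "ck_on j g' S" by auto
  with Suc.IH show ?case by (auto intro!: exI[of _ "\<lambda>x. f' x + g' x"] DERIV_add)
qed

lemma ck_on_mult [intro]: "ck_on j f S \<Longrightarrow> ck_on j g S \<Longrightarrow> ck_on j (\<lambda>x. f x * g x) S"
proof (induction j arbitrary: f g)
  case 0
  then show ?case by (auto intro: continuous_on_mult)
next
  case (Suc j)
  then obtain f' g' where d: "\<forall>x\<in>S. (f has_real_derivative f' x) (at x within S)" "ck_on j f' S"
    "\<forall>x\<in>S. (g has_real_derivative g' x) (at x within S)" "ck_on j g' S" by auto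
  have "ck_on j (\<lambda>x. f' x * g x + g' x * f x) S"
    using Suc d by (intro ck_on_add Suc.IH) (auto dest: ck_on_SucD simp del: ck_on.simps(2))
  with d show ?case by (auto intro!: exI[of _ "\<lambda>x. f' x * g x + g' x * f x"] DERIV_mult)
qed

lemma ck_on_minus [intro]: "ck_on j f S \<Longrightarrow> ck_on j (\<lambda>x. - f x) S"
  using ck_on_mult[OF ck_on_const[of j "-1"], of f S] by simp

lemma ck_on_diff [intro]: "ck_on j f S \<Longrightarrow> ck_on j g S \<Longrightarrow> ck_on j (\<lambda>x. f x - g x) S"
  using ck_on_add[OF _ ck_on_minus, of j f S g] by simp

lemma ck_on_power [intro]: "ck_on j f S \<Longrightarrow> ck_on j (\<lambda>x. f x ^ n) S"
  by (induction n) auto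

lemma ck_on_inverse [intro]:
  "ck_on j f S \<Longrightarrow> (\<And>x. x \<in> S \<Longrightarrow> f x \<noteq> 0) \<Longrightarrow> ck_on j (\<lambda>x. inverse (f x)) S"
proof (induction j)
  case 0
  then show ?case by (auto intro: continuous_on_inverse)
next
  case (Suc j)
  then obtain f' where d: "\<forall>x\<in>S. (f has_real_derivative f' x) (at x within S)" "ck_on j f' S"
    by auto
  have i: "ck_on j (\<lambda>x. inverse (f x)) S"
    using Suc ck_on_SucD by blast
  have "ck_on j (\<lambda>x. - (inverse (f x) * f' x * inverse (f x))) S"
    using i d by (intro ck_on_minus ck_on_mult)
  moreover have "\<forall>x\<in>S. ((\<lambda>x. inverse (f x)) has_real_derivative
      - (inverse (f x) * f' x * inverse (f x))) (at x within S)"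
    using d(1) Suc.prems(2) by (auto intro!: DERIV_inverse')
  ultimately show ?case
    unfolding ck_on.simps by (intro exI[of _ "\<lambda>x. - (inverse (f x) * f' x * inverse (f x))"]) simp
qed

lemma ck_on_divide [intro]:
  "ck_on j f S \<Longrightarrow> ck_on j g S \<Longrightarrow> (\<And>x. x \<in> S \<Longrightarrow> g x \<noteq> 0) \<Longrightarrow> ck_on j (\<lambda>x. f x / g x) S"
  unfolding divide_inverse by (intro ck_on_mult ck_on_inverse)

lemma ck_on_reflect: "ck_on j f S \<Longrightarrow> ck_on j (\<lambda>x. f (- x)) (uminus ` S)"
proof (induction j arbitrary: f)
  case 0
  then show ?case
    by (auto intro!: continuous_on_compose2[of S f] continuous_intros)
next
  case (Suc j)
  then obtain f' where d: "\<forall>x\<in>S. (f has_real_derivative f' x) (at x within S)" "ck_on j f' S"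
    by auto
  have "((\<lambda>x. f (- x)) has_real_derivative - f' (- x)) (at x within uminus ` S)"
    if "x \<in> uminus ` S" for x
  proof -
    have "(f has_real_derivative f' (- x)) (at (- x) within uminus ` (uminus ` S))"
      using that d(1) by (auto simp: image_image)
    then have "((\<lambda>x. f (- x)) has_real_derivative f' (- x) * (- 1)) (at x within uminus ` S)"
      using DERIV_image_chain[of f "f' (- x)" uminus x "uminus ` S" "- 1"]
        DERIV_minus[OF DERIV_ident, of x "uminus ` S"]
      by (simp add: o_def)
    then show ?thesis by simp
  qed
  moreover have "ck_on j (\<lambda>x. - f' (- x)) (uminus ` S)" using Suc.IH d by auto
  ultimately show ?case unfolding ck_on.simps by (intro exI[of _ "\<lambda>x. - f' (- x)"]) auto
qed

text \<open>\<open>ck_on j\<close> hides a separate chain of derivatives for every \<open>j\<close>,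
  whereas \<open>smooth_on_interval\<close> asks for one sequence. At a point that is not isolated
  in \<open>S\<close> the derivative within \<open>S\<close> is unique, so the chains agree, and
  iterating the canonical derivative \<open>d\<close> gives the sequence.\<close>

lemma smooth_on_interval_if_ck_on:
  assumes ck: "\<And>j. ck_on j f S" and lim: "\<And>x. x \<in> S \<Longrightarrow> at x within S \<noteq> bot"
  shows "smooth_on_interval S f"
proof -
  define d :: "(real \<Rightarrow> real) \<Rightarrow> real \<Rightarrow> real"
    where "d g x = vector_derivative g (at x within S)" for g x
  have step: "(\<forall>j. ck_on j (d g) S) \<and> (\<forall>x\<in>S. (g has_real_derivative d g x) (at x within S))"
    if g: "\<And>j. ck_on j g S" for g
  proof -
    have "\<exists>g'. (\<forall>x\<in>S. (g has_real_derivative g' x) (at x within S)) \<and> ck_on j g' S" for j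
      using g[of "Suc j"] by simp
    moreover have "d g x = g' x" if "(g has_real_derivative g' x) (at x within S)" "x \<in> S" for g' x
      unfolding d_def using that lim
      by (intro vector_derivative_within) (auto simp: has_real_derivative_iff_has_vector_derivative)
    ultimately have "ck_on j (d g) S \<and> (\<forall>x\<in>S. (g has_real_derivative d g x) (at x within S))" for j
      by (metis ck_on_cong)
    then show ?thesis by blast
  qed
  have "\<forall>j. ck_on j ((d ^^ i) f) S" for i
    by (induction i) (use ck step in auto)
  with step show ?thesis unfolding smooth_on_interval_def
    by (intro exI[of _ "\<lambda>i. (d ^^ i) f"]) auto
qed

section \<open>Antiderivatives, linear equations and barriers\<close>

lemma antiderivative_on_interval:
  fixes W :: "real \<Rightarrow> real"
  assumes S: "is_interval S" and W: "continuous_on S W"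
  obtains F where "\<And>x. x \<in> S \<Longrightarrow> (F has_real_derivative W x) (at x within S)"
proof (cases "S = {}")
  case False
  then obtain s where s: "s \<in> S" by auto
  \<comment> \<open>One of the two intervals is empty or a point, so this is the signed integral
    from \<open>s\<close> to \<open>x\<close>.\<close>
  define F where "F x = integral {s..x} W - integral {x..s} W" for x
  have "(F has_real_derivative W x) (at x within S)" if x: "x \<in> S" for x
  proof -
    \<comment> \<open>\<open>{a..b}\<close> will be a compact piece of \<open>S\<close> containing
      \<open>s\<close> and a neighbourhood of \<open>x\<close> relative to \<open>S\<close>:
      \<open>a = x\<close> is allowed only if \<open>x\<close> is the left end of \<open>S\<close>,
      and similarly for \<open>b\<close>.\<close>
    have "\<exists>a\<in>S. a \<le> x \<and> a \<le> s \<and> (a < x \<or> S \<subseteq> {x..})"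
      using x s by (metis atLeast_iff linorder_le_cases linorder_not_less order.trans subsetI order_less_imp_le)
    then obtain a where a: "a \<in> S" "a \<le> x" "a \<le> s" "a < x \<or> S \<subseteq> {x..}" by auto
    have "\<exists>b\<in>S. x \<le> b \<and> s \<le> b \<and> (x < b \<or> S \<subseteq> {..x})"
      using x s by (metis atMost_iff linorder_le_cases linorder_not_less order.trans subsetI order_less_imp_le)
    then obtain b where b: "b \<in> S" "x \<le> b" "s \<le> b" "x < b \<or> S \<subseteq> {..x}" by auto
    have ab: "{a..b} \<subseteq> S" using S a(1) b(1) by (meson atLeastAtMost_iff mem_is_interval_1_I subsetI)
    have cont: "continuous_on {a..b} W" using W ab continuous_on_subset by blast
    have eq: "F y = integral {a..y} W - integral {a..s} W" if "y \<in> {a..b}" for y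
    proof -
      have int: "W integrable_on {a..b}" using cont by (rule integrable_continuous_real)
      show ?thesis
      proof (cases "s \<le> y")
        case True
        have "integral {a..s} W + integral {s..y} W = integral {a..y} W"
          using True a(3) that
          by (intro Henstock_Kurzweil_Integration.integral_combine integrable_subinterval_real[OF int]) auto
        moreover have "integral {y..s} W = 0" using True by (cases "y = s") auto
        ultimately show ?thesis by (simp add: F_def)
      next
        case False
        have "integral {a..y} W + integral {y..s} W = integral {a..s} W"
          using False b(3) that
          by (intro Henstock_Kurzweil_Integration.integral_combine integrable_subinterval_real[OF int]) auto
        moreover have "integral {s..y} W = 0" using False by auto
        ultimately show ?thesis by (simp add: F_def)
      qed
    qed
    have "((\<lambda>u. integral {a..u} W) has_real_derivative W x) (at x within {a..b})"
      using integral_has_real_derivative[OF cont] a b by auto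
    then have "((\<lambda>u. integral {a..u} W - integral {a..s} W) has_real_derivative W x) (at x within {a..b})"
      by (auto intro!: derivative_eq_intros)
    then have "(F has_real_derivative W x) (at x within {a..b})"
      by (rule has_field_derivative_transform_within[of _ _ _ _ 1]) (use eq a b in auto)
    moreover have "at x within {a..b} = at x within S"
    proof (rule at_within_nhd)
      let ?U = "(if a < x then {a<..} else UNIV) \<inter> (if x < b then {..<b} else UNIV)"
      show "x \<in> ?U" by auto
      show "open ?U" by auto
      show "{a..b} \<inter> ?U - {x} = S \<inter> ?U - {x}"
        using ab a b by (force split: if_splits)
    qed
    ultimately show ?thesis by simp
  qed
  then show ?thesis using that by blast
qed (use that in auto)

text \<open>The integrating factor \<open>exp (- Q)\<close>, with \<open>Q\<close> an antiderivative
  of \<open>q\<close>, turns \<open>e\<close> into a function with derivative zero; it vanishes at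
  \<open>z\<close>, hence everywhere.\<close>

lemma linear_ode_zero:
  fixes e q :: "real \<Rightarrow> real"
  assumes q: "continuous_on {a..b} q" and e: "continuous_on {a..b} e"
    and d: "\<And>x. a < x \<Longrightarrow> x < b \<Longrightarrow> (e has_real_derivative q x * e x) (at x)"
    and z: "z \<in> {a..b}" "e z = 0" and x: "x \<in> {a..b}"
  shows "e x = 0"
proof -
  obtain Q where Q: "\<And>x. x \<in> {a..b} \<Longrightarrow> (Q has_real_derivative q x) (at x within {a..b})"
    using antiderivative_on_interval[of "{a..b}" q] q by (auto simp: is_interval_cc)
  define h where "h x = e x * exp (- Q x)" for x
  have "continuous_on {a..b} Q"
    using Q by (meson DERIV_continuous continuous_on_eq_continuous_within)
  then have cont: "continuous_on {a..b} h" unfolding h_def using e by (intro continuous_intros)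
  have dh: "(h has_real_derivative 0) (at x)" if "a < x" "x < b" for x
  proof -
    have "(Q has_real_derivative q x) (at x)"
      using Q[of x] that at_within_Icc_at[of a x b] by auto
    with d[OF that] show ?thesis unfolding h_def
      by (auto intro!: derivative_eq_intros simp: algebra_simps)
  qed
  have "h y = h a" if "y \<in> {a..b}" for y
  proof (cases "a < b")
    case True
    then show ?thesis using that DERIV_isconst2[OF _ cont dh, of y] by auto
  next
    case False
    then have "y = a" using that by auto
    then show ?thesis by simp
  qed
  then have "h x = h z" using z x by metis
  then show ?thesis using z by (simp add: h_def)
qed


text \<open>If \<open>f\<close> ended below \<open>c\<close>, then \<open>f z = c\<close> at the
  last point \<open>z\<close> with \<open>f z \<ge> c\<close>, and the positive derivative there
  would produce later such points.\<close>

lemma barrier_le: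
  fixes f f' :: "real \<Rightarrow> real"
  assumes d: "\<And>x. x \<in> {a..b} \<Longrightarrow> (f has_real_derivative f' x) (at x)"
    and ge: "f a \<ge> c" and pos: "\<And>x. x \<in> {a..b} \<Longrightarrow> f x = c \<Longrightarrow> f' x > 0" and ab: "a \<le> b"
  shows "f b \<ge> c"
proof (rule ccontr)
  assume lt: "\<not> f b \<ge> c"
  have cont: "continuous_on {a..b} f"
    using d by (meson DERIV_atLeastAtMost_imp_continuous_on atLeastAtMost_iff)
  define T where "T = {x\<in>{a..b}. c \<le> f x}"
  have "closed T" unfolding T_def
    using continuous_closed_preimage[OF cont closed_atLeastAtMost, of "{c..}"]
    by (simp add: vimage_def Int_def)
  moreover have "bounded T" by (rule bounded_subset[of "{a..b}"]) (auto simp: T_def)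
  ultimately have T: "compact T" by (simp add: compact_eq_bounded_closed)
  have "a \<in> T" using ge ab by (auto simp: T_def)
  then obtain z where z: "z \<in> T" "\<And>x. x \<in> T \<Longrightarrow> x \<le> z"
    using compact_attains_sup[OF T] by blast
  have zab: "z \<in> {a..b}" "c \<le> f z" using z by (auto simp: T_def)
  have zb: "z < b" using zab lt by (cases "z = b") auto
  obtain x where x: "z \<le> x" "x \<le> b" "f x = c"
    using IVT2'[of f b c z] lt zab continuous_on_subset[OF cont, of "{z..b}"] by auto
  then have "x = z" using z(2)[of x] zab by (force simp: T_def)
  then have fz: "f z = c" using x by simp
  obtain e where e: "e > 0" "\<And>h. 0 < h \<Longrightarrow> h < e \<Longrightarrow> f z < f (z + h)"
    using DERIV_pos_inc_right[OF d[OF zab(1)]] pos[OF zab(1)] fz by blast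
  define h where "h = min (e/2) (b - z)"
  have h: "0 < h" "h < e" "h \<le> b - z" using e zb by (auto simp: h_def)
  then have "z + h \<in> T" using e(2)[of h] zab by (auto simp: T_def)
  then show False using z(2)[of "z+h"] h by simp
qed

text \<open>Equality at \<open>b\<close> would push \<open>f\<close> below \<open>c\<close> just
  before \<open>b\<close>, against the weak form on a shorter interval.\<close>

lemma barrier_less:
  fixes f f' :: "real \<Rightarrow> real"
  assumes d: "\<And>x. x \<in> {a..b} \<Longrightarrow> (f has_real_derivative f' x) (at x)"
    and ge: "f a \<ge> c" and pos: "\<And>x. x \<in> {a..b} \<Longrightarrow> f x = c \<Longrightarrow> f' x > 0" and ab: "a < b"
  shows "f b > c"
proof (rule ccontr)
  assume "\<not> f b > c"
  moreover have "f b \<ge> c" using barrier_le[of a b f f' c] assms by simp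
  ultimately have fb: "f b = c" by simp
  obtain e where e: "e > 0" "\<And>h. 0 < h \<Longrightarrow> h < e \<Longrightarrow> f (b - h) < f b"
    using DERIV_pos_inc_left[OF d[of b]] pos[of b] fb ab by auto
  define h where "h = min (e/2) (b - a)"
  have h: "0 < h" "h < e" "a \<le> b - h" "b - h < b" using e ab by (auto simp: h_def)
  have "f (b - h) \<ge> c" using h by (intro barrier_le[of a "b - h" f f' c] d ge pos) auto
  then show False using e(2)[OF h(1,2)] fb by simp
qed

section \<open>Scalar ODEs with cubic right-hand side\<close>


text \<open>The integral operator has Lipschitz constant \<open>L * (b - a) < 1\<close> in the sup
  norm, so a single application of Banach's fixed point theorem covers all of
  \<open>{a..b}\<close>.\<close>

lemma picard_lipschitz:
  fixes \<Phi> :: "real \<Rightarrow> real \<Rightarrow> real"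
  assumes ab: "a \<le> b" and cont: "continuous_on ({a..b} \<times> UNIV) (\<lambda>(t, w). \<Phi> t w)"
    and lip: "\<And>t v w. t \<in> {a..b} \<Longrightarrow> \<bar>\<Phi> t v - \<Phi> t w\<bar> \<le> L * \<bar>v - w\<bar>"
    and L: "0 \<le> L" "L * (b - a) < 1"
  obtains v where "v a = w0"
    "\<And>t. t \<in> {a..b} \<Longrightarrow> (v has_real_derivative \<Phi> t (v t)) (at t within {a..b})"
proof -
  \<comment> \<open>The bounded continuous functions live on the whole line; clamping the argument
    to \<open>{a..b}\<close> makes the operator map this space into itself.\<close>
  define cl where "cl t = max a (min b t)" for t
  have cl: "cl t \<in> {a..b}" "t \<in> {a..b} \<Longrightarrow> cl t = t" for t using ab by (auto simp: cl_def)
  have ccl: "continuous_on UNIV cl" unfolding cl_def by (intro continuous_intros)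
  have cPhi: "continuous_on {a..b} (\<lambda>t. \<Phi> t (v t))" if "continuous_on {a..b} v" for v
  proof -
    have "continuous_on {a..b} (\<lambda>t. (\<lambda>(t, w). \<Phi> t w) (t, v t))"
      by (rule continuous_on_compose2[OF cont]) (use that in \<open>auto intro!: continuous_on_Pair continuous_on_id\<close>)
    then show ?thesis by simp
  qed
  define T where "T v t = w0 + integral {a..cl t} (\<lambda>s. \<Phi> s (apply_bcontfun v s))" for v t
  have vc: "continuous_on {a..b} (apply_bcontfun v)" for v :: "real \<Rightarrow>\<^sub>C real"
    by (rule continuous_on_apply_bcontfun)
  have T: "T v \<in> bcontfun" for v
  proof -
    have c: "continuous_on {a..b} (\<lambda>t. integral {a..t} (\<lambda>s. \<Phi> s (apply_bcontfun v s)))"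
      by (intro indefinite_integral_continuous_1 integrable_continuous_real cPhi vc)
    then have "bounded ((\<lambda>t. integral {a..t} (\<lambda>s. \<Phi> s (apply_bcontfun v s))) ` {a..b})"
      by (intro compact_imp_bounded compact_continuous_image) auto
    then obtain C where
      "\<forall>y\<in>(\<lambda>t. integral {a..t} (\<lambda>s. \<Phi> s (apply_bcontfun v s))) ` {a..b}. norm y \<le> C"
      unfolding bounded_iff by blast
    then have C: "\<bar>integral {a..t} (\<lambda>s. \<Phi> s (apply_bcontfun v s))\<bar> \<le> C" if "t \<in> {a..b}" for t
      using that by simp
    then have "norm (T v t) \<le> \<bar>w0\<bar> + C" for t
    proof -
      have "norm (T v t) \<le> \<bar>w0\<bar> + \<bar>integral {a..cl t} (\<lambda>s. \<Phi> s (apply_bcontfun v s))\<bar>"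
        unfolding T_def real_norm_def by (rule abs_triangle_ineq)
      also have "\<dots> \<le> \<bar>w0\<bar> + C" by (rule add_left_mono) (rule C[OF cl(1)])
      finally show ?thesis .
    qed
    then have "bounded (range (T v))" by (auto simp: bounded_iff)
    moreover have "continuous_on UNIV (T v)" unfolding T_def
      by (intro continuous_intros continuous_on_compose2[OF c ccl]) (use cl in auto)
    ultimately show ?thesis by (auto simp: bcontfun_def)
  qed
  define TT where "TT v = Bcontfun (T v)" for v
  have TT: "apply_bcontfun (TT v) = T v" for v
    unfolding TT_def using T by (simp add: Bcontfun_inverse)
  have "dist (TT v) (TT w) \<le> L * (b - a) * dist v w" for v w
  proof (rule dist_bound)
    fix t
    let ?v = "\<lambda>s. \<Phi> s (apply_bcontfun v s)" and ?w = "\<lambda>s. \<Phi> s (apply_bcontfun w s)"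
    have sub: "{a..cl t} \<subseteq> {a..b}" using cl[of t] by auto
    have int: "?v integrable_on {a..cl t}" "?w integrable_on {a..cl t}"
      using cPhi[OF vc] sub by (blast intro: integrable_continuous_real continuous_on_subset)+
    have "T v t - T w t = integral {a..cl t} (\<lambda>s. ?v s - ?w s)"
      unfolding T_def using int by (simp add: Henstock_Kurzweil_Integration.integral_diff)
    also have "\<bar>\<dots>\<bar> \<le> L * dist v w * (cl t - a)"
    proof -
      have "norm (integral {a..cl t} (\<lambda>s. ?v s - ?w s)) \<le> L * dist v w * (cl t - a)"
      proof (rule integral_bound)
        show "a \<le> cl t" using cl(1)[of t] by simp
        show "continuous_on {a..cl t} (\<lambda>s. ?v s - ?w s)"
          using cPhi[OF vc] sub by (intro continuous_intros) (blast intro: continuous_on_subset)+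
        fix s assume s: "s \<in> {a..cl t}"
        then have "\<bar>?v s - ?w s\<bar> \<le> L * \<bar>apply_bcontfun v s - apply_bcontfun w s\<bar>"
          using lip sub by blast
        also have "\<dots> \<le> L * dist v w"
          using dist_bounded[of v s w] L by (intro mult_left_mono) (auto simp: dist_real_def)
        finally show "norm (?v s - ?w s) \<le> L * dist v w" by simp
      qed
      then show ?thesis by simp
    qed
    also have "\<dots> \<le> L * dist v w * (b - a)"
      using cl(1)[of t] L by (intro mult_left_mono) auto
    finally show "dist (apply_bcontfun (TT v) t) (apply_bcontfun (TT w) t) \<le> L * (b - a) * dist v w"
      by (simp add: TT dist_real_def mult_ac)
  qed
  then obtain v where v: "TT v = v"
    using banach_fix_type[of "L * (b - a)" TT] L ab by auto
  let ?v = "apply_bcontfun v"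
  have ve: "?v t = w0 + integral {a..t} (\<lambda>s. \<Phi> s (?v s))" if "t \<in> {a..b}" for t
  proof -
    have "?v t = T v t" using TT[of v] unfolding v by (rule fun_cong)
    also have "\<dots> = w0 + integral {a..t} (\<lambda>s. \<Phi> s (?v s))" unfolding T_def using cl(2)[OF that] by simp
    finally show ?thesis .
  qed
  show ?thesis
  proof (rule that[of ?v])
    have "?v a = w0 + integral {a..a} (\<lambda>s. \<Phi> s (?v s))" using ab by (intro ve) auto
    then show "?v a = w0" unfolding cbox_interval[symmetric] integral_refl by simp
    fix t assume t: "t \<in> {a..b}"
    have "((\<lambda>t. w0 + integral {a..t} (\<lambda>s. \<Phi> s (?v s))) has_real_derivative \<Phi> t (?v t)) (at t within {a..b})"
      using integral_has_real_derivative[OF cPhi[OF vc] t] by (auto intro!: derivative_eq_intros)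
    then show "(?v has_real_derivative \<Phi> t (?v t)) (at t within {a..b})"
      by (rule has_field_derivative_transform_within[of _ _ _ _ 1]) (use ve t in auto)
  qed
qed

definition cubic :: "(nat \<Rightarrow> real \<Rightarrow> real) \<Rightarrow> real \<Rightarrow> real \<Rightarrow> real" where
  "cubic c x w = c 0 x + c 1 x * w + c 2 x * w\<^sup>2 + c 3 x * w ^ 3"

definition cubic_solution :: "(nat \<Rightarrow> real \<Rightarrow> real) \<Rightarrow> (real \<Rightarrow> real) \<Rightarrow> real set \<Rightarrow> bool" where
  "cubic_solution c w A \<longleftrightarrow> (\<forall>x\<in>A. (w has_real_derivative cubic c x (w x)) (at x))"

lemma cubic_diff:
  "cubic c x v - cubic c x w = (c 1 x + c 2 x * (v + w) + c 3 x * (v\<^sup>2 + v * w + w\<^sup>2)) * (v - w)"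
  by (simp add: cubic_def algebra_simps power2_eq_square power3_eq_cube)

text \<open>By the factorization in \<open>cubic_diff\<close>, the difference of two solutions
  satisfies a linear equation with a continuous coefficient, so \<open>linear_ode_zero\<close>
  applies.\<close>

lemma cubic_solution_unique:
  assumes c: "\<And>i. continuous_on {a..b} (c i)"
    and v: "continuous_on {a..b} v" "cubic_solution c v {a<..<b}"
    and w: "continuous_on {a..b} w" "cubic_solution c w {a<..<b}"
    and z: "z \<in> {a..b}" "v z = w z" and x: "x \<in> {a..b}"
  shows "v x = w x"
proof -
  define q where "q x = c 1 x + c 2 x * (v x + w x) + c 3 x * ((v x)\<^sup>2 + v x * w x + (w x)\<^sup>2)" for x
  have "v x - w x = 0"
  proof (rule linear_ode_zero[where q = q and e = "\<lambda>x. v x - w x" and a = a and b = b and z = z])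
    show "continuous_on {a..b} q" unfolding q_def using c v w by (intro continuous_intros)
    show "continuous_on {a..b} (\<lambda>x. v x - w x)" using v w by (intro continuous_intros)
    show "((\<lambda>x. v x - w x) has_real_derivative q x * (v x - w x)) (at x)" if "a < x" "x < b" for x
      using v(2) w(2) that unfolding cubic_solution_def q_def cubic_diff[symmetric]
      by (auto intro!: derivative_intros)
  qed (use z x in auto)
  then show ?thesis by simp
qed

text \<open>The order of quantifiers matters: one step length \<open>d\<close> serves all starting
  points in \<open>{p..q}\<close> and all initial values bounded by \<open>K\<close>. Cutting off
  the argument at height \<open>B\<close> makes the right-hand side Lipschitz, and within time
  \<open>d\<close> the solution cannot leave the range where the cut-off is the identity.\<close>

lemma cubic_local_solution:
  assumes c: "\<And>i. continuous_on {p..q} (c i)" and pq: "p \<le> q"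
  obtains d where "d > 0"
    "\<And>x0 y0. x0 \<in> {p..q} \<Longrightarrow> \<bar>y0\<bar> \<le> K \<Longrightarrow>
       \<exists>v. v x0 = y0 \<and> (\<forall>t\<in>{x0..min q (x0 + d)}.
         (v has_real_derivative cubic c t (v t)) (at t within {x0..min q (x0 + d)}))"
proof (cases "K \<ge> 0")
  case K: True
  define B where "B = K + 1"
  have "\<exists>C. \<forall>x\<in>{p..q}. \<bar>c i x\<bar> \<le> C" for i
  proof -
    have "bounded (c i ` {p..q})" using c by (intro compact_imp_bounded compact_continuous_image) auto
    then show ?thesis by (auto simp: bounded_iff)
  qed
  then obtain C' where C': "\<And>i x. x \<in> {p..q} \<Longrightarrow> \<bar>c i x\<bar> \<le> C' i" by metis
  define C where "C = 1 + \<bar>C' 0\<bar> + \<bar>C' 1\<bar> + \<bar>C' 2\<bar> + \<bar>C' 3\<bar>"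
  have C: "\<bar>c 0 x\<bar> \<le> C" "\<bar>c 1 x\<bar> \<le> C" "\<bar>c 2 x\<bar> \<le> C" "\<bar>c 3 x\<bar> \<le> C" if "x \<in> {p..q}" for x
    using C'[OF that, of 0] C'[OF that, of 1] C'[OF that, of 2] C'[OF that, of 3] by (auto simp: C_def)
  have C0: "C > 0" by (auto simp: C_def)
  define L where "L = C * (1 + 2 * B + 3 * B\<^sup>2)"
  define M where "M = C * (1 + B + B\<^sup>2 + B ^ 3)"
  have B: "B \<ge> 1" using K by (simp add: B_def)
  have L0: "L > 0" unfolding L_def using B C0 by (intro mult_pos_pos) (auto intro!: add_pos_nonneg)
  have M0: "M > 0" unfolding M_def using B C0 by (intro mult_pos_pos) (auto intro!: add_pos_nonneg)
  define tr where "tr w = max (- B) (min B w)" for w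
  have tr: "\<bar>tr w\<bar> \<le> B" "\<bar>tr v - tr w\<bar> \<le> \<bar>v - w\<bar>" "\<bar>w\<bar> \<le> B \<Longrightarrow> tr w = w" for v w
    using B by (auto simp: tr_def)
  have bd: "\<bar>cubic c x w\<bar> \<le> M" if "x \<in> {p..q}" "\<bar>w\<bar> \<le> B" for x w
  proof -
    have "\<bar>c 0 x\<bar> \<le> C" "\<bar>c 1 x * w\<bar> \<le> C * B" "\<bar>c 2 x * w\<^sup>2\<bar> \<le> C * B\<^sup>2" "\<bar>c 3 x * w ^ 3\<bar> \<le> C * B ^ 3"
      using C[OF that(1)] that(2) C0 B power_mono[of "\<bar>w\<bar>" B 2] power_mono[of "\<bar>w\<bar>" B 3]
      by (auto simp: abs_mult power_abs intro!: mult_mono)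
    then show ?thesis unfolding cubic_def M_def by (simp add: algebra_simps)
  qed
  have lip: "\<bar>cubic c x (tr v) - cubic c x (tr w)\<bar> \<le> L * \<bar>v - w\<bar>" if "x \<in> {p..q}" for x v w
  proof -
    let ?v = "tr v" and ?w = "tr w"
    have m: "\<bar>a * b\<bar> \<le> B\<^sup>2" if "\<bar>a\<bar> \<le> B" "\<bar>b\<bar> \<le> B" for a b
      using that B by (auto simp: abs_mult power2_eq_square intro!: mult_mono)
    have "\<bar>?v + ?w\<bar> \<le> 2 * B" using tr(1)[of v] tr(1)[of w] by linarith
    moreover have "\<bar>a + b + d\<bar> \<le> 3 * B\<^sup>2" if "\<bar>a\<bar> \<le> B\<^sup>2" "\<bar>b\<bar> \<le> B\<^sup>2" "\<bar>d\<bar> \<le> B\<^sup>2" for a b d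
      using that by linarith
    then have "\<bar>?v\<^sup>2 + ?v * ?w + ?w\<^sup>2\<bar> \<le> 3 * B\<^sup>2"
      using m[OF tr(1)[of v] tr(1)[of v]] m[OF tr(1)[of v] tr(1)[of w]] m[OF tr(1)[of w] tr(1)[of w]]
      by (simp add: power2_eq_square)
    ultimately have "\<bar>c 1 x\<bar> \<le> C" "\<bar>c 2 x * (?v + ?w)\<bar> \<le> C * (2 * B)"
        "\<bar>c 3 x * (?v\<^sup>2 + ?v * ?w + ?w\<^sup>2)\<bar> \<le> C * (3 * B\<^sup>2)"
      unfolding abs_mult using C[OF that] C0 by (auto intro!: mult_mono)
    then have "\<bar>c 1 x + c 2 x * (?v + ?w) + c 3 x * (?v\<^sup>2 + ?v * ?w + ?w\<^sup>2)\<bar> \<le> L"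
      unfolding L_def by (simp add: algebra_simps)
    then show ?thesis
      unfolding cubic_diff abs_mult using tr(2)[of v w] L0 by (intro mult_mono) auto
  qed
  \<comment> \<open>The first bound makes the Picard operator a contraction; the second keeps the
    growth \<open>M * d\<close> at most \<open>1 = B - K\<close>.\<close>
  define d where "d = min (1 / (2 * L)) (1 / M)"
  have d: "d > 0" "L * d < 1" "M * d \<le> 1"
  proof -
    show "d > 0" using L0 M0 by (auto simp: d_def)
    have "L * d \<le> L * (1 / (2 * L))" using L0 by (intro mult_left_mono) (auto simp: d_def)
    then show "L * d < 1" using L0 by simp
    have "M * d \<le> M * (1 / M)" using M0 by (intro mult_left_mono) (auto simp: d_def)
    then show "M * d \<le> 1" using M0 by simp
  qed
  show ?thesis
  proof (rule that[OF d(1)])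
    fix x0 y0 assume x0: "x0 \<in> {p..q}" and y0: "\<bar>y0\<bar> \<le> K"
    let ?b = "min q (x0 + d)"
    have b: "x0 \<le> ?b" "{x0..?b} \<subseteq> {p..q}" "?b - x0 \<le> d" using x0 d by auto
    have "continuous_on ({x0..?b} \<times> UNIV) (\<lambda>(t, w). cubic c t (tr w))"
    proof -
      have "continuous_on ({x0..?b} \<times> UNIV) (\<lambda>z. c i (fst z))" for i
        by (rule continuous_on_compose2[OF c, of _ fst]) (use b in \<open>auto intro!: continuous_intros\<close>)
      then show ?thesis unfolding cubic_def tr_def case_prod_unfold by (intro continuous_intros)
    qed
    moreover have "L * (?b - x0) < 1"
      using mult_left_mono[OF b(3), of L] L0 d by linarith
    note lipschitz = this calculation
    obtain v where v: "v x0 = y0"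
      "\<And>t. t \<in> {x0..?b} \<Longrightarrow> (v has_real_derivative cubic c t (tr (v t))) (at t within {x0..?b})"
    proof (rule picard_lipschitz[of x0 ?b "\<lambda>t w. cubic c t (tr w)" L y0])
      show "\<bar>cubic c t (tr v) - cubic c t (tr w)\<bar> \<le> L * \<bar>v - w\<bar>" if "t \<in> {x0..?b}" for t v w
        using that b lip by blast
    qed (use b L0 lipschitz in auto)
    have "tr (v t) = v t" if t: "t \<in> {x0..?b}" for t
    proof (rule tr(3))
      have "norm (v t - v x0) \<le> M * norm (t - x0)"
      proof (rule field_differentiable_bound[of "{x0..?b}" v "\<lambda>t. cubic c t (tr (v t))"])
        show "norm (cubic c z (tr (v z))) \<le> M" if "z \<in> {x0..?b}" for z
          using bd tr(1) that b by auto
      qed (use v(2) t b in auto)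
      also have "\<dots> \<le> M * d" using t b M0 by (intro mult_left_mono) auto
      finally show "\<bar>v t\<bar> \<le> B" using d v(1) y0 by (simp add: B_def)
    qed
    with v show "\<exists>v. v x0 = y0 \<and> (\<forall>t\<in>{x0..?b}. (v has_real_derivative cubic c t (v t)) (at t within {x0..?b}))"
      by (intro exI[of _ v]) auto
  qed
next
  case False
  show ?thesis by (rule that[of 1]) (use False in auto)
qed

text \<open>\<open>b\<close> is the supremum of the right ends of solutions extending
  \<open>w0\<close>. If \<open>\<bar>w\<bar>\<close> did not tend to infinity at
  \<open>b < m\<close>, some bound \<open>K\<close> would hold at points arbitrarily close to
  \<open>b\<close>, and the uniform step length of \<open>cubic_local_solution\<close> would carry
  the solution past \<open>b\<close>.\<close>

lemma cubic_continuation: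
  assumes c: "\<And>i. continuous_on {l<..<m} (c i)"
    and w0: "cubic_solution c w0 {l<..<u}" and lu: "l < u" "u \<le> m"
  obtains b w where "u \<le> b" "b \<le> m" "cubic_solution c w {l<..<b}" "\<And>x. x \<in> {l<..<u} \<Longrightarrow> w x = w0 x"
    "b < m \<Longrightarrow> filterlim (\<lambda>x. \<bar>w x\<bar>) at_top (at_left b)"
proof -
  define sol where "sol b w \<longleftrightarrow> u \<le> b \<and> b \<le> m \<and> cubic_solution c w {l<..<b} \<and> (\<forall>x\<in>{l<..<u}. w x = w0 x)" for b w
  have cont: "continuous_on {p..q} w" if "cubic_solution c w A" "{p..q} \<subseteq> A" for p q w A
    using that unfolding cubic_solution_def
    by (intro continuous_at_imp_continuous_on ballI DERIV_isCont) blast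
  have uniq: "w1 x = w2 x" if "sol b1 w1" "sol b2 w2" "l < x" "x < b1" "x < b2" for b1 b2 w1 w2 x
  proof (cases "x < u")
    case False
    define z where "z = (l + u) / 2"
    have z: "l < z" "z < u" using lu by (auto simp: z_def)
    have "w1 x = w2 x"
    proof (rule cubic_solution_unique[where c = c and a = z and b = x and z = z and v = w1 and w = w2 and x = x])
      show "continuous_on {z..x} (c i)" for i
        using c by (rule continuous_on_subset) (use z that False in \<open>auto simp: sol_def\<close>)
      show "continuous_on {z..x} w1"
        by (rule cont[of _ "{l<..<b1}"]) (use that z in \<open>auto simp: sol_def\<close>)
      show "continuous_on {z..x} w2"
        by (rule cont[of _ "{l<..<b2}"]) (use that z in \<open>auto simp: sol_def\<close>)
      show "w1 z = w2 z" using that z by (auto simp: sol_def)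
      show "cubic_solution c w1 {z<..<x}" "cubic_solution c w2 {z<..<x}"
        using that(1,2,4,5) z by (auto simp: sol_def cubic_solution_def)
    qed (use z False in auto)
    then show ?thesis .
  qed (use that in \<open>auto simp: sol_def\<close>)
  define E where "E = {b. \<exists>w. sol b w}"
  have uE: "u \<in> E" using w0 lu by (auto simp: E_def sol_def)
  have Em: "b \<le> m" if "b \<in> E" for b using that by (auto simp: E_def sol_def)
  define b where "b = Sup E"
  have bdd: "bdd_above E" using Em by (auto simp: bdd_above_def)
  have ub: "u \<le> b" unfolding b_def using uE bdd by (rule cSup_upper)
  have bm: "b \<le> m" unfolding b_def using uE Em by (intro cSup_least) auto
  have ex: "\<exists>b' w. x < b' \<and> sol b' w" if "x < b" for x
    using that less_cSup_iff[of E x] uE bdd by (auto simp: b_def E_def)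
  \<comment> \<open>By \<open>uniq\<close>, extensions with different right ends agree where both
    live, so the value does not depend on the extension picked.\<close>
  define w where "w x = (SOME y. \<exists>b' w. x < b' \<and> sol b' w \<and> y = w x)" for x
  have w: "w x = w' x" if "sol b' w'" "l < x" "x < b'" for b' w' x
    unfolding w_def using that by (intro some_equality) (auto dest: uniq)
  have "cubic_solution c w {l<..<b}"
    unfolding cubic_solution_def
  proof
    fix x assume x: "x \<in> {l<..<b}"
    then obtain b' w' where b': "x < b'" "sol b' w'" using ex[of x] by auto
    have "(w' has_real_derivative cubic c x (w' x)) (at x)"
      using b' x by (auto simp: sol_def cubic_solution_def)
    then have "(w has_real_derivative cubic c x (w' x)) (at x)"
      by (rule has_field_derivative_transform_within_open[of _ _ _ "{l<..<b'}"])
        (use b' x w in auto)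
    then show "(w has_real_derivative cubic c x (w x)) (at x)" using w[OF b'(2)] b' x by auto
  qed
  moreover have "w x = w0 x" if "x \<in> {l<..<u}" for x
    using w[of u w0 x] w0 lu that by (auto simp: sol_def)
  ultimately have solb: "sol b w" using ub bm by (auto simp: sol_def)
  have "filterlim (\<lambda>x. \<bar>w x\<bar>) at_top (at_left b)" if "b < m"
  proof (rule ccontr)
    assume "\<not> filterlim (\<lambda>x. \<bar>w x\<bar>) at_top (at_left b)"
    then obtain K where K: "\<not> eventually (\<lambda>x. K \<le> \<bar>w x\<bar>) (at_left b)"
      by (auto simp: filterlim_at_top)
    define p where "p = (l + b) / 2" define q where "q = (b + m) / 2"
    have pq: "l < p" "p < b" "b < q" "q < m" using lu ub that by (auto simp: p_def q_def)
    obtain d where d: "d > 0"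
      "\<And>x0 y0. x0 \<in> {p..q} \<Longrightarrow> \<bar>y0\<bar> \<le> K \<Longrightarrow>
       \<exists>v. v x0 = y0 \<and> (\<forall>t\<in>{x0..min q (x0 + d)}.
         (v has_real_derivative cubic c t (v t)) (at t within {x0..min q (x0 + d)}))"
    proof (rule cubic_local_solution[of p q c K])
      show "continuous_on {p..q} (c i)" for i
        using c by (rule continuous_on_subset) (use pq in auto)
    qed (use pq in auto)
    have pdb: "max p (b - d) < b" using pq d by auto
    obtain x where x: "max p (b - d) < x" "x < b" "\<bar>w x\<bar> \<le> K"
    proof (atomize_elim, rule ccontr)
      assume *: "\<not> (\<exists>x>max p (b - d). x < b \<and> \<bar>w x\<bar> \<le> K)"
      have "K \<le> \<bar>w x\<bar>" if "max p (b - d) < x" "x < b" for x using * that by force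
      with pdb show False using K unfolding eventually_at_left_field by blast
    qed
    define e where "e = min q (x + d)"
    have e: "b < e" "e < m" using x pq by (auto simp: e_def)
    obtain v where v: "v x = w x"
      "\<And>t. t \<in> {x..e} \<Longrightarrow> (v has_real_derivative cubic c t (v t)) (at t within {x..e})"
      using d(2)[of x "w x"] x pq unfolding e_def by auto
    have v': "cubic_solution c v {x<..<e}"
      unfolding cubic_solution_def
    proof
      fix t assume t: "t \<in> {x<..<e}"
      then show "(v has_real_derivative cubic c t (v t)) (at t)"
        using v(2)[of t] at_within_Icc_at[of x t e] by simp
    qed
    have vw: "v t = w t" if t: "x \<le> t" "t < b" for t
    proof (rule cubic_solution_unique[where c = c and a = x and b = t and z = x and v = v and w = w and x = t])
      show "continuous_on {x..t} (c i)" for i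
        using c by (rule continuous_on_subset) (use x pq t e in auto)
      have "continuous_on {x..e} v" using v(2) by (meson DERIV_continuous continuous_on_eq_continuous_within)
      then show "continuous_on {x..t} v" by (rule continuous_on_subset) (use t e in auto)
      show "continuous_on {x..t} w"
        using solb x t pq by (auto simp: sol_def intro!: cont[of _ "{l<..<b}"])
      show "cubic_solution c v {x<..<t}" using v' t e by (auto simp: cubic_solution_def)
      show "cubic_solution c w {x<..<t}" using solb t x pq by (auto simp: cubic_solution_def sol_def)
    qed (use v t in auto)
    \<comment> \<open>Past \<open>x\<close> the local solution takes over. By \<open>vw\<close> both
      pieces agree between \<open>x\<close> and \<open>b\<close>, so \<open>w'\<close> is
      differentiable at the seam.\<close>
    define w' where "w' t = (if t \<le> x then w t else v t)" for t
    have "(w' has_real_derivative cubic c t (w' t)) (at t)" if t: "t \<in> {l<..<e}" for t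
    proof (cases "t < b")
      case True
      have eq: "w s = w' s" if "s \<in> {l<..<b}" for s using vw that by (auto simp: w'_def)
      have "(w has_real_derivative cubic c t (w t)) (at t)"
        using solb True t by (auto simp: sol_def cubic_solution_def)
      then have "(w' has_real_derivative cubic c t (w t)) (at t)"
        by (rule has_field_derivative_transform_within_open[of _ _ _ "{l<..<b}"]) (use True t eq in auto)
      then show ?thesis using eq True t by auto
    next
      case False
      have "(v has_real_derivative cubic c t (v t)) (at t)"
        using v' False t x by (auto simp: cubic_solution_def)
      then have "(w' has_real_derivative cubic c t (v t)) (at t)"
        by (rule has_field_derivative_transform_within_open[of _ _ _ "{x<..<e}"])
          (use False t x in \<open>auto simp: w'_def\<close>)
      then show ?thesis using False x by (auto simp: w'_def)
    qed
    moreover have "w' t = w0 t" if "t \<in> {l<..<u}" for t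
      using solb that ub vw by (auto simp: sol_def w'_def)
    ultimately have "e \<in> E" using e ub by (auto simp: E_def sol_def cubic_solution_def intro!: exI[of _ w'])
    then have "e \<le> b" unfolding b_def using bdd by (rule cSup_upper)
    then show False using e by simp
  qed
  with solb show ?thesis by (intro that[of b w]) (auto simp: sol_def)
qed

section \<open>Linear ODEs with a regular singular end point\<close>

text \<open>Subtracting an antiderivative \<open>F\<close> of \<open>g\<close> leaves a function
  that is continuous up to \<open>b\<close> and has derivative zero in the interior, hence a
  constant; the one-sided derivative at \<open>b\<close> is inherited from \<open>F\<close>.\<close>

lemma derivative_extends:
  fixes f g :: "real \<Rightarrow> real"
  assumes f: "continuous_on {a<..b} f" and g: "continuous_on {a<..b} g"
    and d: "\<And>x. x \<in> {a<..<b} \<Longrightarrow> (f has_real_derivative g x) (at x)" and x: "x \<in> {a<..b}"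
  shows "(f has_real_derivative g x) (at x within {a<..b})"
proof -
  obtain F where F: "\<And>x. x \<in> {a<..b} \<Longrightarrow> (F has_real_derivative g x) (at x within {a<..b})"
    using antiderivative_on_interval[OF _ g] by (metis is_interval_oc)
  have dF: "(F has_real_derivative g x) (at x)" if "x \<in> {a<..<b}" for x
  proof -
    have "at x within {a<..b} = at x"
      by (rule at_within_open_subset[of _ "{a<..<b}"]) (use that in auto)
    then show ?thesis using F[of x] that by auto
  qed
  have "continuous_on {a<..b} F"
    using F by (meson DERIV_continuous continuous_on_eq_continuous_within)
  then have cont: "continuous_on {a<..b} (\<lambda>x. f x - F x)" using f by (intro continuous_intros)
  have eq: "f y - F y = f b - F b" if y: "y \<in> {a<..b}" for y
  proof (cases "y < b")
    case True
    show ?thesis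
      by (rule DERIV_isconst2[OF True continuous_on_subset[OF cont], symmetric])
        (use y True DERIV_diff[OF d dF] in auto)
  qed (use y in auto)
  have "((\<lambda>y. F y + (f b - F b)) has_real_derivative g x) (at x within {a<..b})"
    using F[OF x] by (auto intro!: derivative_eq_intros)
  then show ?thesis
    by (rule has_field_derivative_transform_within[of _ _ _ _ 1]) (use x eq in \<open>auto simp: algebra_simps\<close>)
qed

text \<open>This is L'Hopital's rule for \<open>(1 - x) powr \<mu> * v x\<close> over
  \<open>(1 - x) powr \<mu>\<close>: by the equation the quotient of the derivatives is
  \<open>h x / \<mu>\<close>. The hypothesis \<open>lim\<close> excludes the homogeneous solutions,
  multiples of \<open>(1 - x) powr (- \<mu>)\<close>.\<close>

lemma singular_linear_tendsto:
  fixes v v' h :: "real \<Rightarrow> real"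
  assumes \<mu>: "\<mu> > 0" and a: "a < 1"
    and d: "\<And>x. x \<in> {a<..<1} \<Longrightarrow> (v has_real_derivative v' x) (at x)"
    and eq: "\<And>x. x \<in> {a<..<1} \<Longrightarrow> (1 - x) * v' x = \<mu> * v x - h x"
    and h: "(h \<longlongrightarrow> h1) (at_left 1)"
    and lim: "((\<lambda>x. (1 - x) powr \<mu> * v x) \<longlongrightarrow> 0) (at_left 1)"
  shows "(v \<longlongrightarrow> h1 / \<mu>) (at_left 1)"
proof -
  have ev: "eventually (\<lambda>x. x \<in> {a<..<1}) (at_left 1)"
    using eventually_at_left_real[OF a] .
  have "((\<lambda>x. ((1 - x) powr \<mu> * v x) / (1 - x) powr \<mu>) \<longlongrightarrow> h1 / \<mu>) (at_left 1)"
  proof (rule lhopital_left[where f' = "\<lambda>x. (1 - x) powr (\<mu> - 1) * (- h x)" and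
        g' = "\<lambda>x. - \<mu> * (1 - x) powr (\<mu> - 1)"])
    have "((\<lambda>x. (1 - x) powr \<mu>) \<longlongrightarrow> (1 - 1) powr \<mu>) (at_left 1)"
      using \<mu> by (intro tendsto_powr' tendsto_intros) (auto simp: eventually_at_left_field intro!: exI[of _ 0])
    then show "((\<lambda>x. (1 - x) powr \<mu>) \<longlongrightarrow> 0) (at_left 1)" by simp
    show "\<forall>\<^sub>F x in at_left 1. (1 - x) powr \<mu> \<noteq> 0"
      using ev by eventually_elim auto
    show "\<forall>\<^sub>F x in at_left 1. - \<mu> * (1 - x) powr (\<mu> - 1) \<noteq> 0"
      using ev by eventually_elim (use \<mu> in auto)
    have dp: "((\<lambda>x. (1 - x) powr \<mu>) has_real_derivative - \<mu> * (1 - x) powr (\<mu> - 1)) (at x)"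
      if "x \<in> {a<..<1}" for x
      using that by (auto intro!: derivative_eq_intros simp: powr_diff powr_minus)
    show "\<forall>\<^sub>F x in at_left 1. ((\<lambda>x. (1 - x) powr \<mu>) has_real_derivative - \<mu> * (1 - x) powr (\<mu> - 1)) (at x)"
      using ev by eventually_elim (rule dp)
    show "\<forall>\<^sub>F x in at_left 1. ((\<lambda>x. (1 - x) powr \<mu> * v x) has_real_derivative
        (1 - x) powr (\<mu> - 1) * (- h x)) (at x)"
      using ev
    proof eventually_elim
      case (elim x)
      have "(1 - x) powr \<mu> = (1 - x) powr (\<mu> - 1) * (1 - x)" using elim by (simp add: powr_diff)
      then have "- \<mu> * (1 - x) powr (\<mu> - 1) * v x + v' x * (1 - x) powr \<mu> =
          (1 - x) powr (\<mu> - 1) * ((1 - x) * v' x - \<mu> * v x)"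
        by algebra
      also have "\<dots> = (1 - x) powr (\<mu> - 1) * (- h x)" using eq[OF elim] by simp
      finally show ?case by (rule DERIV_cong[OF DERIV_mult[OF dp[OF elim] d[OF elim]]])
    qed
    have "((\<lambda>x. h x / \<mu>) \<longlongrightarrow> h1 / \<mu>) (at_left 1)" using h \<mu> by (intro tendsto_intros) auto
    then show "((\<lambda>x. (1 - x) powr (\<mu> - 1) * (- h x) / (- \<mu> * (1 - x) powr (\<mu> - 1))) \<longlongrightarrow> h1 / \<mu>) (at_left 1)"
      by (rule Lim_transform_eventually) (use ev in eventually_elim, auto)
  qed fact
  then show ?thesis
    by (rule Lim_transform_eventually) (use ev in eventually_elim, auto)
qed

lemma continuous_on_right_end_iff:
  fixes f :: "real \<Rightarrow> real"
  assumes "a < b"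
  shows "continuous_on {a<..b} f \<longleftrightarrow> continuous_on {a<..<b} f \<and> (f \<longlongrightarrow> f b) (at_left b)"
proof -
  have "at x within {a<..b} = at x within {a<..<b}" if "x \<in> {a<..<b}" for x
    by (rule at_within_nhd[of x "{a<..<b}"]) (use that in auto)
  moreover have "at b within {a<..b} = at_left b"
    by (rule at_within_nhd[of b "{a<..}"]) (use assms in auto)
  moreover have "{a<..b} = insert b {a<..<b}" using assms by auto
  ultimately show ?thesis
    unfolding continuous_on_def by auto
qed

text \<open>The type of equation is stable under differentiation: \<open>w = v'\<close> satisfies
  \<open>(1 - x) * w' = (\<mu> + 1) * w - h'\<close>. The induction therefore generalizes over \<mu>
  and \<open>h\<close>.\<close>

lemma ck_on_singular_linear:
  fixes v v' h :: "real \<Rightarrow> real"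
  assumes \<mu>: "\<mu> > 0" and a: "a < 1"
    and d: "\<And>x. x \<in> {a<..<1} \<Longrightarrow> (v has_real_derivative v' x) (at x)"
    and eq: "\<And>x. x \<in> {a<..<1} \<Longrightarrow> (1 - x) * v' x = \<mu> * v x - h x"
    and h: "ck_on j h {a<..1}"
    and lim: "((\<lambda>x. (1 - x) powr \<mu> * v x) \<longlongrightarrow> 0) (at_left 1)"
    and v1: "v 1 = h 1 / \<mu>"
  shows "ck_on j v {a<..1}"
  using \<mu> d eq h lim v1
proof (induction j arbitrary: v v' h \<mu>)
  case 0
  have "continuous_on {a<..<1} v"
    using 0(2) by (meson DERIV_isCont continuous_at_imp_continuous_on)
  moreover have "(h \<longlongrightarrow> h 1) (at_left 1)"
    using 0(4) continuous_on_right_end_iff[OF a, of h] by simp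
  ultimately show ?case
    using singular_linear_tendsto[OF 0(1) a 0(2,3) _ 0(5)] 0(6) continuous_on_right_end_iff[OF a, of v] by simp
next
  case (Suc j)
  note [simp del] = ck_on.simps(2)
  obtain h' where h': "\<And>x. x \<in> {a<..1} \<Longrightarrow> (h has_real_derivative h' x) (at x within {a<..1})" "ck_on j h' {a<..1}"
    using Suc.prems(4) unfolding ck_on.simps(2) by blast
  have hc: "(h \<longlongrightarrow> h 1) (at_left 1)"
    using ck_on_continuous[OF Suc.prems(4)] continuous_on_right_end_iff[OF a, of h] by simp
  have "continuous_on {a<..<1} v"
    using Suc.prems(2) by (meson DERIV_isCont continuous_at_imp_continuous_on)
  then have cv: "continuous_on {a<..1} v"
    using singular_linear_tendsto[OF Suc.prems(1) a Suc.prems(2,3) hc Suc.prems(5)] Suc.prems(6)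
      continuous_on_right_end_iff[OF a, of v] by simp
  \<comment> \<open>Solving the equation for \<open>v'\<close> gives an expression that can be
    differentiated; the value at 1 is the limit prescribed by the differentiated equation.\<close>
  define w where "w x = (if x = 1 then h' 1 / (\<mu> + 1) else (\<mu> * v x - h x) / (1 - x))" for x
  have wv: "w x = v' x" if "x \<in> {a<..<1}" for x
    using Suc.prems(3)[OF that] that by (auto simp: w_def field_simps)
  have "ck_on j w {a<..1}"
  proof (rule Suc.IH)
    show "\<mu> + 1 > 0" using Suc.prems(1) by simp
    fix x assume x: "x \<in> {a<..<1}"
    have "at x within {a<..1} = at x"
      by (rule at_within_open_subset[of _ "{a<..<1}"]) (use x in auto)
    then have hx: "(h has_real_derivative h' x) (at x)" using h'(1)[of x] x by simp
    have "((\<lambda>x. (\<mu> * v x - h x) / (1 - x)) has_real_derivative ((\<mu> + 1) * w x - h' x) / (1 - x)) (at x)"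
      using Suc.prems(2)[OF x] hx x wv[OF x]
      by (auto intro!: derivative_eq_intros simp: divide_simps w_def) (simp add: algebra_simps)
    then show "(w has_real_derivative ((\<mu> + 1) * w x - h' x) / (1 - x)) (at x)"
      by (rule has_field_derivative_transform_within_open[of _ _ _ "{a<..<1}"]) (use x in \<open>auto simp: w_def\<close>)
    show "(1 - x) * (((\<mu> + 1) * w x - h' x) / (1 - x)) = (\<mu> + 1) * w x - h' x" using x by simp
  next
    show "ck_on j h' {a<..1}" by fact
    have weq: "\<mu> * ((1 - x) powr \<mu> * v x) - (1 - x) powr \<mu> * h x = (1 - x) powr (\<mu> + 1) * w x"
      if "x \<in> {a<..<1}" for x
    proof -
      have "(1 - x) * w x = \<mu> * v x - h x" using that by (simp add: w_def)
      moreover have "(1 - x) powr (\<mu> + 1) * w x = (1 - x) powr \<mu> * ((1 - x) * w x)"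
        using that by (simp add: powr_add)
      ultimately show ?thesis by (simp only: right_diff_distrib mult.left_commute)
    qed
    have "((\<lambda>x. \<mu> * ((1 - x) powr \<mu> * v x) - (1 - x) powr \<mu> * h x) \<longlongrightarrow> \<mu> * 0 - (1 - 1) powr \<mu> * h 1) (at_left 1)"
      using Suc.prems(1)
      by (intro tendsto_intros tendsto_powr' Suc.prems(5) hc) (auto simp: eventually_at_left_field intro!: exI[of _ 0])
    then have "((\<lambda>x. \<mu> * ((1 - x) powr \<mu> * v x) - (1 - x) powr \<mu> * h x) \<longlongrightarrow> 0) (at_left 1)" by simp
    then show "((\<lambda>x. (1 - x) powr (\<mu> + 1) * w x) \<longlongrightarrow> 0) (at_left 1)"
      by (rule Lim_transform_eventually)
        (use eventually_at_left_real[OF a] weq in \<open>auto elim: eventually_mono\<close>)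
  qed (simp add: w_def)
  moreover have "(v has_real_derivative w x) (at x within {a<..1})" if "x \<in> {a<..1}" for x
    by (rule derivative_extends[OF cv ck_on_continuous[OF \<open>ck_on j w {a<..1}\<close>]])
      (use that Suc.prems(2) wv in auto)
  ultimately show ?case unfolding ck_on.simps(2) by (intro exI[of _ w]) auto
qed

text \<open>Dividing \<open>z - z 1\<close> by \<open>1 - x\<close> raises the exponent \<open>\<mu>\<close> by one and removes the factor
  \<open>1 - x\<close> in front of \<open>S\<close>; this gains one derivative.\<close>

lemma ck_on_Suc_singular_linear:
  fixes z z' S :: "real \<Rightarrow> real"
  assumes \<mu>: "\<mu> > 0" and a: "a < 1"
    and d: "\<And>x. x \<in> {a<..<1} \<Longrightarrow> (z has_real_derivative z' x) (at x)"
    and eq: "\<And>x. x \<in> {a<..<1} \<Longrightarrow> (1 - x) * z' x = \<mu> * z x - g - (1 - x) * S x"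
    and S: "ck_on j S {a<..1}" and z: "continuous_on {a<..1} z" and z1: "z 1 = g / \<mu>"
  shows "ck_on (Suc j) z {a<..1}"
proof -
  define v where "v x = (if x = 1 then S 1 / (\<mu> + 1) else (z x - z 1) / (1 - x))" for x
  have z': "z' x = \<mu> * v x - S x" if "x \<in> {a<..<1}" for x
  proof -
    have "\<mu> * ((1 - x) * v x) = \<mu> * z x - g" using that z1 \<mu> by (simp add: v_def field_simps)
    then have "(1 - x) * z' x = (1 - x) * (\<mu> * v x - S x)"
      using eq[OF that] by (simp add: algebra_simps)
    then show ?thesis using that by simp
  qed
  have v: "ck_on j v {a<..1}"
  proof (rule ck_on_singular_linear[where \<mu> = "\<mu> + 1" and v' = "\<lambda>x. (z' x + v x) / (1 - x)" and h = S])
    show "\<mu> + 1 > 0" using \<mu> by simp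
    fix x assume x: "x \<in> {a<..<1}"
    have "((\<lambda>x. (z x - z 1) / (1 - x)) has_real_derivative (z' x + v x) / (1 - x)) (at x)"
      using d[OF x] x
      by (auto intro!: derivative_eq_intros simp: divide_simps v_def)
    then show "(v has_real_derivative (z' x + v x) / (1 - x)) (at x)"
      by (rule has_field_derivative_transform_within_open[of _ _ _ "{a<..<1}"]) (use x in \<open>auto simp: v_def\<close>)
    have "z' x + v x = (\<mu> + 1) * v x - S x" using z'[OF x] by (simp add: algebra_simps)
    then show "(1 - x) * ((z' x + v x) / (1 - x)) = (\<mu> + 1) * v x - S x" using x by simp
  next
    have "(z \<longlongrightarrow> z 1) (at_left 1)" using z continuous_on_right_end_iff[OF a, of z] by simp
    then have "((\<lambda>x. (1 - x) powr \<mu> * (z x - z 1)) \<longlongrightarrow> (1 - 1) powr \<mu> * (z 1 - z 1)) (at_left 1)"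
      using \<mu> by (intro tendsto_intros tendsto_powr') (auto simp: eventually_at_left_field intro!: exI[of _ 0])
    then have "((\<lambda>x. (1 - x) powr \<mu> * (z x - z 1)) \<longlongrightarrow> 0) (at_left 1)" by simp
    then show "((\<lambda>x. (1 - x) powr (\<mu> + 1) * v x) \<longlongrightarrow> 0) (at_left 1)"
      by (rule Lim_transform_eventually)
        (use eventually_at_left_real[OF a] in eventually_elim, auto simp: v_def powr_add)
  qed (use a S in \<open>auto simp: v_def\<close>)
  have "ck_on j (\<lambda>x. \<mu> * v x - S x) {a<..1}" using v S by (intro ck_on_diff ck_on_mult ck_on_const)
  moreover have "(z has_real_derivative \<mu> * v x - S x) (at x within {a<..1})" if "x \<in> {a<..1}" for x
    by (rule derivative_extends[OF z ck_on_continuous[OF calculation]]) (use that d z' in auto)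
  ultimately show ?thesis
    unfolding ck_on.simps by (intro exI[of _ "\<lambda>x. \<mu> * v x - S x"]) auto
qed

section \<open>The soliton ODE\<close>


text \<open>With \<open>\<alpha> x = \<kappa>\<^sup>2 (1 - x\<^sup>2)\<close>, \<open>|\<nabla>r|\<^sup>2 = \<alpha> \<circ> r\<close> and \<open>\<Delta>r = \<beta> \<circ> r\<close> the soliton equation for \<open>V \<circ> r\<close> is
  \<open>\<alpha> w' = (1 - \<beta> w) (1 + \<alpha> w\<^sup>2) + \<alpha> \<alpha>' w\<^sup>3 / 2\<close> for \<open>w = V'\<close>. Here \<open>\<beta> x = - (N (x - R) + \<kappa>\<^sup>2 x)\<close>
  with \<open>\<kappa> = k\<close> and \<open>N = k (n - 1)\<close>; dividing by \<open>\<alpha>\<close> gives the coefficients below.\<close>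

definition soliton_coeff :: "real \<Rightarrow> real \<Rightarrow> real \<Rightarrow> nat \<Rightarrow> real \<Rightarrow> real" where
  "soliton_coeff \<kappa> N R i x =
     (if i = 0 then 1 / (\<kappa>\<^sup>2 * (1 - x\<^sup>2))
      else if i = 1 then (N * (x - R) + \<kappa>\<^sup>2 * x) / (\<kappa>\<^sup>2 * (1 - x\<^sup>2))
      else if i = 2 then 1 else N * (x - R))"

lemma cubic_soliton_coeff:
  "cubic (soliton_coeff \<kappa> N R) x w =
     (1 + (N * (x - R) + \<kappa>\<^sup>2 * x) * w) / (\<kappa>\<^sup>2 * (1 - x\<^sup>2)) + w\<^sup>2 * (1 + N * (x - R) * w)"
proof -
  have "(1 + B * w) / D = 1 / D + B / D * w" for B D :: real
    by (simp add: add_divide_distrib)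
  then show ?thesis
    by (simp add: cubic_def soliton_coeff_def distrib_left power2_eq_square power3_eq_cube)
qed

locale translator_ode =
  fixes \<kappa> N R :: real
  assumes kappa: "\<kappa> > 0" and N: "N \<ge> 1" and R: "-1 < R" "R < 1"
begin

abbreviation "sol \<equiv> cubic_solution (soliton_coeff \<kappa> N R)"
abbreviation "\<alpha> x \<equiv> \<kappa>\<^sup>2 * (1 - x\<^sup>2)"

lemma alpha_pos: "-1 < x \<Longrightarrow> x < 1 \<Longrightarrow> \<alpha> x > 0"
  using kappa abs_square_less_1[of x] by (auto intro!: mult_pos_pos)

lemma sol_deriv:
  "sol w A \<Longrightarrow> x \<in> A \<Longrightarrow> (w has_real_derivative (1 + (N * (x - R) + \<kappa>\<^sup>2 * x) * w x) / \<alpha> x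
     + (w x)\<^sup>2 * (1 + N * (x - R) * w x)) (at x)"
  by (simp add: cubic_solution_def cubic_soliton_coeff)

lemma sol_continuous: "sol w A \<Longrightarrow> continuous_on A w"
  by (auto simp: cubic_solution_def intro!: continuous_at_imp_continuous_on DERIV_isCont)

lemma sol_mono: "sol w A \<Longrightarrow> B \<subseteq> A \<Longrightarrow> sol w B"
  by (auto simp: cubic_solution_def)

lemma sol_reflect:
  assumes "sol w {l<..<u}"
  shows "cubic_solution (soliton_coeff \<kappa> N (- R)) (\<lambda>x. - w (- x)) {- u<..<- l}"
  unfolding cubic_solution_def
proof
  fix x assume x: "x \<in> {- u<..<- l}"
  then have "(w has_real_derivative cubic (soliton_coeff \<kappa> N R) (- x) (w (- x))) (at (- x))"
    using assms by (auto simp: cubic_solution_def)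
  then have "((\<lambda>x. - w (- x)) has_real_derivative cubic (soliton_coeff \<kappa> N R) (- x) (w (- x))) (at x)"
    by (auto simp: DERIV_mirror dest: DERIV_minus)
  moreover have "cubic (soliton_coeff \<kappa> N R) (- x) (w (- x)) = cubic (soliton_coeff \<kappa> N (- R)) x (- w (- x))"
    by (simp add: cubic_soliton_coeff algebra_simps)
  ultimately show "((\<lambda>x. - w (- x)) has_real_derivative cubic (soliton_coeff \<kappa> N (- R)) x (- w (- x))) (at x)"
    by simp
qed

lemma sol_ck_on:
  assumes w: "sol w {l<..<u}" and lu: "-1 \<le> l" "u \<le> 1"
  shows "ck_on j w {l<..<u}"
proof (induction j)
  case 0
  then show ?case using sol_continuous[OF w] by simp
next
  case (Suc j)
  let ?w' = "\<lambda>x. (1 + (N * (x - R) + \<kappa>\<^sup>2 * x) * w x) / \<alpha> x + (w x)\<^sup>2 * (1 + N * (x - R) * w x)"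
  have "\<alpha> x \<noteq> 0" if "x \<in> {l<..<u}" for x using alpha_pos[of x] that lu by auto
  then have "ck_on j ?w' {l<..<u}"
    using Suc by (intro ck_on_add ck_on_mult ck_on_divide ck_on_power ck_on_diff ck_on_const ck_on_ident)
  moreover have "(w has_real_derivative ?w' x) (at x within {l<..<u})" if "x \<in> {l<..<u}" for x
    using sol_deriv[OF w that] by (rule has_field_derivative_at_within)
  ultimately show ?case unfolding ck_on.simps by (intro exI[of _ ?w']) auto
qed

lemma sol_pos_after:
  assumes w: "sol w {l<..<u}" and lu: "-1 \<le> l" "u \<le> 1"
    and xy: "l < x" "x < y" "y < u" and wx: "w x \<ge> 0"
  shows "w y > 0"
  by (rule barrier_less[of x y w _ 0, OF sol_deriv[OF w]]) (use assms alpha_pos in auto)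

section \<open>Excluding blow-up at or before \<open>R\<close>\<close>

text \<open>Near \<open>b\<close> the positive function \<open>y = - 1 / w\<close> tends to 0. Its
  derivative is \<open>1 + N * (x - R) * w + h\<close> with \<open>h\<close> tending to 0, and left
  of \<open>R\<close> the middle term is non-negative. So \<open>y\<close> would be non-decreasing
  with limit 0, hence non-positive.\<close>

lemma no_negative_blow_up:
  assumes w: "sol w {l<..<b}" and lb: "-1 \<le> l" "l < b" "b \<le> R"
    and neg: "\<And>x. x \<in> {l<..<b} \<Longrightarrow> w x < 0"
    and lim: "filterlim w at_bot (at_left b)"
  shows False
proof -
  define y where "y x = - inverse (w x)" for x
  have y: "y x > 0" if "x \<in> {l<..<b}" for x using neg[OF that] by (simp add: y_def)
  have y0: "(y \<longlongrightarrow> 0) (at_left b)"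
    unfolding y_def using tendsto_minus[OF filterlim_compose[OF tendsto_inverse_0 filterlim_mono[OF lim at_bot_le_at_infinity order.refl]]]
    by simp
  define h where "h x = ((y x)\<^sup>2 - (N * (x - R) + \<kappa>\<^sup>2 * x) * y x) / \<alpha> x" for x
  have "(h \<longlongrightarrow> (0\<^sup>2 - (N * (b - R) + \<kappa>\<^sup>2 * b) * 0) / \<alpha> b) (at_left b)"
    unfolding h_def using alpha_pos[of b] lb R by (intro tendsto_intros y0) auto
  then have "(h \<longlongrightarrow> 0) (at_left b)" by simp
  then have "eventually (\<lambda>x. dist (h x) 0 < 1) (at_left b)" by (rule tendstoD) simp
  then obtain p where p: "p < b" "\<And>x. p < x \<Longrightarrow> x < b \<Longrightarrow> \<bar>h x\<bar> < 1"
    unfolding eventually_at_left_field by auto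
  define q where "q = max p l"
  have q: "p \<le> q" "l \<le> q" "q < b" using p lb by (auto simp: q_def)
  have dy: "(y has_real_derivative 1 + N * (x - R) * w x + h x) (at x)" if x: "x \<in> {l<..<b}" for x
  proof -
    have "\<alpha> x > 0" using alpha_pos x lb R by auto
    with neg[OF x] show ?thesis
      unfolding y_def h_def
      by (auto intro!: derivative_eq_intros sol_deriv[OF w x] simp: divide_simps)
        (simp add: algebra_simps power2_eq_square power3_eq_cube)
  qed
  have mono: "y s \<le> y t" if "q < s" "s \<le> t" "t < b" for s t
  proof (rule DERIV_nonneg_imp_nondecreasing[OF that(2)])
    fix x assume x: "s \<le> x" "x \<le> t"
    then have xl: "x \<in> {l<..<b}" using that q by auto
    have "N * (x - R) * w x \<ge> 0" using N lb neg[OF xl] xl by (intro mult_nonpos_nonpos) (auto simp: mult_le_0_iff)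
    moreover have "\<bar>h x\<bar> < 1" using p x that q by auto
    ultimately show "\<exists>d. (y has_real_derivative d) (at x) \<and> 0 \<le> d" 
      using dy[OF xl] by (intro exI[of _ "1 + N * (x - R) * w x + h x"]) auto
  qed
  define s where "s = (q + b) / 2"
  have s: "q < s" "s < b" using q by (auto simp: s_def)
  have "y s \<le> 0"
    by (rule tendsto_lowerbound[OF y0]) (use s mono in \<open>auto simp: eventually_at_left_field intro!: exI[of _ s]\<close>)
  then show False using y[of s] s q by auto
qed

text \<open>Here \<open>N \<ge> 1\<close> is essential: for \<open>b = R\<close> the linearization of \<open>1 / w\<close> at \<open>b\<close> has the
  characteristic polynomial \<open>X\<^sup>2 - X + N\<close>, whose roots are not real.\<close>

lemma no_positive_blow_up:
  assumes w: "sol w {l<..<b}" and lb: "-1 \<le> l" "l < b" "b \<le> R"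
    and pos: "\<And>x. x \<in> {l<..<b} \<Longrightarrow> w x > 0"
    and lim: "filterlim w at_top (at_left b)"
  shows False
proof -
  define y where "y x = inverse (w x)" for x
  have y: "y x > 0" if "x \<in> {l<..<b}" for x using pos[OF that] by (simp add: y_def)
  have y0: "(y \<longlongrightarrow> 0) (at_left b)"
    unfolding y_def by (rule filterlim_compose[OF tendsto_inverse_0 filterlim_mono[OF lim at_top_le_at_infinity order.refl]])
  define h where "h x = ((y x)\<^sup>2 + (N * (x - R) + \<kappa>\<^sup>2 * x) * y x) / \<alpha> x" for x
  have "(h \<longlongrightarrow> (0\<^sup>2 + (N * (b - R) + \<kappa>\<^sup>2 * b) * 0) / \<alpha> b) (at_left b)"
    unfolding h_def using alpha_pos[of b] lb R by (intro tendsto_intros y0) auto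
  then have "(h \<longlongrightarrow> 0) (at_left b)" by simp
  then have "eventually (\<lambda>x. dist (h x) 0 < 1/2) (at_left b)" by (rule tendstoD) simp
  then obtain p where p: "p < b" "\<And>x. p < x \<Longrightarrow> x < b \<Longrightarrow> \<bar>h x\<bar> < 1/2"
    unfolding eventually_at_left_field by auto
  define q where "q = max p l"
  have q: "p \<le> q" "l \<le> q" "q < b" using p lb by (auto simp: q_def)
  have dy: "(y has_real_derivative - 1 + N * (R - x) / y x - h x) (at x)" if x: "x \<in> {l<..<b}" for x
  proof -
    have "\<alpha> x > 0" using alpha_pos x lb R by auto
    with pos[OF x] show ?thesis
      unfolding y_def h_def
      by (auto intro!: derivative_eq_intros sol_deriv[OF w x] simp: divide_simps)
        (simp add: algebra_simps power2_eq_square power3_eq_cube)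
  qed
  \<comment> \<open>Because \<open>b \<le> R\<close> and \<open>N \<ge> 1\<close>, the coefficient
    can be lowered to the case \<open>N = 1\<close>, \<open>R = b\<close>. The bound 1/2 on
    \<open>h\<close> is small enough for the inequality \<open>1 / t + t \<ge> 2\<close> to absorb
    it below.\<close>
  have lower: "- 1 + (b - x) / y x - 1/2 \<le> - 1 + N * (R - x) / y x - h x" if x: "q < x" "x < b" for x
  proof -
    have "1 * (b - x) \<le> N * (R - x)" using N lb x by (intro mult_mono) auto
    then have "(b - x) / y x \<le> N * (R - x) / y x" using y[of x] x q by (intro divide_right_mono) auto
    moreover have "\<bar>h x\<bar> < 1/2" using p(2)[of x] x q by auto
    ultimately show ?thesis by (simp only: abs_less_iff) linarith
  qed
  \<comment> \<open>The derivative of \<open>y\<close> is at least -2 and \<open>y\<close> tends to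
    0 at \<open>b\<close>.\<close>
  have upper: "y s \<le> 2 * (b - s)" if s: "q < s" "s < b" for s
  proof -
    have "((\<lambda>x. y x + 2 * x) \<longlongrightarrow> 0 + 2 * b) (at_left b)" by (intro tendsto_intros y0)
    moreover have "y s + 2 * s \<le> y t + 2 * t" if t: "s \<le> t" "t < b" for t
    proof (rule DERIV_nonneg_imp_nondecreasing[OF t(1), of "\<lambda>x. y x + 2 * x"])
      fix x assume x: "s \<le> x" "x \<le> t"
      then have "x \<in> {l<..<b}" "q < x" "x < b" using s t q by auto
      then have "(b - x) / y x \<ge> 0" using y[of x] by (intro divide_nonneg_pos) auto
      then have "- 1 + N * (R - x) / y x - h x + 2 \<ge> 0"
        using lower[OF \<open>q < x\<close> \<open>x < b\<close>] by linarith
      moreover have "((\<lambda>x. y x + 2 * x) has_real_derivative (- 1 + N * (R - x) / y x - h x) + 2) (at x)"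
        using \<open>x \<in> {l<..<b}\<close> by (auto intro!: derivative_eq_intros dy)
      ultimately show "\<exists>d. ((\<lambda>x. y x + 2 * x) has_real_derivative d) (at x) \<and> 0 \<le> d" by blast
    qed
    ultimately have "y s + 2 * s \<le> 0 + 2 * b"
      using s by (intro tendsto_lowerbound[of "\<lambda>x. y x + 2 * x" "0 + 2 * b" "at_left b"])
        (auto simp: eventually_at_left_field intro!: exI[of _ s])
    then show ?thesis by simp
  qed
  \<comment> \<open>For \<open>t = y / (b - x)\<close> the bound \<open>lower\<close> gives
    \<open>(b - x) * t' \<ge> 1 / t + t - 3/2 \<ge> 1/2\<close>, so \<open>t\<close> grows at least
    like \<open>- ln (b - x) / 2\<close>, whereas \<open>upper\<close> says
    \<open>t \<le> 2\<close>. \<open>G\<close> is \<open>t\<close> minus that growth.\<close>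
  define G where "G x = y x / (b - x) + ln (b - x) / 2" for x
  define s where "s = (q + b) / 2"
  have s: "q < s" "s < b" using q by (auto simp: s_def)
  have mono: "G s \<le> G t" if t: "s \<le> t" "t < b" for t
  proof (rule DERIV_nonneg_imp_nondecreasing[OF t(1)])
    fix x assume x: "s \<le> x" "x \<le> t"
    then have xl: "x \<in> {l<..<b}" "q < x" "x < b" using s t q by auto
    let ?d = "- 1 + N * (R - x) / y x - h x" and ?q = "y x / (b - x)"
    have q0: "?q > 0" using y[OF xl(1)] xl by auto
    have "2 \<le> 1 / t + t" if "t > 0" for t :: real
    proof -
      have "0 \<le> (t - 1)\<^sup>2 / t" using that by simp
      also have "\<dots> = 1 / t + t - 2" using that by (simp add: field_simps power2_eq_square)
      finally show ?thesis by simp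
    qed
    from this[OF q0] have "2 \<le> 1 / ?q + ?q" .
    moreover have "1 / ?q = (b - x) / y x" by simp
    ultimately have "?d + ?q - 1/2 \<ge> 0" using lower[OF xl(2,3)] by linarith
    then have "(?d + ?q - 1/2) / (b - x) \<ge> 0" using xl by (intro divide_nonneg_pos) auto
    moreover have "(G has_real_derivative (?d + ?q - 1/2) / (b - x)) (at x)"
      unfolding G_def using xl(3)
      by (auto intro!: derivative_eq_intros dy[OF xl(1)] simp del: minus_add_distrib)
        (simp add: divide_simps; simp add: algebra_simps)
    ultimately show "\<exists>d. (G has_real_derivative d) (at x) \<and> 0 \<le> d" by blast
  qed
  \<comment> \<open>The second bound places \<open>b - e\<close> so close to \<open>b\<close> that
    \<open>2 + ln e / 2 < G s\<close>.\<close>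
  define e where "e = min (b - s) (exp (2 * (G s - 2) - 1))"
  have e: "e > 0" "e \<le> b - s" "e \<le> exp (2 * (G s - 2) - 1)" using s by (auto simp: e_def)
  then have le: "ln e \<le> 2 * (G s - 2) - 1" using ln_mono[OF e(3,1)] by simp
  have "G s \<le> G (b - e)" using e by (intro mono) auto
  also have "\<dots> \<le> 2 + ln e / 2"
  proof -
    have "y (b - e) / e \<le> 2" using upper[of "b - e"] e s by (simp add: pos_divide_le_eq)
    then show ?thesis by (simp add: G_def)
  qed
  finally show False using le by simp
qed

text \<open>From its first non-negative value on a solution is positive, so near \<open>b\<close>
  its sign is constant and the blow-up has a definite direction; both directions are excluded for
  \<open>b \<le> R\<close>.\<close>

lemma blow_up_right:
  assumes w: "sol w {l<..<b}" and lb: "-1 \<le> l" "l < b" "b < 1"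
    and lim: "filterlim (\<lambda>x. \<bar>w x\<bar>) at_top (at_left b)"
  shows "R < b \<and> (filterlim w at_top (at_left b) \<or> filterlim w at_bot (at_left b))"
proof (cases "\<exists>x. l < x \<and> x < b \<and> w x \<ge> 0")
  case True
  then obtain x where x: "l < x" "x < b" "w x \<ge> 0" by auto
  have pos: "w y > 0" if "x < y" "y < b" for y
    using sol_pos_after[OF w lb(1) _ x(1) that(1,2) x(3)] lb by simp
  have top: "filterlim w at_top (at_left b)"
    by (rule filterlim_mono_eventually[OF lim order.refl order.refl])
      (use pos x in \<open>auto simp: eventually_at_left_field less_imp_le intro!: exI[of _ x]\<close>)
  have "sol w {x<..<b}" by (rule sol_mono[OF w]) (use x in auto)
  then have False if "b \<le> R"
    by (rule no_positive_blow_up[of w x b]) (use that x lb pos top in auto)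
  then show ?thesis using top by force
next
  case False
  then have neg: "w y < 0" if "l < y" "y < b" for y using that by force
  have "filterlim (\<lambda>x. - w x) at_top (at_left b)"
    by (rule filterlim_mono_eventually[OF lim order.refl order.refl])
      (use abs_of_neg[OF neg] lb in \<open>auto simp: eventually_at_left_field intro!: exI[of _ l]\<close>)
  then have bot: "filterlim w at_bot (at_left b)" by (simp add: filterlim_uminus_at_bot)
  have "\<not> b \<le> R" using no_negative_blow_up[OF w lb(1,2)] neg bot by auto
  then show ?thesis using bot by auto
qed

section \<open>Solutions that reach the singular point 1\<close>

text \<open>\<open>- 1 / Z\<close> stays negative, but its derivative is at least
  \<open>N * (x - R) / \<alpha> x\<close>, and this is at least \<open>c / (1 - x)\<close> because
  \<open>\<alpha> x \<le> 2 * \<kappa>\<^sup>2 * (1 - x)\<close>. The integral of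
  \<open>c / (1 - x)\<close> diverges at 1.\<close>

lemma riccati_growth_impossible:
  fixes Z Z' :: "real \<Rightarrow> real"
  assumes x1: "R < x1" "x1 < 1"
    and d: "\<And>x. x1 \<le> x \<Longrightarrow> x < 1 \<Longrightarrow> (Z has_real_derivative Z' x) (at x)"
    and Z: "\<And>x. x1 \<le> x \<Longrightarrow> x < 1 \<Longrightarrow> Z x > 0"
    and Z': "\<And>x. x1 \<le> x \<Longrightarrow> x < 1 \<Longrightarrow> Z' x \<ge> N * (x - R) * (Z x)\<^sup>2 / \<alpha> x"
  shows False
proof -
  define c where "c = N * (x1 - R) / (2 * \<kappa>\<^sup>2)"
  have c: "c > 0" using N x1 kappa by (simp add: c_def)
  define G where "G x = c * ln (1 - x) - inverse (Z x)" for x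
  have mono: "G x1 \<le> G t" if t: "x1 \<le> t" "t < 1" for t
  proof (rule DERIV_nonneg_imp_nondecreasing[OF t(1)])
    fix x assume x: "x1 \<le> x" "x \<le> t"
    then have x': "x1 \<le> x" "x < 1" using t by auto
    have a: "0 < \<alpha> x" "\<alpha> x \<le> 2 * \<kappa>\<^sup>2 * (1 - x)"
    proof -
      show "0 < \<alpha> x" using alpha_pos x' x1 R by auto
      have "\<kappa>\<^sup>2 * (1 - x) * (1 + x) \<le> \<kappa>\<^sup>2 * (1 - x) * 2" using x' by (intro mult_left_mono) auto
      then show "\<alpha> x \<le> 2 * \<kappa>\<^sup>2 * (1 - x)" by (simp add: algebra_simps power2_eq_square)
    qed
    have "c / (1 - x) = N * (x1 - R) / (2 * \<kappa>\<^sup>2 * (1 - x))" by (simp add: c_def)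
    also have "\<dots> \<le> N * (x - R) / \<alpha> x"
      using a x' N x1 by (intro frac_le mult_left_mono) auto
    also have "\<dots> \<le> Z' x / (Z x)\<^sup>2"
      using Z'[OF x'] Z[OF x'] by (simp add: field_simps)
    finally have "0 \<le> Z' x / (Z x)\<^sup>2 - c / (1 - x)" by simp
    moreover have "(G has_real_derivative Z' x / (Z x)\<^sup>2 - c / (1 - x)) (at x)"
    proof -
      have 1: "((\<lambda>x. ln (1 - x)) has_real_derivative - 1 / (1 - x)) (at x)"
        using x' by (auto intro!: derivative_eq_intros)
      have 2: "((\<lambda>x. inverse (Z x)) has_real_derivative - (inverse (Z x) * Z' x * inverse (Z x))) (at x)"
        by (rule DERIV_inverse'[OF d[OF x']]) (use Z[OF x'] in auto)
      show ?thesis unfolding G_def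
        by (rule DERIV_cong[OF DERIV_diff[OF DERIV_cmult[OF 1, of c] 2]])
          (simp add: field_simps power2_eq_square)
    qed
    ultimately show "\<exists>d. (G has_real_derivative d) (at x) \<and> 0 \<le> d" by blast
  qed
  define e where "e = min (1 - x1) (exp (G x1 / c))"
  have e: "e > 0" "e \<le> 1 - x1" "e \<le> exp (G x1 / c)" using x1 by (auto simp: e_def)
  then have le: "ln e \<le> G x1 / c" using ln_mono[OF e(3,1)] by simp
  have "G x1 \<le> G (1 - e)" using e by (intro mono) auto
  also have "\<dots> < c * ln e" using Z[of "1 - e"] e by (simp add: G_def)
  also have "\<dots> \<le> G x1" using le c by (simp add: field_simps)
  finally show False by simp
qed

text \<open>This and its variant for negative \<open>v\<close> write the Riccati bound as a product
  of three factors, to be compared one by one with those in \<open>sol_square_deriv\<close>.\<close>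

lemma square_quotient: "A \<noteq> 0 \<Longrightarrow> c * (A * v\<^sup>2)\<^sup>2 / A = v * (A * v\<^sup>2) * (c * v)" for A c v :: real
  by (simp add: field_simps power2_eq_square)

lemma square_quotient': "A \<noteq> 0 \<Longrightarrow> c * (A * v\<^sup>2)\<^sup>2 / A = (2 * - v) * (A * v\<^sup>2) * (c * - v / 2)" for A c v :: real
  by (simp add: field_simps power2_eq_square)

text \<open>The derivative of \<alpha> contributes
  \<open>- 2 * \<kappa>\<^sup>2 * x * (w x)\<^sup>2\<close>, which cancels the part
  \<open>\<kappa>\<^sup>2 * x\<close> of the linear coefficient; what remains factors, and its sign
  can be read off.\<close>

lemma sol_square_deriv:
  assumes w: "sol w A" and x: "x \<in> A" "-1 < x" "x < 1"
  shows "((\<lambda>x. \<alpha> x * (w x)\<^sup>2) has_real_derivative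
     2 * w x * (1 + \<alpha> x * (w x)\<^sup>2) * (1 + N * (x - R) * w x)) (at x)"
proof -
  define A where "A = \<alpha> x"
  define D where "D = (1 + (N * (x - R) + \<kappa>\<^sup>2 * x) * w x) / A + (w x)\<^sup>2 * (1 + N * (x - R) * w x)"
  have A: "A \<noteq> 0" unfolding A_def by (rule less_imp_neq[OF alpha_pos[OF x(2,3)], symmetric])
  have "(w has_real_derivative D) (at x)" using sol_deriv[OF w x(1)] unfolding A_def D_def .
  then have "((\<lambda>x. \<alpha> x * (w x)\<^sup>2) has_real_derivative - 2 * \<kappa>\<^sup>2 * x * (w x)\<^sup>2 + 2 * w x * (A * D)) (at x)"
    unfolding A_def by (auto intro!: derivative_eq_intros)
  moreover have "A * D = 1 + (N * (x - R) + \<kappa>\<^sup>2 * x) * w x + A * ((w x)\<^sup>2 * (1 + N * (x - R) * w x))"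
    unfolding D_def distrib_left[of A] using A by simp
  then have "- 2 * \<kappa>\<^sup>2 * x * (w x)\<^sup>2 + 2 * w x * (A * D) =
      2 * w x * (1 + A * (w x)\<^sup>2) * (1 + N * (x - R) * w x)"
    by (simp only:) (simp add: algebra_simps power2_eq_square)
  ultimately show ?thesis unfolding A_def by simp
qed

text \<open>A non-negative value would make \<open>w\<close> positive from there on. Right of
  \<open>R\<close> every factor in \<open>sol_square_deriv\<close> is then positive, and their
  product dominates the Riccati bound.\<close>

lemma sol_up_to_1_neg:
  assumes w: "sol w {l<..<1}" and l: "-1 \<le> l" and x: "l < x" "x < 1"
  shows "w x < 0"
proof (rule ccontr)
  assume "\<not> w x < 0"
  define x1 where "x1 = (max x R + 1) / 2"
  have x1: "x < x1" "R < x1" "x1 < 1" using x R by (auto simp: x1_def)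
  have pos: "w y > 0" if "x1 \<le> y" "y < 1" for y
    using sol_pos_after[OF w l _ x(1), of y] that x1 \<open>\<not> w x < 0\<close> by auto
  show False
  proof (rule riccati_growth_impossible[OF x1(2,3) sol_square_deriv[OF w]])
    fix y assume y: "x1 \<le> y" "y < 1"
    show "y \<in> {l<..<1}" "-1 < y" "y < 1" using y x1 x l by auto
    then have a: "\<alpha> y > 0" using alpha_pos by auto
    then show "\<alpha> y * (w y)\<^sup>2 > 0" using pos[OF y] by simp
    have "N * (y - R) * (\<alpha> y * (w y)\<^sup>2)\<^sup>2 / \<alpha> y = w y * (\<alpha> y * (w y)\<^sup>2) * (N * (y - R) * w y)"
      using a by (intro square_quotient) auto
    also have "\<dots> \<le> (2 * w y) * (1 + \<alpha> y * (w y)\<^sup>2) * (1 + N * (y - R) * w y)"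
      using a pos[OF y] N x1 y by (intro mult_mono) auto
    finally show "N * (y - R) * (\<alpha> y * (w y)\<^sup>2)\<^sup>2 / \<alpha> y \<le> \<dots>" .
  qed
qed

text \<open>The barrier is \<open>?Y x = N * (x - R) * - w x\<close> at level 2: once reached, it is
  not left again, and \<open>?Y \<ge> 2\<close> gives \<open>?Y - 1 \<ge> ?Y / 2\<close>, which
  makes \<open>sol_square_deriv\<close> a Riccati inequality. Hence \<open>?Y < 2\<close> beyond
  \<open>p\<close>, and this bounds \<open>w\<close>.\<close>

lemma sol_up_to_1_bounded:
  assumes w: "sol w {l<..<1}" and l: "-1 \<le> l" "l < 1"
  obtains K p where "l \<le> p" "p < 1" "\<And>x. x \<in> {p<..<1} \<Longrightarrow> \<bar>w x\<bar> \<le> K"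
proof -
  \<comment> \<open>Beyond \<open>p\<close> both \<open>x - R\<close> and \<open>x\<close> are
    positive; the sign of \<open>x\<close> makes \<open>\<kappa>\<^sup>2 * x * w x\<close>
    non-positive at the barrier.\<close>
  define p where "p = (max (max l R) 0 + 1) / 2"
  have p: "l < p" "R < p" "0 < p" "p < 1" using l R by (auto simp: p_def)
  have "N * (x - R) * - w x < 2" if x: "p \<le> x" "x < 1" for x
  proof (rule ccontr)
    assume "\<not> N * (x - R) * - w x < 2"
    let ?Y = "\<lambda>x. N * (x - R) * - w x"
    let ?w' = "\<lambda>x. (1 + (N * (x - R) + \<kappa>\<^sup>2 * x) * w x) / \<alpha> x + (w x)\<^sup>2 * (1 + N * (x - R) * w x)"
    have in_I: "y \<in> {l<..<1}" if "x \<le> y" "y < 1" for y using that x p by auto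
    have neg: "w y < 0" if "x \<le> y" "y < 1" for y
      using sol_up_to_1_neg[OF w l(1)] in_I[OF that] by auto
    have Y: "?Y y \<ge> 2" if y: "x \<le> y" "y < 1" for y
    proof (rule barrier_le[of x y ?Y "\<lambda>z. N * - w z + N * (z - R) * - ?w' z" 2])
      fix z assume z: "z \<in> {x..y}"
      then have zI: "z \<in> {l<..<1}" "R < z" "0 < z" using x p y by auto
      have "(?Y has_real_derivative N * - w z + N * (z - R) * - D) (at z)"
        if "(w has_real_derivative D) (at z)" for D
        using that by (auto intro!: derivative_eq_intros simp: algebra_simps)
      then show "(?Y has_real_derivative N * - w z + N * (z - R) * - ?w' z) (at z)"
        using sol_deriv[OF w zI(1)] by blast
      assume Yz: "?Y z = 2"
      have wz: "w z < 0" using neg z y by auto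
      have "\<kappa>\<^sup>2 * z * w z \<le> 0" using zI wz by (intro mult_nonneg_nonpos) auto
      then have "1 + (N * (z - R) + \<kappa>\<^sup>2 * z) * w z < 0" using Yz by (simp add: algebra_simps)
      then have "(1 + (N * (z - R) + \<kappa>\<^sup>2 * z) * w z) / \<alpha> z < 0"
        using alpha_pos[of z] zI l by (intro divide_neg_pos) auto
      moreover have "(w z)\<^sup>2 * (1 + N * (z - R) * w z) < 0"
        using wz Yz by (intro mult_pos_neg) auto
      ultimately have "?w' z < 0" by linarith
      then have "N * (z - R) * - ?w' z > 0" using N zI by (intro mult_pos_pos) auto
      moreover have "N * - w z > 0" using N wz by (intro mult_pos_pos) auto
      ultimately show "N * - w z + N * (z - R) * - ?w' z > 0" by linarith
    qed (use \<open>\<not> N * (x - R) * - w x < 2\<close> y in auto)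
    have xR: "R < x" using x p by auto
    show False
    proof (rule riccati_growth_impossible[OF xR x(2) sol_square_deriv[OF w]])
      fix y assume y: "x \<le> y" "y < 1"
      show "y \<in> {l<..<1}" "-1 < y" "y < 1" using in_I[OF y] y l by auto
      then have a: "\<alpha> y > 0" using alpha_pos by auto
      then show "\<alpha> y * (w y)\<^sup>2 > 0" using neg[OF y] by simp
      have "N * (y - R) * (\<alpha> y * (w y)\<^sup>2)\<^sup>2 / \<alpha> y = (2 * - w y) * (\<alpha> y * (w y)\<^sup>2) * (?Y y / 2)"
        using a by (intro square_quotient') auto
      also have "\<dots> \<le> (2 * - w y) * (1 + \<alpha> y * (w y)\<^sup>2) * (?Y y - 1)"
      proof (rule mult_mono)
        show "2 * - w y * (\<alpha> y * (w y)\<^sup>2) \<le> 2 * - w y * (1 + \<alpha> y * (w y)\<^sup>2)"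
          using neg[OF y] by (intro mult_left_mono) auto
        show "0 \<le> 2 * - w y * (1 + \<alpha> y * (w y)\<^sup>2)"
          using neg[OF y] a by (intro mult_nonneg_nonneg) auto
      qed (use Y[OF y] in auto)
      also have "\<dots> = 2 * w y * (1 + \<alpha> y * (w y)\<^sup>2) * (1 + N * (y - R) * w y)"
        by (simp add: algebra_simps)
      finally show "N * (y - R) * (\<alpha> y * (w y)\<^sup>2)\<^sup>2 / \<alpha> y \<le> \<dots>" .
    qed
  qed
  note Y = this
  have bd: "\<bar>w x\<bar> \<le> 2 / (N * (p - R))" if "x \<in> {p<..<1}" for x
  proof -
    have "w x < 0" using sol_up_to_1_neg[OF w l(1)] that p by auto
    have "N * (p - R) * - w x \<le> N * (x - R) * - w x"
      using that N \<open>w x < 0\<close> p by (intro mult_right_mono mult_left_mono) auto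
    then have "N * (p - R) * - w x \<le> 2" using Y[of x] that by auto
    then show ?thesis using \<open>w x < 0\<close> N p by (simp add: field_simps)
  qed
  show ?thesis by (rule that[OF _ _ bd]) (use p in auto)
qed

text \<open>Multiply the ODE by \<open>1 - x\<close>. Since
  \<open>1 / (1 + x) = 1 / 2 + (1 - x) / (2 * (1 + x))\<close>, it splits into a linear part with
  constant coefficients and a multiple \<open>S\<close> of \<open>1 - x\<close>. As \<open>S\<close>
  is polynomial in \<open>W\<close> with smooth coefficients,
  \<open>ck_on_Suc_singular_linear\<close> raises the regularity of \<open>W\<close> one order at a
  time.\<close>

lemma sol_extends_to_1:
  assumes w: "sol w {l<..<1}" and l: "-1 \<le> l" "l < 1"
  obtains W where "\<And>x. x \<in> {l<..<1} \<Longrightarrow> W x = w x" "W 1 < 0" "\<And>j. ck_on j W {l<..1}"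
proof -
  define B where "B = N * (1 - R) + \<kappa>\<^sup>2"
  have "N * (1 - R) > 0" using N R by simp
  then have B: "B > 0" using kappa by (simp add: B_def add_pos_pos)
  define \<mu> where "\<mu> = B / (2 * \<kappa>\<^sup>2)"
  define g where "g = - 1 / (2 * \<kappa>\<^sup>2)"
  have mu: "\<mu> > 0" using B kappa by (simp add: \<mu>_def)
  \<comment> \<open>\<open>g / \<mu> = - 1 / B\<close> is the zero of \<open>1 + B * w\<close>, the
    numerator of the singular term at \<open>x = 1\<close>.\<close>
  define W where "W x = (if x = 1 then g / \<mu> else w x)" for x
  define c1 where "c1 x = (N + \<kappa>\<^sup>2) / (\<kappa>\<^sup>2 * (1 + x))" for x
  define c2 where "c2 x = 1 / (2 * \<kappa>\<^sup>2 * (1 + x))" for x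
  define S where "S x = c1 x * W x - c2 x * (1 + B * W x) - (W x)\<^sup>2 * (1 + N * (x - R) * W x)" for x
  define W' where "W' x = (1 + (N * (x - R) + \<kappa>\<^sup>2 * x) * w x) / \<alpha> x + (w x)\<^sup>2 * (1 + N * (x - R) * w x)" for x
  have d: "(W has_real_derivative W' x) (at x)" if x: "x \<in> {l<..<1}" for x
    by (rule has_field_derivative_transform_within_open[OF sol_deriv[OF w x, folded W'_def], of "{l<..<1}"])
      (use x in \<open>auto simp: W_def\<close>)
  have eq: "(1 - x) * W' x = \<mu> * W x - g - (1 - x) * S x" if x: "x \<in> {l<..<1}" for x
  proof -
    define p where "p = 1 / \<kappa>\<^sup>2"
    define t where "t = 1 / (1 + x)"
    define Q where "Q = (w x)\<^sup>2 * (1 + N * (x - R) * w x)"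
    have nz: "1 - x \<noteq> 0" "1 + x \<noteq> 0" using x l by auto
    have t: "t * (1 + x) = 1" using nz by (simp add: t_def)
    have "\<alpha> x = (1 - x) * (\<kappa>\<^sup>2 * (1 + x))" by (simp add: algebra_simps power2_eq_square)
    then have "W' x = (1 + (N * (x - R) + \<kappa>\<^sup>2 * x) * w x) / ((1 - x) * (\<kappa>\<^sup>2 * (1 + x))) + Q"
      unfolding W'_def Q_def by (simp only:)
    moreover have "(1 - x) * (c / ((1 - x) * d) + Q) = c / d + (1 - x) * Q" for c d
      unfolding distrib_left using nz by simp
    ultimately have "(1 - x) * W' x = (1 + (N * (x - R) + \<kappa>\<^sup>2 * x) * w x) / (\<kappa>\<^sup>2 * (1 + x)) + (1 - x) * Q"
      by (simp only:)
    also have "(1 + (N * (x - R) + \<kappa>\<^sup>2 * x) * w x) / (\<kappa>\<^sup>2 * (1 + x)) =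
        (1 + (N * (x - R) + \<kappa>\<^sup>2 * x) * w x) * p * t"
      by (simp add: p_def t_def)
    also have "\<dots> = (1 + B * w x) * p * t - (1 - x) * (N + \<kappa>\<^sup>2) * w x * p * t"
      by (simp add: B_def algebra_simps)
    also have "(1 + B * w x) * p * t = (1 + B * w x) * p / 2 * (t * (1 + x) + t * (1 - x))"
      by (simp add: algebra_simps)
    also have "\<dots> = (1 + B * w x) * p / 2 + (1 - x) * ((1 + B * w x) * p / 2 * t)"
    proof -
      have "c * (1 + t * (1 - x)) = c + (1 - x) * (c * t)" for c by (simp add: algebra_simps)
      then show ?thesis unfolding t .
    qed
    finally have "(1 - x) * W' x = (1 + B * w x) * p / 2 + (1 - x) * ((1 + B * w x) * p / 2 * t)
        - (1 - x) * (N + \<kappa>\<^sup>2) * w x * p * t + (1 - x) * Q" .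
    also have "\<dots> = B * p / 2 * w x - - p / 2 - (1 - x) * ((N + \<kappa>\<^sup>2) * p * t * w x - p * t / 2 * (1 + B * w x) - Q)"
      by (simp add: algebra_simps add_divide_distrib diff_divide_distrib)
    finally have *: "(1 - x) * W' x = B * p / 2 * w x - - p / 2
        - (1 - x) * ((N + \<kappa>\<^sup>2) * p * t * w x - p * t / 2 * (1 + B * w x) - Q)" .
    have "W x = w x" using x by (simp add: W_def)
    then have "S x = (N + \<kappa>\<^sup>2) * p * t * w x - p * t / 2 * (1 + B * w x) - Q"
      unfolding S_def Q_def c1_def c2_def p_def t_def by simp
    moreover have "\<mu> = B * p / 2" "g = - p / 2" by (simp_all add: \<mu>_def g_def p_def)
    ultimately show ?thesis using * \<open>W x = w x\<close> by (simp only:)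
  qed
  have cw: "continuous_on {l<..<1} W"
    using d by (meson DERIV_isCont continuous_at_imp_continuous_on)
  obtain K p where K: "l \<le> p" "p < 1" "\<And>x. x \<in> {p<..<1} \<Longrightarrow> \<bar>W x\<bar> \<le> K"
  proof -
    obtain K p where "l \<le> p" "p < 1" "\<And>x. x \<in> {p<..<1} \<Longrightarrow> \<bar>w x\<bar> \<le> K"
      using sol_up_to_1_bounded[OF w l] by blast
    then show ?thesis by (intro that[of p K]) (auto simp: W_def)
  qed
  have small: "((\<lambda>x. (1 - x) powr e * f x) \<longlongrightarrow> 0) (at_left 1)"
    if "e > 0" and "\<And>x. x \<in> {p<..<1} \<Longrightarrow> \<bar>f x\<bar> \<le> C" for e C and f :: "real \<Rightarrow> real"
  proof (rule Lim_null_comparison)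
    show "\<forall>\<^sub>F x in at_left 1. norm ((1 - x) powr e * f x) \<le> (1 - x) powr e * C"
      using eventually_at_left_real[OF K(2)]
      by eventually_elim (use that(2) in \<open>auto simp: abs_mult intro!: mult_left_mono\<close>)
    have "((\<lambda>x. (1 - x) powr e * C) \<longlongrightarrow> (1 - 1) powr e * C) (at_left 1)"
      using that(1) by (intro tendsto_intros tendsto_powr') (auto simp: eventually_at_left_field intro!: exI[of _ 0])
    then show "((\<lambda>x. (1 - x) powr e * C) \<longlongrightarrow> 0) (at_left 1)" by simp
  qed
  \<comment> \<open>Convergence of \<open>S\<close> is not yet known, but after multiplication by
    \<open>1 - x\<close> the boundedness of \<open>W\<close> suffices.\<close>
  have hlim: "((\<lambda>x. g + (1 - x) * S x) \<longlongrightarrow> g) (at_left 1)"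
  proof -
    have pow: "((\<lambda>x. (1 - x) * W x ^ k) \<longlongrightarrow> 0) (at_left 1)" for k
    proof -
      have "\<bar>W x ^ k\<bar> \<le> K ^ k" if "x \<in> {p<..<1}" for x
        using K(3)[OF that] by (simp add: power_abs power_mono)
      then have "((\<lambda>x. (1 - x) powr 1 * W x ^ k) \<longlongrightarrow> 0) (at_left 1)" by (intro small) auto
      then show ?thesis
        by (rule Lim_transform_eventually) (use eventually_at_left_real[OF l(2)] in \<open>auto elim: eventually_mono\<close>)
    qed
    have "(1 - x) * S x = c1 x * ((1 - x) * W x ^ 1) - c2 x * ((1 - x) + B * ((1 - x) * W x ^ 1))
        - (1 - x) * W x ^ 2 - N * (x - R) * ((1 - x) * W x ^ 3)" for x
      unfolding S_def by (simp add: algebra_simps power2_eq_square power3_eq_cube)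
    moreover have "(c1 \<longlongrightarrow> c1 1) (at_left 1)" "(c2 \<longlongrightarrow> c2 1) (at_left 1)"
      unfolding c1_def c2_def by (intro tendsto_intros; use kappa in simp)+
    then have "((\<lambda>x. g + (c1 x * ((1 - x) * W x ^ 1) - c2 x * ((1 - x) + B * ((1 - x) * W x ^ 1))
        - (1 - x) * W x ^ 2 - N * (x - R) * ((1 - x) * W x ^ 3))) \<longlongrightarrow>
        g + (c1 1 * 0 - c2 1 * ((1 - 1) + B * 0) - 0 - N * (1 - R) * 0)) (at_left 1)"
      by (intro tendsto_intros pow)
    ultimately show ?thesis by simp
  qed
  have "(W \<longlongrightarrow> g / \<mu>) (at_left 1)"
    by (rule singular_linear_tendsto[OF mu l(2) d _ hlim small[OF mu K(3)]]) (use eq in \<open>auto simp: algebra_simps\<close>)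
  then have cW: "continuous_on {l<..1} W"
    using continuous_on_right_end_iff[OF l(2), of W] cw by (simp add: W_def)
  have "ck_on j W {l<..1}" for j
  proof (induction j)
    case 0
    then show ?case using cW by simp
  next
    case (Suc j)
    have S: "ck_on j S {l<..1}"
      unfolding S_def c1_def c2_def using Suc kappa l
      by (intro ck_on_add ck_on_mult ck_on_divide ck_on_power ck_on_diff ck_on_const ck_on_ident) auto
    show ?case
      by (rule ck_on_Suc_singular_linear[OF mu l(2) d eq S cW]) (auto simp: W_def)
  qed
  moreover have "W 1 < 0" using mu kappa by (simp add: W_def g_def divide_neg_pos)
  ultimately show ?thesis by (intro that[of W]) (auto simp: W_def)
qed

end

text \<open>In the last two alternatives \<open>a\<close> and \<open>b\<close>, respectively, are arbitrary.\<close>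

definition soliton_shape :: "real \<Rightarrow> real set \<Rightarrow> (real \<Rightarrow> real) \<Rightarrow> real \<Rightarrow> real \<Rightarrow> bool" where
  "soliton_shape R Jh W a b \<longleftrightarrow>
       -1 < a \<and> a < R \<and> R < b \<and> b < 1 \<and>
       ( (Jh = {a<..<b} \<and> (\<forall>s\<in>{a<..<R}. W s < 0) \<and> W R = 0 \<and> (\<forall>s\<in>{R<..<b}. W s > 0) \<and>
            filterlim W at_bot (at_right a) \<and> filterlim W at_top (at_left b))
       \<or> (Jh = {a<..<b} \<and> (\<exists>c\<in>{a<..<R}. (\<forall>s\<in>{a<..<c}. W s < 0) \<and> W c = 0 \<and> (\<forall>s\<in>{c<..<b}. W s > 0)) \<and>
            filterlim W at_bot (at_right a) \<and> filterlim W at_top (at_left b))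
       \<or> (Jh = {a<..<b} \<and> (\<exists>c\<in>{R<..<b}. (\<forall>s\<in>{a<..<c}. W s < 0) \<and> W c = 0 \<and> (\<forall>s\<in>{c<..<b}. W s > 0)) \<and>
            filterlim W at_bot (at_right a) \<and> filterlim W at_top (at_left b))
       \<or> (Jh = {a<..<b} \<and> (\<forall>s\<in>{a<..<b}. W s > 0) \<and>
            filterlim W at_top (at_right a) \<and> filterlim W at_top (at_left b))
       \<or> (Jh = {a<..<b} \<and> (\<forall>s\<in>{a<..<b}. W s < 0) \<and>
            filterlim W at_bot (at_right a) \<and> filterlim W at_bot (at_left b))
       \<or> (Jh = {-1..<b} \<and> (\<forall>s\<in>{-1..<b}. W s > 0) \<and> filterlim W at_top (at_left b))
       \<or> (Jh = {a<..1} \<and> (\<forall>s\<in>{a<..1}. W s < 0) \<and> filterlim W at_bot (at_right a)))"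

section \<open>Maximal solutions and their shapes\<close>

context translator_ode
begin

lemma sol_continuation_right:
  assumes w0: "sol w0 {l<..<u}" and lu: "-1 \<le> l" "l < u" "u \<le> 1"
  obtains b w where "u \<le> b" "b \<le> 1" "sol w {l<..<b}" "\<And>x. x \<in> {l<..<u} \<Longrightarrow> w x = w0 x"
    "b < 1 \<Longrightarrow> R < b \<and> (filterlim w at_top (at_left b) \<or> filterlim w at_bot (at_left b))"
proof -
  have "continuous_on {l<..<1} (soliton_coeff \<kappa> N R i)" for i
  proof -
    have "\<alpha> x \<noteq> 0" if "x \<in> {l<..<1}" for x
      by (rule less_imp_neq[OF alpha_pos, symmetric]) (use that lu in auto)
    then show ?thesis
    proof -
      assume *: "\<And>x. x \<in> {l<..<1} \<Longrightarrow> \<alpha> x \<noteq> 0"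
      consider "i = 0" | "i = 1" | "i = 2" | "i > 2" by linarith
      then show ?thesis
        unfolding soliton_coeff_def by cases (use * in \<open>auto intro!: continuous_intros\<close>)
    qed
  qed
  then obtain b w where b: "u \<le> b" "b \<le> 1" "sol w {l<..<b}" "\<And>x. x \<in> {l<..<u} \<Longrightarrow> w x = w0 x"
    "b < 1 \<Longrightarrow> filterlim (\<lambda>x. \<bar>w x\<bar>) at_top (at_left b)"
    using cubic_continuation[OF _ w0 lu(2,3)] by blast
  then show ?thesis using blow_up_right[OF b(3) lu(1)] lu by (intro that[of b w]) auto
qed

lemma reflected: "translator_ode \<kappa> N (- R)"
  using kappa N R by unfold_locales auto

text \<open>Continue to the right, reflect, continue to the right again, and reflect back.\<close>

lemma sol_maximal:
  assumes w0: "sol w0 {l<..<u}" and lu: "-1 \<le> l" "l < u" "u \<le> 1"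
  obtains a b w where "-1 \<le> a" "a \<le> l" "u \<le> b" "b \<le> 1" "sol w {a<..<b}" "\<And>x. x \<in> {l<..<u} \<Longrightarrow> w x = w0 x"
    "b < 1 \<Longrightarrow> R < b \<and> (filterlim w at_top (at_left b) \<or> filterlim w at_bot (at_left b))"
    "-1 < a \<Longrightarrow> a < R \<and> (filterlim w at_top (at_right a) \<or> filterlim w at_bot (at_right a))"
proof -
  obtain b w1 where b: "u \<le> b" "b \<le> 1" "sol w1 {l<..<b}" "\<And>x. x \<in> {l<..<u} \<Longrightarrow> w1 x = w0 x"
    "b < 1 \<Longrightarrow> R < b \<and> (filterlim w1 at_top (at_left b) \<or> filterlim w1 at_bot (at_left b))"
    using sol_continuation_right[OF w0 lu] by blast
  interpret r: translator_ode \<kappa> N "- R" by (rule reflected)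
  obtain c v where c: "- l \<le> c" "c \<le> 1" "r.sol v {- b<..<c}"
    "\<And>x. x \<in> {- b<..<- l} \<Longrightarrow> v x = - w1 (- x)"
    "c < 1 \<Longrightarrow> - R < c \<and> (filterlim v at_top (at_left c) \<or> filterlim v at_bot (at_left c))"
    by (rule r.sol_continuation_right[OF sol_reflect[OF b(3)]]) (use lu b in auto)
  define w where "w x = - v (- x)" for x
  have ww1: "w x = w1 x" if "x \<in> {l<..<b}" for x using c(4)[of "- x"] that by (simp add: w_def)
  have left: "filterlim w F (at_left b) \<longleftrightarrow> filterlim w1 F (at_left b)" for F
    by (rule filterlim_cong) (use eventually_at_left_real[of l b] ww1 b lu in \<open>auto elim: eventually_mono\<close>)
  have right: "filterlim w at_top (at_right (- c)) \<longleftrightarrow> filterlim v at_bot (at_left c)"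
    "filterlim w at_bot (at_right (- c)) \<longleftrightarrow> filterlim v at_top (at_left c)"
    unfolding w_def filterlim_at_left_to_right[of v]
      filterlim_uminus_at_bot[of "\<lambda>x. v (- x)"] filterlim_uminus_at_top[of "\<lambda>x. v (- x)"] by (rule refl)+
  show ?thesis
  proof (rule that[of "- c" b w])
    show "sol w {- c<..<b}" using r.sol_reflect[OF c(3)] by (simp add: w_def[abs_def])
    show "w x = w0 x" if "x \<in> {l<..<u}" for x using that ww1 b by auto
    show "b < 1 \<Longrightarrow> R < b \<and> (filterlim w at_top (at_left b) \<or> filterlim w at_bot (at_left b))"
      using b(5) by (simp add: left)
    show "-1 < - c \<Longrightarrow> - c < R \<and> (filterlim w at_top (at_right (- c)) \<or> filterlim w at_bot (at_right (- c)))"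
      using c(5) by (auto simp: right)
  qed (use b c in auto)
qed

lemma sol_from_minus_1:
  assumes w: "sol w {-1<..<u}" and u: "-1 < u" "u \<le> 1"
  obtains W where "\<And>x. x \<in> {-1<..<u} \<Longrightarrow> W x = w x" "\<And>x. x \<in> {-1..<u} \<Longrightarrow> W x > 0" "\<And>j. ck_on j W {-1..<u}"
proof -
  interpret r: translator_ode \<kappa> N "- R" by (rule reflected)
  have refl: "r.sol (\<lambda>x. - w (- x)) {- u<..<1}" using sol_reflect[OF w] by simp
  obtain v where v: "\<And>x. x \<in> {- u<..<1} \<Longrightarrow> v x = - w (- x)" "v 1 < 0" "\<And>j. ck_on j v {- u<..1}"
    using r.sol_extends_to_1[OF refl] u by auto
  define W where "W x = - v (- x)" for x
  have Ww: "W x = w x" if "x \<in> {-1<..<u}" for x using v(1)[of "- x"] that by (simp add: W_def)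
  show ?thesis
  proof (rule that[of W])
    show "W x = w x" if "x \<in> {-1<..<u}" for x using that by (rule Ww)
    show "W x > 0" if "x \<in> {-1..<u}" for x
    proof (cases "x = -1")
      case False
      then show ?thesis using r.sol_up_to_1_neg[OF refl, of "- x"] Ww[of x] that u by auto
    qed (use v in \<open>simp add: W_def\<close>)
    have "uminus ` {- u<..1} = {-1..<u}" by (simp add: image_uminus_greaterThanAtMost)
    then show "ck_on j W {-1..<u}" for j
      unfolding W_def using ck_on_minus[OF ck_on_reflect[OF v(3)]] by simp
  qed
qed

text \<open>Each end of the maximal solution is a singular point or a blow-up of definite sign, and
  the rule that negative values precede positive ones decides which pairs of ends occur. The last
  two conclusions are meant for end points belonging to \<open>J\<close>: an end of
  \<open>{l<..<u}\<close> outside the extended domain is a blow-up point of the given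
  solution.\<close>

lemma soliton_classification:
  assumes w0: "sol w0 {l<..<u}" and lu: "-1 \<le> l" "l < u" "u \<le> 1"
  obtains Jh W a b where "soliton_shape R Jh W a b" "\<And>j. ck_on j W Jh"
    "{l<..<u} \<subseteq> Jh" "\<And>x. x \<in> {l<..<u} \<Longrightarrow> W x = w0 x"
    "u \<notin> Jh \<Longrightarrow> filterlim w0 at_infinity (at_left u)"
    "l \<notin> Jh \<Longrightarrow> filterlim w0 at_infinity (at_right l)"
proof -
  obtain p q w where pq: "-1 \<le> p" "p \<le> l" "u \<le> q" "q \<le> 1" and w: "sol w {p<..<q}"
    and ww0: "\<And>x. x \<in> {l<..<u} \<Longrightarrow> w x = w0 x"
    and right: "q < 1 \<Longrightarrow> R < q \<and> (filterlim w at_top (at_left q) \<or> filterlim w at_bot (at_left q))"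
    and left: "-1 < p \<Longrightarrow> p < R \<and> (filterlim w at_top (at_right p) \<or> filterlim w at_bot (at_right p))"
    using sol_maximal[OF w0 lu] by blast
  have pltq: "p < q" using pq lu by linarith
  have evl: "filterlim w0 F (at_left u) \<longleftrightarrow> filterlim w F (at_left u)" for F
    by (rule filterlim_cong) (use eventually_at_left_real[of l u] ww0 lu in \<open>auto elim: eventually_mono\<close>)
  have evr: "filterlim w0 F (at_right l) \<longleftrightarrow> filterlim w F (at_right l)" for F
    by (rule filterlim_cong) (use eventually_at_right_real[of l u] ww0 lu in \<open>auto elim: eventually_mono\<close>)
  have inf: "filterlim f at_infinity F" if "filterlim f at_top F \<or> filterlim f at_bot F"
    for f :: "real \<Rightarrow> real" and F
    using that filterlim_mono[OF _ at_top_le_at_infinity order.refl] filterlim_mono[OF _ at_bot_le_at_infinity order.refl]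
    by blast
  have infu: "filterlim w0 at_infinity (at_left u)" if "q < 1" "\<not> u < q"
  proof -
    have "u = q" using that pq by simp
    then have "filterlim w at_infinity (at_left u)" using right[OF that(1)] inf by blast
    then show ?thesis by (simp only: evl)
  qed
  have infl: "filterlim w0 at_infinity (at_right l)" if "-1 < p" "\<not> p < l"
  proof -
    have "l = p" using that pq by simp
    then have "filterlim w at_infinity (at_right l)" using left[OF that(1)] inf by blast
    then show ?thesis by (simp only: evr)
  qed
  have pos_after: "w y > 0" if "p < x" "x < y" "y < q" "w x \<ge> 0" for x y
    using sol_pos_after[OF w] that pq by auto
  have left_top: "w x > 0" if "filterlim w at_top (at_right p)" "p < x" "x < q" for x
  proof -
    have "eventually (\<lambda>y. w y \<ge> 0 \<and> y \<in> {p<..<x}) (at_right p)"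
      using that by (intro eventually_conj eventually_at_right_real) (auto simp: filterlim_at_top)
    then obtain y where "w y \<ge> 0" "y \<in> {p<..<x}" by (auto dest: eventually_happens)
    then show ?thesis using pos_after[of y x] that by auto
  qed
  have right_bot: "w x < 0" if "filterlim w at_bot (at_left q)" "p < x" "x < q" for x
  proof (rule ccontr)
    assume "\<not> w x < 0"
    have "eventually (\<lambda>y. w y \<le> 0 \<and> y \<in> {x<..<q}) (at_left q)"
      using that by (intro eventually_conj eventually_at_left_real) (auto simp: filterlim_at_bot)
    then obtain y where "w y \<le> 0" "y \<in> {x<..<q}" by (auto dest: eventually_happens)
    then show False using pos_after[of x y] that \<open>\<not> w x < 0\<close> by auto
  qed
  have left_end: "w x > 0" if "p = -1" "p < x" "x < q" for x
  proof -
    have "sol w {-1<..<q}" "-1 < q" using w that by auto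
    then obtain W where W: "\<And>x. x \<in> {-1<..<q} \<Longrightarrow> W x = w x" "\<And>x. x \<in> {-1..<q} \<Longrightarrow> W x > 0"
      using sol_from_minus_1[of w q] pq(4) by metis
    show ?thesis using W(1)[of x] W(2)[of x] that by simp
  qed
  have right_end: "w x < 0" if "q = 1" "p < x" "x < q" for x
    using sol_up_to_1_neg[of w p x] w that pq by auto
  define x0 where "x0 = (p + q) / 2"
  have x0: "p < x0" "x0 < q" using pltq by (auto simp: x0_def)
  have sub: "{l<..<u} \<subseteq> {p<..<q}" using pq by auto
  have ck: "ck_on j w {p<..<q}" for j by (rule sol_ck_on[OF w]) (use pq in auto)
  \<comment> \<open>Three possibilities at each end make nine pairs. A positive start (blow-up to
    plus infinity, or \<open>p = -1\<close>) is incompatible with a negative finish (blow-up to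
    minus infinity, or \<open>q = 1\<close>), which leaves five.\<close>
  consider (neg_pos) "-1 < p" "filterlim w at_bot (at_right p)" "q < 1" "filterlim w at_top (at_left q)"
    | (neg) "-1 < p" "filterlim w at_bot (at_right p)" "q < 1" "filterlim w at_bot (at_left q)"
    | (pos) "-1 < p" "filterlim w at_top (at_right p)" "q < 1" "filterlim w at_top (at_left q)"
    | (neg_1) "-1 < p" "filterlim w at_bot (at_right p)" "q = 1"
    | (pos_1) "p = -1" "q < 1" "filterlim w at_top (at_left q)"
  proof -
    have "\<not> (filterlim w at_top (at_right p) \<and> filterlim w at_bot (at_left q))"
      using left_top right_bot x0 by force
    moreover have "\<not> (filterlim w at_top (at_right p) \<and> q = 1)" using left_top right_end x0 by force
    moreover have "\<not> (p = -1 \<and> q = 1)" using left_end right_end x0 by force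
    moreover have "\<not> (p = -1 \<and> filterlim w at_bot (at_left q))" using left_end right_bot x0 by force
    moreover have "p = -1 \<or> -1 < p" "q = 1 \<or> q < 1" using pq by auto
    ultimately show thesis using that left right by blast
  qed
  then show ?thesis
  proof cases
    case neg_pos
    note R = left[OF neg_pos(1)] right[OF neg_pos(3)]
    have "eventually (\<lambda>y. w y \<le> 0 \<and> y \<in> {p<..<x0}) (at_right p)"
      using neg_pos x0 by (intro eventually_conj eventually_at_right_real) (auto simp: filterlim_at_bot)
    then obtain y1 where y1: "w y1 \<le> 0" "y1 \<in> {p<..<x0}" by (auto dest: eventually_happens)
    have "eventually (\<lambda>y. w y \<ge> 0 \<and> y \<in> {x0<..<q}) (at_left q)"
      using neg_pos x0 by (intro eventually_conj eventually_at_left_real) (auto simp: filterlim_at_top)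
    then obtain y2 where y2: "w y2 \<ge> 0" "y2 \<in> {x0<..<q}" by (auto dest: eventually_happens)
    have "continuous_on {y1..y2} w"
      by (rule continuous_on_subset[OF sol_continuous[OF w]]) (use y1 y2 in auto)
    moreover have "y1 \<le> y2" using y1 y2 by auto
    ultimately obtain c where "y1 \<le> c" "c \<le> y2" "w c = 0" using IVT'[of w y1 0 y2] y1 y2 by blast
    then have c: "p < c" "c < q" "w c = 0" using y1 y2 by auto
    have "\<forall>s\<in>{p<..<c}. w s < 0"
    proof (rule ballI, rule ccontr)
      fix s assume "s \<in> {p<..<c}" "\<not> w s < 0"
      then show False using pos_after[of s c] c by auto
    qed
    moreover have "\<forall>s\<in>{c<..<q}. w s > 0" using pos_after[of c] c by auto
    note signs = calculation this
    have "soliton_shape R {p<..<q} w p q"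
    \<comment> \<open>The position of the zero relative to \<open>R\<close> separates the first
      three shapes.\<close>
    proof (cases c R rule: linorder_cases)
      case less
      then have "\<exists>c\<in>{p<..<R}. (\<forall>s\<in>{p<..<c}. w s < 0) \<and> w c = 0 \<and> (\<forall>s\<in>{c<..<q}. w s > 0)"
        using signs c by (intro bexI[of _ c] conjI) auto
      then show ?thesis unfolding soliton_shape_def using neg_pos R by (simp del: greaterThanLessThan_iff)
    next
      case equal
      then show ?thesis unfolding soliton_shape_def using neg_pos R signs c by (simp del: greaterThanLessThan_iff)
    next
      case greater
      then have "\<exists>c\<in>{R<..<q}. (\<forall>s\<in>{p<..<c}. w s < 0) \<and> w c = 0 \<and> (\<forall>s\<in>{c<..<q}. w s > 0)"
        using signs c by (intro bexI[of _ c] conjI) auto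
      then show ?thesis unfolding soliton_shape_def using neg_pos R by (simp del: greaterThanLessThan_iff)
    qed
    then show ?thesis
      by (rule that) (use ck sub ww0 infu infl neg_pos pltq pq lu in auto)
  next
    case neg
    have "\<forall>s\<in>{p<..<q}. w s < 0" using right_bot[OF neg(4)] by simp
    then have "soliton_shape R {p<..<q} w p q"
      unfolding soliton_shape_def using left[OF neg(1)] right[OF neg(3)] neg by (simp del: greaterThanLessThan_iff)
    then show ?thesis
      by (rule that) (use ck sub ww0 infu infl neg pltq pq lu in auto)
  next
    case pos
    have "\<forall>s\<in>{p<..<q}. w s > 0" using left_top[OF pos(2)] by simp
    then have "soliton_shape R {p<..<q} w p q"
      unfolding soliton_shape_def using left[OF pos(1)] right[OF pos(3)] pos by (simp del: greaterThanLessThan_iff)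
    then show ?thesis
      by (rule that) (use ck sub ww0 infu infl pos pltq pq lu in auto)
  next
    case neg_1
    then obtain W where W: "\<And>x. x \<in> {p<..<1} \<Longrightarrow> W x = w x" "W 1 < 0" "\<And>j. ck_on j W {p<..1}"
      using sol_extends_to_1[of w p] w pq pltq by blast
    have "filterlim W at_bot (at_right p) \<longleftrightarrow> filterlim w at_bot (at_right p)"
      by (rule filterlim_cong) (use eventually_at_right_real[of p 1] W pltq neg_1 in \<open>auto elim: eventually_mono\<close>)
    moreover have "\<forall>x\<in>{p<..1}. W x < 0"
    proof
      fix x assume "x \<in> {p<..1}"
      then show "W x < 0" using W(1)[of x] W(2) right_end[of x] neg_1 by (cases "x = 1") auto
    qed
    ultimately have "soliton_shape R {p<..1} W p ((R + 1) / 2)"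
      unfolding soliton_shape_def using neg_1 left[OF neg_1(1)] R by (simp del: greaterThanAtMost_iff)
    then show ?thesis
      by (rule that) (use W sub ww0 infl neg_1 pltq pq lu in auto)
  next
    case pos_1
    then obtain W where W: "\<And>x. x \<in> {-1<..<q} \<Longrightarrow> W x = w x" "\<And>x. x \<in> {-1..<q} \<Longrightarrow> W x > 0" "\<And>j. ck_on j W {-1..<q}"
      using sol_from_minus_1[of w q] w pq pltq by blast
    have "filterlim W at_top (at_left q) \<longleftrightarrow> filterlim w at_top (at_left q)"
      by (rule filterlim_cong) (use eventually_at_left_real[of p q] W pltq pos_1 in \<open>auto elim: eventually_mono\<close>)
    moreover have "\<forall>x\<in>{-1..<q}. W x > 0" using W(2) by blast
    ultimately have "soliton_shape R {-1..<q} W ((R - 1) / 2) q"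
      unfolding soliton_shape_def using pos_1 right[OF pos_1(2)] R by (simp del: atLeastLessThan_iff)
    then show ?thesis
      by (rule that) (use W sub ww0 infu pos_1 pltq pq lu in auto)
  qed
qed

end

section \<open>Traces and orthogonal projections\<close>


text \<open>Gradient and Hessian are built along the inductive construction of the polynomial.
  Symmetry is part of the induction claim; in the product case the two cross terms are
  exchanged.\<close>

lemma real_polynomial_function_gradient_hessian:
  fixes F :: "'a::euclidean_space \<Rightarrow> real"
  assumes "real_polynomial_function F"
  obtains g H where "\<And>x. (F has_derivative (\<lambda>v. g x \<bullet> v)) (at x)"
    "\<And>x. (g has_derivative H x) (at x)" "\<And>x v w. H x v \<bullet> w = H x w \<bullet> v"
proof -
  have "\<exists>g H. (\<forall>x. (F has_derivative (\<lambda>v. g x \<bullet> v)) (at x)) \<and>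
    (\<forall>x. (g has_derivative H x) (at x)) \<and> (\<forall>x v w. H x v \<bullet> w = H x w \<bullet> v)"
    using assms
  proof (induction F rule: real_polynomial_function.induct)
    case (linear f)
    have "(\<lambda>v. adjoint f 1 \<bullet> v) = f"
      using adjoint_works[OF bounded_linear.linear[OF linear], of _ 1] by (auto simp: inner_commute)
    then have "(f has_derivative (\<lambda>v. adjoint f 1 \<bullet> v)) (at x)" for x
      using bounded_linear_imp_has_derivative[OF linear, of "at x"] by simp
    then show ?case by (intro exI[of _ "\<lambda>x. adjoint f 1"] exI[of _ "\<lambda>x v. 0"]) auto
  next
    case (const c)
    show ?case by (intro exI[of _ "\<lambda>x. 0"] exI[of _ "\<lambda>x v. 0"]) auto
  next
    case (add f1 f2)
    then obtain g1 H1 g2 H2 where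
      "\<forall>x. (f1 has_derivative (\<lambda>v. g1 x \<bullet> v)) (at x)" "\<forall>x. (g1 has_derivative H1 x) (at x)"
      "\<forall>x v w. H1 x v \<bullet> w = H1 x w \<bullet> v"
      "\<forall>x. (f2 has_derivative (\<lambda>v. g2 x \<bullet> v)) (at x)" "\<forall>x. (g2 has_derivative H2 x) (at x)"
      "\<forall>x v w. H2 x v \<bullet> w = H2 x w \<bullet> v" by blast
    then show ?case
      by (intro exI[of _ "\<lambda>x. g1 x + g2 x"] exI[of _ "\<lambda>x v. H1 x v + H2 x v"])
        (auto simp: inner_add_left intro!: has_derivative_add)
  next
    case (mult f1 f2)
    then obtain g1 H1 g2 H2 where *:
      "\<And>x. (f1 has_derivative (\<lambda>v. g1 x \<bullet> v)) (at x)" "\<And>x. (g1 has_derivative H1 x) (at x)"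
      "\<And>x v w. H1 x v \<bullet> w = H1 x w \<bullet> v"
      "\<And>x. (f2 has_derivative (\<lambda>v. g2 x \<bullet> v)) (at x)" "\<And>x. (g2 has_derivative H2 x) (at x)"
      "\<And>x v w. H2 x v \<bullet> w = H2 x w \<bullet> v" by blast
    have "((\<lambda>x. f1 x * f2 x) has_derivative (\<lambda>v. (f1 x *\<^sub>R g2 x + f2 x *\<^sub>R g1 x) \<bullet> v)) (at x)" for x
      using has_derivative_mult[OF *(1,4)] by (simp add: inner_add_left algebra_simps)
    moreover have "((\<lambda>x. f1 x *\<^sub>R g2 x + f2 x *\<^sub>R g1 x) has_derivative
       (\<lambda>v. f1 x *\<^sub>R H2 x v + (g1 x \<bullet> v) *\<^sub>R g2 x + (f2 x *\<^sub>R H1 x v + (g2 x \<bullet> v) *\<^sub>R g1 x))) (at x)" for x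
      by (intro has_derivative_add has_derivative_scaleR *)
    moreover have "(f1 x *\<^sub>R H2 x v + (g1 x \<bullet> v) *\<^sub>R g2 x + (f2 x *\<^sub>R H1 x v + (g2 x \<bullet> v) *\<^sub>R g1 x)) \<bullet> w =
       (f1 x *\<^sub>R H2 x w + (g1 x \<bullet> w) *\<^sub>R g2 x + (f2 x *\<^sub>R H1 x w + (g2 x \<bullet> w) *\<^sub>R g1 x)) \<bullet> v" for x v w
      by (simp add: inner_add_left *(3)[of x v w] *(6)[of x v w])
    ultimately show ?case
      by (intro exI[of _ "\<lambda>x. f1 x *\<^sub>R g2 x + f2 x *\<^sub>R g1 x"]
          exI[of _ "\<lambda>x v. f1 x *\<^sub>R H2 x v + (g1 x \<bullet> v) *\<^sub>R g2 x + (f2 x *\<^sub>R H1 x v + (g2 x \<bullet> v) *\<^sub>R g1 x)"])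
        blast
  qed
  then show ?thesis using that by blast
qed

text \<open>Pairing a linear combination with \<open>b\<close> reads off its coefficient at
  \<open>b\<close>; this yields independence, hence finiteness, and the expansion. A general
  \<open>G\<close> is allowed because \<open>trace_wrt\<close> uses the induced metric of an
  immersion.\<close>

lemma orthonormal_expansion:
  fixes G :: "'a::euclidean_space \<Rightarrow> 'a \<Rightarrow> real"
  assumes G: "bilinear G" and B: "\<And>a b. a \<in> B \<Longrightarrow> b \<in> B \<Longrightarrow> G a b = (if a = b then 1 else 0)"
  shows "finite B" "v \<in> span B \<Longrightarrow> v = (\<Sum>b\<in>B. G v b *\<^sub>R b)"
proof -
  have coord: "G (\<Sum>b\<in>t. u b *\<^sub>R b) b = u b" if "finite t" "t \<subseteq> B" "b \<in> t" for t u b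
  proof -
    have lin: "linear (\<lambda>x. G x b)" using G by (simp add: bilinear_def)
    have "G (\<Sum>b\<in>t. u b *\<^sub>R b) b = (\<Sum>a\<in>t. u a * G a b)"
      using linear_sum[OF lin, of "\<lambda>a. u a *\<^sub>R a" t] linear_cmul[OF lin] by simp
    also have "\<dots> = (\<Sum>a\<in>t. if a = b then u a else 0)" 
    proof (rule sum.cong[OF refl])
      fix a assume "a \<in> t"
      then have "G a b = (if a = b then 1 else 0)" using B that by blast
      then show "u a * G a b = (if a = b then u a else 0)" by simp
    qed
    finally show ?thesis using that by simp
  qed
  have "linear (\<lambda>x. G x b)" for b using G by (simp add: bilinear_def)
  then have "G 0 b = 0" for b using linear_0 by blast
  then have "independent B" unfolding independent_explicit_module using coord by metis
  then show fin: "finite B" by (rule independent_imp_finite)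
  show "v = (\<Sum>b\<in>B. G v b *\<^sub>R b)" if v: "v \<in> span B"
  proof -
    obtain u where u: "v = (\<Sum>b\<in>B. u b *\<^sub>R b)" using v fin by (auto simp: span_finite)
    then show ?thesis using coord[OF fin order.refl] by simp
  qed
qed

lemma bilinear_inner: "bilinear ((\<bullet>) :: 'a::euclidean_space \<Rightarrow> 'a \<Rightarrow> real)"
  by (simp add: bilinear_def bounded_linear.linear bounded_linear_inner_left bounded_linear_inner_right)

lemma exists_orthonormal:
  fixes T :: "'a::euclidean_space set"
  assumes "subspace T"
  shows "\<exists>E. span E = T \<and> (\<forall>a\<in>E. \<forall>b\<in>E. a \<bullet> b = (if a = b then 1 else 0))"
proof -
  obtain E where "pairwise orthogonal E" "\<And>x. x \<in> E \<Longrightarrow> norm x = 1" "span E = T"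
    using orthonormal_basis_subspace[OF assms] by metis
  then show ?thesis
    by (intro exI[of _ E]) (auto simp: pairwise_def orthogonal_def norm_eq_1)
qed

section \<open>The metric induced on a graph of slope \<open>p\<close>\<close>

context
  fixes T :: "'a::euclidean_space set" and p :: 'a and G :: "'a \<Rightarrow> 'a \<Rightarrow> real" and E :: "'a set"
  assumes T: "subspace T" and p: "p \<in> T" and G: "\<And>v w. G v w = v \<bullet> w + (p \<bullet> v) * (p \<bullet> w)"
    and E: "span E = T" "\<And>a b. a \<in> E \<Longrightarrow> b \<in> E \<Longrightarrow> a \<bullet> b = (if a = b then 1 else 0)"
begin

text \<open>The map \<open>\<phi>\<close> below is the inverse square root of \<open>id + p p\<^sup>T\<close>.\<close>

lemma exists_graph_orthonormal:
  "\<exists>B. span B = T \<and> (\<forall>a\<in>B. \<forall>b\<in>B. G a b = (if a = b then 1 else 0))"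
proof -
  define s where "s = sqrt (1 + p \<bullet> p)"
  have s: "s > 0" "s * s = 1 + p \<bullet> p" by (auto simp: s_def add_pos_nonneg)
  \<comment> \<open>In the direction of \<open>p\<close> the map must scale by \<open>1 / s\<close>,
    that is \<open>1 - c * (p \<bullet> p) = 1 / s\<close>. With
    \<open>p \<bullet> p = (s - 1) * (s + 1)\<close> this gives a formula that also makes sense for
    \<open>p = 0\<close>.\<close>
  define c where "c = 1 / (s * (s + 1))"
  have c: "c * s * (s + 1) = 1" using s by (simp add: c_def)
  have pp: "p \<bullet> p = s * s - 1" using s by simp
  define \<phi> where "\<phi> v = v - (c * (p \<bullet> v)) *\<^sub>R p" for v
  have lin: "linear \<phi>" unfolding \<phi>_def
    by (auto intro!: linearI simp: algebra_simps inner_add_right)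
  have cs: "1 - c * (s * s - 1) = 1 / s"
  proof -
    have "s * (1 - c * (s * s - 1)) = s - (c * s * (s + 1)) * (s - 1)" by (simp add: algebra_simps)
    also have "\<dots> = 1" unfolding c by simp
    finally show ?thesis using s by (simp add: field_simps)
  qed
  have p\<phi>: "p \<bullet> \<phi> v = (p \<bullet> v) / s" for v
  proof -
    have "p \<bullet> \<phi> v = (p \<bullet> v) * (1 - c * (s * s - 1))"
      by (simp add: \<phi>_def inner_diff_right pp algebra_simps)
    then show ?thesis by (simp add: cs)
  qed
  have iso: "G (\<phi> v) (\<phi> w) = v \<bullet> w" for v w
  proof -
    have "\<phi> v \<bullet> \<phi> w = v \<bullet> w - 2 * c * (p \<bullet> v) * (p \<bullet> w) + c * c * (p \<bullet> p) * (p \<bullet> v) * (p \<bullet> w)"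
      by (simp add: \<phi>_def inner_diff_left inner_diff_right inner_commute[of v p] inner_commute[of w p] algebra_simps)
    also have "\<dots> = v \<bullet> w + (p \<bullet> v) * (p \<bullet> w) * (c * (c * (s * s - 1)) - 2 * c)"
      by (simp add: pp algebra_simps)
    also have "c * (s * s - 1) = 1 - 1 / s" using cs by simp
    also have "c * (1 - 1 / s) - 2 * c = - (c * s * (s + 1)) / (s * s)" using s(1) by (simp add: field_simps)
    also have "\<dots> = - 1 / (s * s)" unfolding c by simp
    finally show ?thesis unfolding G p\<phi> by simp
  qed
  have sub: "\<phi> ` T \<subseteq> T"
    using T p unfolding \<phi>_def by (auto intro: subspace_diff subspace_scale)
  have "v = 0" if "\<phi> v = 0" for v
    using iso[of v v] that by (simp add: G)
  then have inj: "inj \<phi>" using lin by (simp add: linear_injective_0)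
  then have "inj_on \<phi> (span T)" by (rule inj_on_subset) simp
  then have "dim (\<phi> ` T) = dim T" by (rule dim_image_eq[OF lin])
  then have "\<phi> ` T = T"
    using subspace_dim_equal[OF linear_subspace_image[OF lin T] T sub] by simp
  then have "span (\<phi> ` E) = T" using linear_span_image[OF lin, of E] E(1) by simp
  moreover have "\<forall>a\<in>\<phi> ` E. \<forall>b\<in>\<phi> ` E. G a b = (if a = b then 1 else 0)"
    using iso E(2) inj by (auto simp: inj_eq)
  ultimately show ?thesis by blast
qed

text \<open>The trace with respect to \<open>G\<close> is the contraction of \<open>Q\<close> with
  the inverse metric. For a rank-one perturbation of the inner product the inverse is explicit
  (Sherman-Morrison), and \<open>K\<close> recovers it from the basis \<open>B\<close>.\<close>

lemma graph_trace:
  fixes Q :: "'a \<Rightarrow> 'a \<Rightarrow> real"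
  assumes Q: "bilinear Q" and B: "span B = T" "\<And>a b. a \<in> B \<Longrightarrow> b \<in> B \<Longrightarrow> G a b = (if a = b then 1 else 0)"
  shows "(\<Sum>b\<in>B. Q b b) = (\<Sum>e\<in>E. Q e e) - Q p p / (1 + p \<bullet> p)"
proof -
  have bG: "bilinear G" unfolding G
    by (auto simp: bilinear_def algebra_simps inner_add_right inner_add_left intro!: linearI)
  have B': "v = (\<Sum>b\<in>B. G v b *\<^sub>R b)" if "v \<in> span B" for v
    using orthonormal_expansion(2)[of G B v] bG B(2) that by blast
  have E': "finite E" "\<And>v. v \<in> span E \<Longrightarrow> v = (\<Sum>e\<in>E. (v \<bullet> e) *\<^sub>R e)"
    using orthonormal_expansion[of "(\<bullet>)" E] bilinear_inner E(2) by blast+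
  define q where "q = 1 + p \<bullet> p"
  have q: "q > 0" by (simp add: q_def add_pos_nonneg)
  \<comment> \<open>\<open>sh\<close> is the inverse of \<open>id + p p^T\<close>, so pairing with
    \<open>sh v\<close> under \<open>G\<close> is pairing with \<open>v\<close> under the inner
    product.\<close>
  define sh where "sh v = v - ((p \<bullet> v) / q) *\<^sub>R p" for v
  have sh: "G b (sh v) = b \<bullet> v" for b v
  proof -
    have "p \<bullet> sh v = (p \<bullet> v) / q"
      using q by (simp add: sh_def inner_diff_right field_simps) (simp add: q_def algebra_simps)
    then show ?thesis by (simp add: G) (simp add: sh_def inner_diff_right inner_commute[of b p])
  qed
  have K: "(\<Sum>b\<in>B. (b \<bullet> v) * (b \<bullet> w)) = v \<bullet> w - (p \<bullet> v) * (p \<bullet> w) / q" if v: "v \<in> T" for v w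
  proof -
    have "sh v \<in> span B" unfolding B(1) sh_def using v p T by (intro subspace_diff subspace_scale) auto
    have "v \<bullet> w - (p \<bullet> v) * (p \<bullet> w) / q = G (sh v) (sh w)"
      unfolding sh by (simp add: sh_def inner_diff_left)
    also have "\<dots> = G (\<Sum>b\<in>B. G (sh v) b *\<^sub>R b) (sh w)"
      using B'[OF \<open>sh v \<in> span B\<close>] by simp
    also have "\<dots> = (\<Sum>b\<in>B. G (sh v) b * G b (sh w))"
    proof -
      have lin: "linear (\<lambda>x. G x (sh w))" using bG by (simp add: bilinear_def)
      show ?thesis
        using linear_sum[OF lin, of "\<lambda>b. G (sh v) b *\<^sub>R b" B] linear_cmul[OF lin] by simp
    qed
    also have "\<dots> = (\<Sum>b\<in>B. (b \<bullet> v) * (b \<bullet> w))"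
    proof -
      have "G (sh v) b = G b (sh v)" for b unfolding G by (simp add: inner_commute mult.commute)
      then have "G (sh v) b = b \<bullet> v" for b using sh by simp
      then show ?thesis by (simp only: sh)
    qed
    finally show ?thesis by simp
  qed
  have ex: "Q v w = (\<Sum>e\<in>E. \<Sum>e'\<in>E. (v \<bullet> e) * (w \<bullet> e') * Q e e')" if "v \<in> T" "w \<in> T" for v w
  proof -
    have "Q v w = Q (\<Sum>e\<in>E. (v \<bullet> e) *\<^sub>R e) (\<Sum>e\<in>E. (w \<bullet> e) *\<^sub>R e)"
      using E'(2)[of v] E'(2)[of w] that E(1) by simp
    also have "\<dots> = (\<Sum>e\<in>E. \<Sum>e'\<in>E. Q ((v \<bullet> e) *\<^sub>R e) ((w \<bullet> e') *\<^sub>R e'))"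
      by (simp add: bilinear_sum[OF Q] sum.cartesian_product)
    finally show ?thesis by (simp add: bilinear_lmul[OF Q] bilinear_rmul[OF Q] mult_ac)
  qed
  have BT: "b \<in> T" if "b \<in> B" for b using that B(1) span_base by blast
  have ET: "e \<in> T" if "e \<in> E" for e using that E(1) span_base by blast
  have "(\<Sum>b\<in>B. Q b b) = (\<Sum>b\<in>B. \<Sum>e\<in>E. \<Sum>e'\<in>E. (b \<bullet> e) * (b \<bullet> e') * Q e e')"
    using ex BT by (intro sum.cong) auto
  also have "\<dots> = (\<Sum>e\<in>E. \<Sum>e'\<in>E. \<Sum>b\<in>B. (b \<bullet> e) * (b \<bullet> e') * Q e e')"
    by (subst sum.swap, rule sum.cong[OF refl], rule sum.swap)
  also have "\<dots> = (\<Sum>e\<in>E. \<Sum>e'\<in>E. (e \<bullet> e' - (p \<bullet> e) * (p \<bullet> e') / q) * Q e e')"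
    by (simp add: sum_distrib_right[symmetric] K ET cong: sum.cong)
  also have "\<dots> = (\<Sum>e\<in>E. \<Sum>e'\<in>E. (e \<bullet> e') * Q e e') - (\<Sum>e\<in>E. \<Sum>e'\<in>E. (p \<bullet> e) * (p \<bullet> e') * Q e e') / q"
    by (simp add: left_diff_distrib sum_subtractf sum_divide_distrib)
  also have "(\<Sum>e\<in>E. \<Sum>e'\<in>E. (e \<bullet> e') * Q e e') = (\<Sum>e\<in>E. \<Sum>e'\<in>E. if e' = e then Q e e' else 0)"
    using E(2) by (intro sum.cong refl) auto
  also have "\<dots> = (\<Sum>e\<in>E. Q e e)" using E'(1) by simp
  finally show ?thesis using ex[OF p p] by (simp add: q_def)
qed

end

lemma sphere_tangent_subspace: "subspace (sphere_tangent x)"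
  unfolding sphere_tangent_def by (auto simp: subspace_def inner_add_left)

lemma orth_proj_unique:
  assumes "subspace S" "p \<in> S" "w - p \<in> orthogonal_comp S"
  shows "orth_proj S w = p"
  unfolding orth_proj_def
proof (rule the_equality)
  fix p' assume p': "p' \<in> S \<and> w - p' \<in> orthogonal_comp S"
  have "p' - p \<in> S" using assms p' by (auto intro: subspace_diff)
  then have "(p' - p) \<bullet> (w - p) = 0" "(p' - p) \<bullet> (w - p') = 0"
    using assms(3) p' by (auto simp: orthogonal_comp_def orthogonal_def inner_commute)
  then have "(p' - p) \<bullet> (p' - p) = 0" by (simp add: inner_diff_right)
  then show "p' = p" by simp
qed (use assms in auto)

lemma orth_proj_line:
  fixes \<nu> :: "'a::euclidean_space"
  assumes "S = range (\<lambda>c. c *\<^sub>R \<nu>)" "\<nu> \<noteq> 0"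
  shows "orth_proj S w = ((w \<bullet> \<nu>) / (\<nu> \<bullet> \<nu>)) *\<^sub>R \<nu>"
proof (rule orth_proj_unique)
  show "subspace S" using assms(1) span_singleton[of \<nu>] subspace_span by metis
  show "w - ((w \<bullet> \<nu>) / (\<nu> \<bullet> \<nu>)) *\<^sub>R \<nu> \<in> orthogonal_comp S"
    using assms by (auto simp: orthogonal_comp_def orthogonal_def inner_diff_right inner_commute)
qed (use assms in auto)

lemma orth_proj_tangent:
  fixes x :: "'a::euclidean_space"
  assumes "norm x = 1"
  shows "orth_proj (sphere_tangent x) w = w - (w \<bullet> x) *\<^sub>R x"
  using assms
  by (intro orth_proj_unique sphere_tangent_subspace)
    (auto simp: sphere_tangent_def orthogonal_comp_def orthogonal_def inner_diff_left norm_eq_1)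

section \<open>Calculus with polynomials on the sphere\<close>


lemma norm_has_derivative':
  fixes x :: "'a::euclidean_space"
  shows "x \<noteq> 0 \<Longrightarrow> (norm has_derivative (\<lambda>v. v \<bullet> sgn x)) (at x)"
  using has_derivative_norm[of x] by (simp add: inner_commute)

lemma sgn_has_derivative:
  fixes x :: "'a::euclidean_space"
  assumes "x \<noteq> 0"
  shows "(sgn has_derivative (\<lambda>v. (1 / norm x) *\<^sub>R (v - (v \<bullet> sgn x) *\<^sub>R sgn x))) (at x)"
proof -
  have "((\<lambda>y. inverse (norm y) *\<^sub>R y) has_derivative
      (\<lambda>v. inverse (norm x) *\<^sub>R v + (- (inverse (norm x) * (v \<bullet> sgn x) * inverse (norm x))) *\<^sub>R x)) (at x)"
    using assms norm_has_derivative'[OF assms] by (auto intro!: derivative_eq_intros)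
  moreover have "inverse (norm x) *\<^sub>R v + (- (inverse (norm x) * (v \<bullet> sgn x) * inverse (norm x))) *\<^sub>R x =
      (1 / norm x) *\<^sub>R (v - (v \<bullet> sgn x) *\<^sub>R sgn x)" for v
    by (simp add: sgn_div_norm scaleR_diff_right inverse_eq_divide)
  moreover have "(\<lambda>y. inverse (norm y) *\<^sub>R y) = (sgn :: 'a \<Rightarrow> 'a)"
    by (auto simp: sgn_div_norm)
  ultimately show ?thesis by simp
qed

text \<open>On an open part of the cone the derivative within the cone is the full derivative, hence
  unique, and may be computed from any explicit formula for the radially constant extension.\<close>

lemma dS_eqI:
  assumes U: "open U" "U \<subseteq> sgn -` M" "y \<in> U" and G: "(G has_derivative D) (at y)"
    and h: "\<And>z. z \<in> U \<Longrightarrow> h (sgn z) = G z"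
  shows "dS M h y v = D v"
proof -
  have "((h \<circ> sgn) has_derivative D) (at y)"
    by (rule has_derivative_transform_within_open[OF G U(1,3)]) (use h in auto)
  moreover have "at y within sgn -` M = at y"
    using U by (intro at_within_open_subset) auto
  ultimately show ?thesis by (simp add: dS_def frechet_derivative_at[symmetric])
qed

lemma d2S_eqI:
  assumes U: "open U" "U \<subseteq> sgn -` M" "x \<in> U"
    and G: "\<And>y. y \<in> U \<Longrightarrow> (G has_derivative G' y) (at y)"
    and h: "\<And>z. z \<in> U \<Longrightarrow> h (sgn z) = G z"
    and E: "((\<lambda>y. G' y w) has_derivative E) (at x)"
  shows "d2S M h x v w = E v"
proof -
  have "dS M h y w = G' y w" if "y \<in> U" for y
    by (rule dS_eqI[OF U(1,2) that G[OF that] h])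
  then have "((\<lambda>y. dS M h y w) has_derivative E) (at x)"
    by (intro has_derivative_transform_within_open[OF E U(1,3)]) auto
  moreover have "at x within sgn -` M = at x"
    using U by (intro at_within_open_subset) auto
  ultimately show ?thesis by (simp add: d2S_def frechet_derivative_at[symmetric])
qed

section \<open>The restriction of a homogeneous polynomial to the sphere\<close>

locale sphere_polynomial =
  fixes r F :: "'a::euclidean_space \<Rightarrow> real" and g :: "'a \<Rightarrow> 'a" and H :: "'a \<Rightarrow> 'a \<Rightarrow> 'a" and k :: nat
  assumes F: "\<And>x. (F has_derivative (\<lambda>v. g x \<bullet> v)) (at x)"
    and g: "\<And>x. (g has_derivative H x) (at x)"
    and H_sym: "\<And>x v w. H x v \<bullet> w = H x w \<bullet> v"
    and hom: "\<And>c x. F (c *\<^sub>R x) = c ^ k * F x"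
    and rF: "\<And>x. x \<in> sphere 0 1 \<Longrightarrow> r x = F x"
    and normalized: "\<And>x. x \<in> sphere 0 1 \<Longrightarrow> (norm (gradS r x))\<^sup>2 = (real k)\<^sup>2 * (1 - (r x)\<^sup>2)"
begin

lemma euler: "g x \<bullet> x = real k * F x"
proof -
  have "((\<lambda>c. F (c *\<^sub>R x)) has_derivative (\<lambda>c. g (1 *\<^sub>R x) \<bullet> (c *\<^sub>R x))) (at 1)"
    by (rule has_derivative_compose[OF _ F]) (auto intro!: derivative_eq_intros)
  then have "((\<lambda>c. F (c *\<^sub>R x)) has_real_derivative g x \<bullet> x) (at 1)"
    by (simp add: has_field_derivative_def mult_commute_abs)
  moreover have "((\<lambda>c. c ^ k * F x) has_real_derivative real k * F x) (at 1)"
    by (auto intro!: derivative_eq_intros)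
  ultimately show ?thesis unfolding hom by (rule DERIV_unique)
qed

text \<open>By \<open>euler\<close> this is, on the sphere, the tangential part of the Euclidean
  gradient \<open>g\<close>; the formula makes sense on the whole space, where it can be
  differentiated.\<close>

definition \<gamma> :: "'a \<Rightarrow> 'a" where "\<gamma> z = g z - (real k * F z) *\<^sub>R z"
definition \<gamma>' :: "'a \<Rightarrow> 'a \<Rightarrow> 'a" where
  "\<gamma>' z v = H z v - ((real k * F z) *\<^sub>R v + (real k * (g z \<bullet> v)) *\<^sub>R z)"
text \<open>The Euclidean Hessian with the correction for the second fundamental form of the sphere:
  by \<open>euler\<close>, \<open>real k * F x\<close> is the radial derivative of \<open>F\<close>
  on the sphere.\<close>

definition hess :: "'a \<Rightarrow> 'a \<Rightarrow> 'a \<Rightarrow> real" where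
  "hess x v w = H x v \<bullet> w - real k * F x * (v \<bullet> w)"

lemma gamma_derivative: "(\<gamma> has_derivative \<gamma>' z) (at z)"
  unfolding \<gamma>_def \<gamma>'_def
  by (intro has_derivative_diff g has_derivative_scaleR has_derivative_mult_right F has_derivative_ident)

lemma H_linear: "linear (H x)"
  using g[of x] has_derivative_linear by blast

lemma hess_bilinear: "bilinear (hess x)"
  using H_linear[of x] unfolding bilinear_def hess_def
  by (auto intro!: linearI simp: linear_add linear_cmul inner_add_left inner_add_right algebra_simps)

lemma hess_sym: "hess x v w = hess x w v"
  by (simp add: hess_def H_sym[of x v w] inner_commute[of v w])

lemma gamma_tangent: "norm x = 1 \<Longrightarrow> \<gamma> x \<bullet> x = 0"
  by (simp add: \<gamma>_def inner_diff_left euler norm_eq_1)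

lemma gamma'_hess: "w \<bullet> x = 0 \<Longrightarrow> \<gamma>' x v \<bullet> w = hess x v w"
  by (simp add: \<gamma>'_def hess_def inner_diff_left inner_add_left inner_commute[of x])

lemma sgn_derivative_tangent:
  fixes x :: 'a
  shows "norm x = 1 \<Longrightarrow> (sgn has_derivative (\<lambda>v. v - (v \<bullet> x) *\<^sub>R x)) (at x)"
  using sgn_has_derivative[of x] by (cases "x = 0") (auto simp: sgn_div_norm)

text \<open>The formula is needed off the sphere as well, hence the factor
  \<open>1 / norm y\<close>: \<open>d2S\<close> differentiates it once more in a neighbourhood of
  \<open>x\<close>.\<close>

lemma F_sgn_derivative:
  assumes "y \<noteq> 0"
  shows "((\<lambda>y. F (sgn y)) has_derivative (\<lambda>w. (\<gamma> (sgn y) \<bullet> w) / norm y)) (at y)"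
proof -
  have "((\<lambda>y. F (sgn y)) has_derivative
      (\<lambda>w. g (sgn y) \<bullet> ((1 / norm y) *\<^sub>R (w - (w \<bullet> sgn y) *\<^sub>R sgn y)))) (at y)"
    by (rule has_derivative_compose[OF sgn_has_derivative[OF assms] F])
  moreover have "g (sgn y) \<bullet> ((1 / norm y) *\<^sub>R (w - (w \<bullet> sgn y) *\<^sub>R sgn y)) = (\<gamma> (sgn y) \<bullet> w) / norm y" for w
    by (simp add: \<gamma>_def inner_diff_right inner_diff_left euler inner_commute[of w])
  ultimately show ?thesis by (simp only:)
qed

lemma F_sgn_second_derivative:
  assumes x: "norm x = 1"
  shows "((\<lambda>y. (\<gamma> (sgn y) \<bullet> w) / norm y) has_derivative
    (\<lambda>v. \<gamma>' x (v - (v \<bullet> x) *\<^sub>R x) \<bullet> w - (\<gamma> x \<bullet> w) * (x \<bullet> v))) (at x)"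
proof -
  have "x \<noteq> 0" "sgn x = x" using x by (auto simp: sgn_div_norm)
  have "((\<lambda>y. \<gamma> (sgn y)) has_derivative (\<lambda>v. \<gamma>' (sgn x) (v - (v \<bullet> x) *\<^sub>R x))) (at x)"
    by (rule has_derivative_compose[OF sgn_derivative_tangent[OF x] gamma_derivative])
  then show ?thesis
    using \<open>x \<noteq> 0\<close> x norm_has_derivative'[OF \<open>x \<noteq> 0\<close>] unfolding \<open>sgn x = x\<close>
    by (auto intro!: derivative_eq_intros simp: \<open>sgn x = x\<close> inner_commute)
qed

lemma sgn_nonzero: "y \<noteq> 0 \<Longrightarrow> sgn y \<in> sphere 0 1" for y :: 'a
  by (simp add: norm_sgn)

lemma dS_r: 
  assumes "y \<noteq> 0"
  shows "dS (sphere 0 1) r y w = (\<gamma> (sgn y) \<bullet> w) / norm y"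
  by (rule dS_eqI[of "- {0}", OF _ _ _ F_sgn_derivative]) (use assms rF sgn_nonzero in auto)

lemma d2S_r:
  assumes "norm x = 1" "v \<bullet> x = 0" "w \<bullet> x = 0"
  shows "d2S (sphere 0 1) r x v w = hess x v w"
proof -
  have "d2S (sphere 0 1) r x v w = \<gamma>' x (v - (v \<bullet> x) *\<^sub>R x) \<bullet> w - (\<gamma> x \<bullet> w) * (x \<bullet> v)"
    by (rule d2S_eqI[of "- {0}", OF _ _ _ F_sgn_derivative _ F_sgn_second_derivative])
      (use assms rF sgn_nonzero in auto)
  then show ?thesis using assms gamma'_hess by (simp add: inner_commute)
qed

lemma gradS_r: 
  assumes "norm x = 1"
  shows "gradS r x = \<gamma> x"
  unfolding gradS_def
proof (rule the_equality)
  have "x \<noteq> 0" "sgn x = x" using assms by (auto simp: sgn_div_norm)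
  then have d: "dS (sphere 0 1) r x v = \<gamma> x \<bullet> v" for v using dS_r assms by simp
  show "\<gamma> x \<in> sphere_tangent x \<and> (\<forall>v\<in>sphere_tangent x. dS (sphere 0 1) r x v = \<gamma> x \<bullet> v)"
    using gamma_tangent[OF assms] d by (auto simp: sphere_tangent_def)
  fix D assume D: "D \<in> sphere_tangent x \<and> (\<forall>v\<in>sphere_tangent x. dS (sphere 0 1) r x v = D \<bullet> v)"
  then have "D - \<gamma> x \<in> sphere_tangent x"
    using gamma_tangent[OF assms] by (auto simp: sphere_tangent_def inner_diff_left)
  then have "\<gamma> x \<bullet> (D - \<gamma> x) = D \<bullet> (D - \<gamma> x)" using D d by auto
  then have "(D - \<gamma> x) \<bullet> (D - \<gamma> x) = 0" by (simp add: inner_diff_left)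
  then show "D = \<gamma> x" by simp
qed

lemma gamma_norm: "norm x = 1 \<Longrightarrow> \<gamma> x \<bullet> \<gamma> x = (real k)\<^sup>2 * (1 - (F x)\<^sup>2)"
  using normalized[of x] gradS_r[of x] rF[of x] by (simp add: power2_norm_eq_inner)

lemma hess_gamma_gamma:
  assumes x: "norm x = 1"
  shows "hess x (\<gamma> x) (\<gamma> x) = - (real k)\<^sup>2 * F x * (\<gamma> x \<bullet> \<gamma> x)"
proof -
  have sx: "sgn x = x" and x0: "x \<noteq> 0" using x by (auto simp: sgn_div_norm)
  \<comment> \<open>The normalization identity, extended radially: \<open>?\<psi>\<close> vanishes
    near \<open>x\<close> in the whole space, so its derivative is zero and may be evaluated at
    \<open>\<gamma> x\<close>.\<close>
  let ?\<psi> = "\<lambda>y. \<gamma> (sgn y) \<bullet> \<gamma> (sgn y) - (real k)\<^sup>2 * (1 - (F (sgn y))\<^sup>2)"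
  have "((\<lambda>y. \<gamma> (sgn y)) has_derivative (\<lambda>v. \<gamma>' (sgn x) (v - (v \<bullet> x) *\<^sub>R x))) (at x)"
    by (rule has_derivative_compose[OF sgn_derivative_tangent[OF x] gamma_derivative])
  note d1 = has_derivative_inner[OF this this]
  have "((\<lambda>y. (F (sgn y))\<^sup>2) has_derivative (\<lambda>w. 2 * F (sgn x) * ((\<gamma> (sgn x) \<bullet> w) / norm x))) (at x)"
    using F_sgn_derivative[OF x0] by (auto intro!: derivative_eq_intros)
  then have d2: "((\<lambda>y. (real k)\<^sup>2 * (1 - (F (sgn y))\<^sup>2)) has_derivative
      (\<lambda>w. (real k)\<^sup>2 * (0 - 2 * F (sgn x) * ((\<gamma> (sgn x) \<bullet> w) / norm x)))) (at x)"
    by (intro has_derivative_mult_right has_derivative_diff has_derivative_const)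
  have "(?\<psi> has_derivative (\<lambda>v. (\<gamma> (sgn x) \<bullet> \<gamma>' (sgn x) (v - (v \<bullet> x) *\<^sub>R x) + \<gamma>' (sgn x) (v - (v \<bullet> x) *\<^sub>R x) \<bullet> \<gamma> (sgn x))
      - (real k)\<^sup>2 * (0 - 2 * F (sgn x) * ((\<gamma> (sgn x) \<bullet> v) / norm x)))) (at x)"
    by (rule has_derivative_diff[OF d1 d2])
  moreover have "(?\<psi> has_derivative (\<lambda>v. 0)) (at x)"
    by (rule has_derivative_transform_within_open[OF has_derivative_const[of 0], of "- {0}"])
      (use x0 gamma_norm norm_sgn in \<open>auto simp: norm_sgn\<close>)
  ultimately have "(\<lambda>v. (\<gamma> (sgn x) \<bullet> \<gamma>' (sgn x) (v - (v \<bullet> x) *\<^sub>R x) + \<gamma>' (sgn x) (v - (v \<bullet> x) *\<^sub>R x) \<bullet> \<gamma> (sgn x))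
      - (real k)\<^sup>2 * (0 - 2 * F (sgn x) * ((\<gamma> (sgn x) \<bullet> v) / norm x))) = (\<lambda>v. 0)"
    by (rule has_derivative_unique)
  from fun_cong[OF this, of "\<gamma> x"]
  have "2 * (\<gamma>' x (\<gamma> x) \<bullet> \<gamma> x) + 2 * (real k)\<^sup>2 * F x * (\<gamma> x \<bullet> \<gamma> x) = 0"
    using x sx gamma_tangent[OF x] by (simp add: inner_commute)
  then show ?thesis using gamma'_hess[OF gamma_tangent[OF x], of "\<gamma> x"] by simp
qed

text \<open>\<open>laplS\<close> sums over a basis hidden in a choice; exposing that basis lets it
  be compared with the one chosen for the induced metric.\<close>

lemma laplS_r:
  assumes x: "norm x = 1"
  obtains E where "span E = sphere_tangent x" "\<And>a b. a \<in> E \<Longrightarrow> b \<in> E \<Longrightarrow> a \<bullet> b = (if a = b then 1 else 0)"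
    "laplS r x = (\<Sum>e\<in>E. hess x e e)"
proof -
  define E where "E = (SOME B. span B = sphere_tangent x \<and> (\<forall>a\<in>B. \<forall>b\<in>B. a \<bullet> b = (if a = b then 1 else 0)))"
  have E: "span E = sphere_tangent x \<and> (\<forall>a\<in>E. \<forall>b\<in>E. a \<bullet> b = (if a = b then 1 else 0))"
    unfolding E_def by (rule someI_ex[OF exists_orthonormal[OF sphere_tangent_subspace]])
  have "e \<bullet> x = 0" if "e \<in> E" for e
    using that E span_base[of e E] by (auto simp: sphere_tangent_def)
  then have "laplS r x = (\<Sum>e\<in>E. hess x e e)"
    unfolding laplS_def trace_wrt_def E_def[symmetric] using d2S_r[OF x] by (intro sum.cong) auto
  then show ?thesis using that E by blast
qed

end

section \<open>The soliton equation for graphs\<close>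


context sphere_polynomial
begin

text \<open>The spherical gradient of \<open>V \<circ> r\<close> when \<open>V1\<close> is the
  derivative of \<open>V\<close>.\<close>

definition graph_slope :: "(real \<Rightarrow> real) \<Rightarrow> 'a \<Rightarrow> 'a" where
  "graph_slope V1 x = V1 (F x) *\<^sub>R \<gamma> x"

text \<open>The Hessian of \<open>V \<circ> r\<close> on tangent vectors, by the chain rule.\<close>

definition graph_hess :: "(real \<Rightarrow> real) \<Rightarrow> (real \<Rightarrow> real) \<Rightarrow> 'a \<Rightarrow> 'a \<Rightarrow> 'a \<Rightarrow> real" where
  "graph_hess V1 V2 x v w = V2 (F x) * (\<gamma> x \<bullet> v) * (\<gamma> x \<bullet> w) + V1 (F x) * hess x v w"

section \<open>Geometry of the graph at a point over an interior level\<close>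

context
  fixes J :: "real set" and V V1 V2 :: "real \<Rightarrow> real" and h :: "'a \<Rightarrow> 'a \<times> real" and M :: "'a set" and x :: 'a
  assumes V1: "\<And>s. s \<in> interior J \<Longrightarrow> (V has_real_derivative V1 s) (at s)"
    and V2: "\<And>s. s \<in> interior J \<Longrightarrow> (V1 has_real_derivative V2 s) (at s)"
    and M: "M = {x \<in> sphere 0 1. r x \<in> J}" and h: "\<And>y. y \<in> M \<Longrightarrow> h y = (y, V (r y))"
    and x: "norm x = 1" "F x \<in> interior J"
begin

abbreviation "slope \<equiv> graph_slope V1 x"
abbreviation "hessian \<equiv> graph_hess V1 V2 x"

lemma sgn_x: "sgn x = x" "x \<noteq> 0" "x \<bullet> x = 1"
proof -
  show "sgn x = x" "x \<noteq> 0" using x(1) by (auto simp: sgn_div_norm)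
  show "x \<bullet> x = 1" using x(1) by (simp add: norm_eq_1)
qed

text \<open>Over levels interior to \<open>J\<close> the cone over \<open>M\<close> contains an open
  set around \<open>x\<close>, so the derivatives within the cone become ordinary ones.\<close>

lemma cone_neighbourhood:
  defines "U \<equiv> {y \<in> - {0}. F (sgn y) \<in> interior J}"
  shows "open U" "U \<subseteq> sgn -` M" "x \<in> U" "y \<in> U \<Longrightarrow> h (sgn y) = (sgn y, V (F (sgn y)))"
proof -
  have "continuous_on (- {0}) (\<lambda>y. F (sgn y))"
    using F_sgn_derivative has_derivative_continuous
    by (intro continuous_at_imp_continuous_on) blast
  then have "open (- {0} \<inter> (\<lambda>y. F (sgn y)) -` interior J)"
    by (rule continuous_open_preimage) auto
  also have "- {0} \<inter> (\<lambda>y. F (sgn y)) -` interior J = U" by (auto simp: U_def)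
  finally show "open U" .
  show sub: "U \<subseteq> sgn -` M"
    using sgn_nonzero rF interior_subset[of J] by (auto simp: U_def M)
  show "x \<in> U" using x sgn_x by (simp add: U_def)
  show "h (sgn y) = (sgn y, V (F (sgn y)))" if "y \<in> U"
    using h[of "sgn y"] sub that rF[of "sgn y"] sgn_nonzero[of y] by (auto simp: U_def)
qed

lemma graph_derivative:
  assumes "y \<noteq> 0" "F (sgn y) \<in> interior J"
  shows "((\<lambda>y. (sgn y, V (F (sgn y)))) has_derivative
    (\<lambda>w. ((1 / norm y) *\<^sub>R (w - (w \<bullet> sgn y) *\<^sub>R sgn y), V1 (F (sgn y)) * ((\<gamma> (sgn y) \<bullet> w) / norm y)))) (at y)"
proof (rule has_derivative_Pair[OF sgn_has_derivative[OF assms(1)]])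
  have "(V has_derivative (*) (V1 (F (sgn y)))) (at (F (sgn y)))"
    using V1[OF assms(2)] by (simp add: has_field_derivative_def)
  then show "((\<lambda>y. V (F (sgn y))) has_derivative (\<lambda>w. V1 (F (sgn y)) * ((\<gamma> (sgn y) \<bullet> w) / norm y))) (at y)"
    by (rule has_derivative_compose[OF F_sgn_derivative[OF assms(1)]])
qed

lemma graph_second_derivative:
  assumes w: "w \<bullet> x = 0"
  shows "((\<lambda>y. ((1 / norm y) *\<^sub>R (w - (w \<bullet> sgn y) *\<^sub>R sgn y), V1 (F (sgn y)) * ((\<gamma> (sgn y) \<bullet> w) / norm y)))
    has_derivative (\<lambda>v. (- (v \<bullet> x) *\<^sub>R w - (w \<bullet> (v - (v \<bullet> x) *\<^sub>R x)) *\<^sub>R x,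
      V1 (F x) * (\<gamma>' x (v - (v \<bullet> x) *\<^sub>R x) \<bullet> w - (\<gamma> x \<bullet> w) * (x \<bullet> v)) +
      V2 (F x) * (\<gamma> x \<bullet> v) * (\<gamma> x \<bullet> w)))) (at x)"
proof (rule has_derivative_Pair)
  note ds = sgn_derivative_tangent[OF x(1)]
  have "((\<lambda>y. inverse (norm y)) has_derivative (\<lambda>v. - (inverse (norm x) * (v \<bullet> sgn x) * inverse (norm x)))) (at x)"
    by (rule Deriv.has_derivative_inverse[OF _ norm_has_derivative']) (use sgn_x in auto)
  then have dn: "((\<lambda>y. 1 / norm y) has_derivative (\<lambda>v. - (v \<bullet> x))) (at x)"
    using x sgn_x by (simp add: inverse_eq_divide)
  have "((\<lambda>y. w - (w \<bullet> sgn y) *\<^sub>R sgn y) has_derivative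
      (\<lambda>v. 0 - ((w \<bullet> sgn x) *\<^sub>R (v - (v \<bullet> x) *\<^sub>R x) + (w \<bullet> (v - (v \<bullet> x) *\<^sub>R x)) *\<^sub>R sgn x))) (at x)"
    by (intro has_derivative_diff has_derivative_const has_derivative_scaleR has_derivative_inner_right ds)
  from has_derivative_scaleR[OF dn this]
  show "((\<lambda>y. (1 / norm y) *\<^sub>R (w - (w \<bullet> sgn y) *\<^sub>R sgn y)) has_derivative
      (\<lambda>v. - (v \<bullet> x) *\<^sub>R w - (w \<bullet> (v - (v \<bullet> x) *\<^sub>R x)) *\<^sub>R x)) (at x)"
    using sgn_x x w by (simp add: algebra_simps)
  have "(V1 has_derivative (*) (V2 (F x))) (at (F (sgn x)))"
    using V2[OF x(2)] sgn_x by (simp add: has_field_derivative_def)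
  then have "((\<lambda>y. V1 (F (sgn y))) has_derivative (\<lambda>v. V2 (F x) * ((\<gamma> (sgn x) \<bullet> v) / norm x))) (at x)"
    by (rule has_derivative_compose[OF F_sgn_derivative[OF sgn_x(2)]])
  from has_derivative_mult[OF this F_sgn_second_derivative[OF x(1), of w]]
  show "((\<lambda>y. V1 (F (sgn y)) * ((\<gamma> (sgn y) \<bullet> w) / norm y)) has_derivative
     (\<lambda>v. V1 (F x) * (\<gamma>' x (v - (v \<bullet> x) *\<^sub>R x) \<bullet> w - (\<gamma> x \<bullet> w) * (x \<bullet> v)) +
      V2 (F x) * (\<gamma> x \<bullet> v) * (\<gamma> x \<bullet> w))) (at x)"
    using sgn_x x by simp
qed

lemma dS_graph:
  assumes "v \<bullet> x = 0"
  shows "dS M h x v = (v, slope \<bullet> v)"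
proof -
  have "dS M h x v = ((1 / norm x) *\<^sub>R (v - (v \<bullet> sgn x) *\<^sub>R sgn x), V1 (F (sgn x)) * ((\<gamma> (sgn x) \<bullet> v) / norm x))"
    by (rule dS_eqI[OF cone_neighbourhood(1,2,3) graph_derivative cone_neighbourhood(4)]) (use sgn_x x in auto)
  then show ?thesis using sgn_x x assms by (simp add: graph_slope_def)
qed

text \<open>The first component is the acceleration of great circles. It is orthogonal to the
  sphere, hence to the normal of the graph, so only \<open>hessian\<close> enters the second
  fundamental form.\<close>

lemma d2S_graph:
  assumes "v \<bullet> x = 0" "w \<bullet> x = 0"
  shows "d2S M h x v w = (- (v \<bullet> w) *\<^sub>R x, hessian v w)"
proof -
  have "d2S M h x v w = (- (v \<bullet> x) *\<^sub>R w - (w \<bullet> (v - (v \<bullet> x) *\<^sub>R x)) *\<^sub>R x,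
      V1 (F x) * (\<gamma>' x (v - (v \<bullet> x) *\<^sub>R x) \<bullet> w - (\<gamma> x \<bullet> w) * (x \<bullet> v)) +
      V2 (F x) * (\<gamma> x \<bullet> v) * (\<gamma> x \<bullet> w))"
    by (rule d2S_eqI[OF cone_neighbourhood(1,2,3) graph_derivative cone_neighbourhood(4) graph_second_derivative]) (use assms in auto)
  then show ?thesis
    using assms gamma'_hess[OF assms(2), of v] by (simp add: graph_hess_def inner_commute)
qed

lemma graph_slope_tangent: "slope \<bullet> x = 0"
  using gamma_tangent[OF x(1)] by (simp add: graph_slope_def)

text \<open>Normality of \<open>w\<close> means that
  \<open>?z = fst w + snd w *\<^sub>R slope\<close> is orthogonal to all tangent vectors; being
  tangent itself, \<open>?z\<close> is zero.\<close>

lemma normal_space_graph: "normal_space M h x = range (\<lambda>c. c *\<^sub>R (- slope, 1))"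
proof -
  have "x \<in> M" using cone_neighbourhood(2,3) sgn_x by auto
  then have hx: "fst (h x) = x" using h by simp
  have "w \<in> normal_space M h x \<longleftrightarrow> w \<in> range (\<lambda>c. c *\<^sub>R (- slope, 1))" for w
  proof
    assume w: "w \<in> normal_space M h x"
    let ?z = "fst w + snd w *\<^sub>R slope"
    have *: "fst w \<bullet> x = 0" "\<And>v. v \<bullet> x = 0 \<Longrightarrow> ?z \<bullet> v = 0"
      using w by (auto simp: normal_space_def sphere_tangent_def hx dS_graph inner_prod_def inner_add_left)
    have "?z \<bullet> x = 0" using *(1) graph_slope_tangent by (simp add: inner_add_left)
    then have "?z \<bullet> ?z = 0" by (rule *(2))
    then have "fst w = - snd w *\<^sub>R slope" by (simp add: eq_neg_iff_add_eq_0)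
    then have "w = snd w *\<^sub>R (- slope, 1)" by (simp add: prod_eq_iff)
    then show "w \<in> range (\<lambda>c. c *\<^sub>R (- slope, 1))" by blast
  next
    assume "w \<in> range (\<lambda>c. c *\<^sub>R (- slope, 1))"
    then show "w \<in> normal_space M h x"
      using graph_slope_tangent
      by (auto simp: normal_space_def sphere_tangent_def hx dS_graph inner_prod_def)
  qed
  then show ?thesis by blast
qed

lemma normal_part_graph:
  "normal_part M h x w = ((snd w - fst w \<bullet> slope) / (1 + slope \<bullet> slope)) *\<^sub>R (- slope, 1)"
  unfolding normal_part_def
  by (subst orth_proj_line[OF normal_space_graph]) (auto simp: inner_prod_def prod_eq_iff add.commute)

lemma second_fundamental_form_graph:
  assumes "v \<bullet> x = 0" "w \<bullet> x = 0"
  shows "second_fundamental_form M h x v w =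
    (hessian v w / (1 + slope \<bullet> slope)) *\<^sub>R (- slope, 1)"
  unfolding second_fundamental_form_def d2S_graph[OF assms] normal_part_graph
  using graph_slope_tangent by (simp add: inner_commute)

text \<open>The second fundamental form is a multiple of the fixed normal
  \<open>(- slope, 1)\<close>, so only the trace of \<open>hessian\<close> in the induced metric is
  needed; \<open>graph_trace\<close> reduces it to the trace over the basis of \<open>laplS\<close>
  and the value on \<open>slope\<close>.\<close>

lemma mean_curvature_vector_graph:
  "mean_curvature_vector M h x =
    ((V2 (F x) * (\<gamma> x \<bullet> \<gamma> x) + V1 (F x) * laplS r x
      - hessian slope slope / (1 + slope \<bullet> slope)) / (1 + slope \<bullet> slope))
    *\<^sub>R (- slope, 1)"
proof -
  define T where "T = sphere_tangent x"
  define p where "p = slope"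
  define G where "G v w = v \<bullet> w + (p \<bullet> v) * (p \<bullet> w)" for v w
  obtain E where E: "span E = T" "\<And>a b. a \<in> E \<Longrightarrow> b \<in> E \<Longrightarrow> a \<bullet> b = (if a = b then 1 else 0)"
    "laplS r x = (\<Sum>e\<in>E. hess x e e)"
    using laplS_r[OF x(1)] unfolding T_def by metis
  have T: "subspace T" "p \<in> T" "\<gamma> x \<in> T" "\<And>v. v \<in> T \<longleftrightarrow> v \<bullet> x = 0"
    using sphere_tangent_subspace graph_slope_tangent gamma_tangent[OF x(1)]
    by (auto simp: T_def p_def sphere_tangent_def)
  \<comment> \<open>The very choice made inside \<open>trace_wrt\<close>;
    \<open>exists_graph_orthonormal\<close> guarantees that it satisfies its specification.\<close>
  define B where "B = (SOME B. span B = T \<and> (\<forall>a\<in>B. \<forall>b\<in>B. dS M h x a \<bullet> dS M h x b = (if a = b then 1 else 0)))"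
  have eqG: "dS M h x a \<bullet> dS M h x b = G a b" if "a \<in> T" "b \<in> T" for a b
    using that by (simp add: T(4) dS_graph G_def p_def inner_prod_def)
  obtain B0 where B0: "span B0 = T" "\<forall>a\<in>B0. \<forall>b\<in>B0. G a b = (if a = b then 1 else 0)"
    using exists_graph_orthonormal[OF T(1,2), of G E] G_def E by blast
  have sub: "C \<subseteq> T" if "span C = T" for C using that span_superset by blast
  have "span B = T \<and> (\<forall>a\<in>B. \<forall>b\<in>B. dS M h x a \<bullet> dS M h x b = (if a = b then 1 else 0))"
    unfolding B_def
    by (rule someI[of _ B0]) (use B0 eqG sub[OF B0(1)] in \<open>auto simp: subset_iff\<close>)
  then have B: "span B = T" "\<And>a b. a \<in> B \<Longrightarrow> b \<in> B \<Longrightarrow> G a b = (if a = b then 1 else 0)"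
    using eqG sub[of B] by (auto simp: subset_iff)
  have bil: "bilinear hessian"
    unfolding bilinear_def graph_hess_def
    by (auto intro!: linearI simp: bilinear_ladd[OF hess_bilinear] bilinear_radd[OF hess_bilinear]
        bilinear_lmul[OF hess_bilinear] bilinear_rmul[OF hess_bilinear] inner_add_right algebra_simps)
  have exp: "(\<Sum>e\<in>E. (\<gamma> x \<bullet> e) *\<^sub>R e) = \<gamma> x"
    using orthonormal_expansion(2)[of "(\<bullet>)" E "\<gamma> x", symmetric] bilinear_inner E T(3) by blast
  have "(\<Sum>e\<in>E. (\<gamma> x \<bullet> e) * (\<gamma> x \<bullet> e)) = \<gamma> x \<bullet> (\<Sum>e\<in>E. (\<gamma> x \<bullet> e) *\<^sub>R e)"
    by (simp add: inner_sum_right)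
  also have "\<dots> = \<gamma> x \<bullet> \<gamma> x" unfolding exp ..
  finally have "(\<Sum>e\<in>E. hessian e e) = V2 (F x) * (\<gamma> x \<bullet> \<gamma> x) + V1 (F x) * laplS r x"
    unfolding graph_hess_def E(3) sum.distrib sum_distrib_left[symmetric] mult.assoc by simp
  moreover have "(\<Sum>b\<in>B. hessian b b) = (\<Sum>e\<in>E. hessian e e) - hessian p p / (1 + p \<bullet> p)"
    by (rule graph_trace[OF T(1,2) _ E(1,2) bil B]) (simp_all add: G_def)
  moreover have "mean_curvature_vector M h x = (\<Sum>b\<in>B. (hessian b b / (1 + p \<bullet> p)) *\<^sub>R (- p, 1))"
    unfolding mean_curvature_vector_def trace_wrt_def T_def[symmetric] B_def[symmetric] p_def
    using sub[OF B(1)] T(4) by (intro sum.cong second_fundamental_form_graph) auto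
  moreover have "\<dots> = ((\<Sum>b\<in>B. hessian b b) / (1 + p \<bullet> p)) *\<^sub>R (- p, 1)"
    unfolding sum_divide_distrib scaleR_sum_left ..
  ultimately show ?thesis unfolding p_def by (simp only:)
qed

end

text \<open>At time 0 the shift is the identity and the shifted flow has velocity
  \<open>d - (0, 1)\<close>. So \<open>d\<close> and \<open>(0, 1)\<close> have the same normal
  part, and the mean curvature vector is the normal part of \<open>(0, 1)\<close>; comparing
  coefficients along \<open>(- p, 1)\<close> gives one scalar equation,
  \<open>m = 1\<close>.\<close>

lemma translating_soliton_equation:
  assumes V1: "\<And>s. s \<in> interior J \<Longrightarrow> (V has_real_derivative V1 s) (at s)"
    and V2: "\<And>s. s \<in> interior J \<Longrightarrow> (V1 has_real_derivative V2 s) (at s)"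
    and M: "M = {x \<in> sphere 0 1. r x \<in> J}" and x: "norm x = 1" "F x \<in> interior J"
    and flow: "mean_curvature_flow_from_graph M (V \<circ> r) I f" and soliton: "is_translating_soliton M I f"
  defines "\<alpha> \<equiv> (real k)\<^sup>2 * (1 - (F x)\<^sup>2)"
  shows "\<alpha> * V2 (F x) = (1 - laplS r x * V1 (F x)) * (1 + \<alpha> * (V1 (F x))\<^sup>2) - (real k)\<^sup>2 * F x * \<alpha> * (V1 (F x)) ^ 3"
proof -
  have h: "f 0 y = (y, V (r y))" if "y \<in> M" for y
    using flow that by (auto simp: mean_curvature_flow_from_graph_def)
  note ctx = V1 V2 M h x
  define p where "p = graph_slope V1 x"
  define q where "q = 1 + p \<bullet> p"
  have q: "q > 0" by (simp add: q_def add_pos_nonneg)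
  define m where "m = V2 (F x) * (\<gamma> x \<bullet> \<gamma> x) + V1 (F x) * laplS r x - graph_hess V1 V2 x p p / q"
  have np: "normal_part M (f 0) x w = ((snd w - fst w \<bullet> p) / q) *\<^sub>R (- p, 1)" for w
    unfolding p_def q_def by (rule normal_part_graph[OF ctx])
  have mc: "mean_curvature_vector M (f 0) x = (m / q) *\<^sub>R (- p, 1)"
    unfolding p_def q_def m_def by (rule mean_curvature_vector_graph[OF ctx])
  have xM: "x \<in> M" using x rF[of x] interior_subset[of J] by (auto simp: M)
  have I: "open I" "0 \<in> I" using flow by (auto simp: mean_curvature_flow_from_graph_def)
  have smooth: "smooth_map_on (I \<times> M) (\<lambda>(t, x). f t x)"
    and mcf: "normal_part M (f 0) x (vector_derivative (\<lambda>s. f s x) (at 0)) = mean_curvature_vector M (f 0) x"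
    using flow I xM by (auto simp: mean_curvature_flow_from_graph_def)
  \<comment> \<open>The flow is known only on \<open>I \<times> M\<close>; a local smooth extension
    makes \<open>s \<mapsto> f s x\<close> differentiable at 0, without which
    \<open>vector_derivative\<close> would carry no information.\<close>
  obtain U e where U: "open U" "(0, x) \<in> U" "\<And>j. Ck_open j e U"
    "\<And>q. q \<in> (I \<times> M) \<inter> U \<Longrightarrow> e q = (case q of (t, x) \<Rightarrow> f t x)"
  proof -
    have "(0, x) \<in> I \<times> M" using I xM by simp
    from bspec[OF smooth[unfolded smooth_map_on_def] this] show ?thesis using that by blast
  qed
  have "e differentiable (at (0, x))" using U(3)[of "Suc 0"] U(2) by auto
  then obtain e' where "(e has_derivative e') (at (0, x))" by (auto simp: differentiable_def)
  then have "((\<lambda>s. e (s, x)) has_derivative (\<lambda>s. e' (s, 0))) (at 0)"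
    by (rule has_derivative_compose[rotated]) (auto intro!: derivative_eq_intros)
  moreover have "open (I \<inter> (\<lambda>s. (s, x)) -` U)"
    using I U(1) by (intro open_Int open_vimage) (auto intro!: continuous_intros)
  ultimately have "((\<lambda>s. f s x) has_derivative (\<lambda>s. e' (s, 0))) (at 0)"
    by (rule has_derivative_transform_within_open) (use I U xM in auto)
  then have "(\<lambda>s. f s x) differentiable (at 0)" by (auto simp: differentiable_def)
  then have df: "((\<lambda>s. f s x) has_vector_derivative vector_derivative (\<lambda>s. f s x) (at 0)) (at 0)"
    by (simp add: vector_derivative_works)
  define d where "d = vector_derivative (\<lambda>s. f s x) (at 0)"
  have inv: "inv (vertical_shift t) = (\<lambda>(y :: 'a, s). (y, s - t))" for t
    by (rule inv_equality) (auto simp: vertical_shift_def)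
  have "((\<lambda>s. f s x - (0, s)) has_vector_derivative d - (0, 1)) (at 0)"
    using df unfolding d_def[symmetric]
    by (intro has_vector_derivative_diff)
      (auto simp: has_vector_derivative_def intro!: derivative_eq_intros)
  moreover have "(inv (vertical_shift s) \<circ> f s) x = f s x - (0, s)" for s
    by (simp add: inv case_prod_unfold prod_eq_iff)
  ultimately have "vector_derivative (\<lambda>s. (inv (vertical_shift s) \<circ> f s) x) (at 0) = d - (0, 1)"
    by (simp only: vector_derivative_at)
  moreover have "inv (vertical_shift 0) \<circ> f 0 = f 0" by (auto simp: inv)
  note calculation = calculation this
  have "normal_part M (f 0) x (d - (0, 1)) = 0"
  proof -
    have "\<forall>t\<in>I. \<forall>x\<in>M. normal_part M (inv (vertical_shift t) \<circ> f t) x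
        (vector_derivative (\<lambda>s. (inv (vertical_shift s) \<circ> f s) x) (at t)) = 0"
      using soliton unfolding is_translating_soliton_def Let_def .
    from bspec[OF bspec[OF this I(2)] xM] show ?thesis by (simp only: calculation)
  qed
  then have "(snd (d - (0, 1)) - fst (d - (0, 1)) \<bullet> p) / q = 0"
    unfolding np by (simp add: prod_eq_iff)
  then have "snd (d - (0, 1)) - fst (d - (0, 1)) \<bullet> p = 0" using q by simp
  moreover have "(snd d - fst d \<bullet> p) / q = m / q"
    using mcf unfolding np mc d_def[symmetric] by (simp add: prod_eq_iff)
  ultimately have m1: "m = 1" using q by auto
  have \<alpha>: "\<gamma> x \<bullet> \<gamma> x = \<alpha>" using gamma_norm[OF x(1)] by (simp add: \<alpha>_def)
  have "hess x p p = (V1 (F x))\<^sup>2 * hess x (\<gamma> x) (\<gamma> x)"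
    unfolding p_def graph_slope_def
    by (simp add: bilinear_lmul[OF hess_bilinear] bilinear_rmul[OF hess_bilinear] power2_eq_square)
  also have "\<dots> = - (V1 (F x))\<^sup>2 * ((real k)\<^sup>2 * F x * \<alpha>)"
    using hess_gamma_gamma[OF x(1)] \<alpha> by simp
  \<comment> \<open>Here the identity for \<open>hess\<close> on \<open>\<gamma> x\<close> enters,
    which came from differentiating the norm of the gradient.\<close>
  finally have hpp: "graph_hess V1 V2 x p p = V2 (F x) * (V1 (F x) * \<alpha>)\<^sup>2 - (V1 (F x)) ^ 3 * ((real k)\<^sup>2 * F x * \<alpha>)"
    unfolding graph_hess_def by (simp add: p_def graph_slope_def \<alpha> power2_eq_square power3_eq_cube)
  have q_eq: "q = 1 + \<alpha> * (V1 (F x))\<^sup>2"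
    by (simp add: q_def p_def graph_slope_def \<alpha> power2_eq_square)
  have "m * q = (V2 (F x) * \<alpha> + V1 (F x) * laplS r x) * q - graph_hess V1 V2 x p p"
    unfolding m_def \<alpha> left_diff_distrib using q by simp
  also have "\<dots> = V2 (F x) * \<alpha> + V1 (F x) * laplS r x * q + (V1 (F x)) ^ 3 * ((real k)\<^sup>2 * F x * \<alpha>)"
    unfolding hpp distrib_right by (simp add: q_eq algebra_simps power2_eq_square)
  finally have "\<alpha> * V2 (F x) = (1 - laplS r x * V1 (F x)) * q - (real k)\<^sup>2 * F x * \<alpha> * (V1 (F x)) ^ 3"
    unfolding m1 by (simp add: algebra_simps)
  then show ?thesis unfolding q_eq .
qed

end

section \<open>Multiplicities of the principal curvatures\<close>


text \<open>Take a maximum \<open>v\<close> of the quadratic form on the unit sphere of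
  \<open>S\<close>. Comparing \<open>v\<close> with \<open>v + t *\<^sub>R w\<close> bounds a term
  linear in \<open>t\<close> by a quadratic one, so its coefficient \<open>c\<close>
  vanishes.\<close>

lemma bilinear_eigenvector:
  fixes b :: "'a::euclidean_space \<Rightarrow> 'a \<Rightarrow> real"
  assumes S: "subspace S" "S \<noteq> {0}" and b: "bilinear b" "\<And>v w. b v w = b w v"
  obtains v \<kappa> where "v \<in> S" "v \<noteq> 0" "\<And>w. w \<in> S \<Longrightarrow> b v w = \<kappa> * (v \<bullet> w)"
proof -
  obtain s where s: "s \<in> S" "s \<noteq> 0" using S subspace_0[OF S(1)] by blast
  define K where "K = S \<inter> sphere 0 1"
  have "compact K" unfolding K_def
    using closed_subspace[OF S(1)] by (simp add: closed_Int_compact)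
  moreover have "(1 / norm s) *\<^sub>R s \<in> K"
    using s S(1) by (auto simp: K_def intro: subspace_scale)
  then have "K \<noteq> {}" by blast
  moreover have "continuous_on K (\<lambda>v. b v v)"
  proof -
    have "bounded_bilinear b" using b(1) by (simp add: bilinear_conv_bounded_bilinear)
    from bounded_bilinear.continuous_on[OF this continuous_on_id continuous_on_id] show ?thesis .
  qed
  ultimately obtain v where v: "v \<in> K" "\<And>w. w \<in> K \<Longrightarrow> b w w \<le> b v v"
    using continuous_attains_sup[of K "\<lambda>v. b v v"] by blast
  define \<kappa> where "\<kappa> = b v v"
  have vv: "v \<bullet> v = 1" "v \<in> S" using v(1) by (auto simp: K_def norm_eq_1)
  have le: "b w w \<le> \<kappa> * (w \<bullet> w)" if w: "w \<in> S" for w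
  proof (cases "w = 0")
    case True
    then show ?thesis using bilinear_lzero[OF b(1)] by simp
  next
    case False
    then have "(1 / norm w) *\<^sub>R w \<in> K" using w S(1) by (auto simp: K_def intro: subspace_scale)
    then have "b w w / (norm w)\<^sup>2 \<le> \<kappa>"
      using v(2)[of "(1 / norm w) *\<^sub>R w"]
      by (simp add: bilinear_lmul[OF b(1)] bilinear_rmul[OF b(1)] \<kappa>_def power2_eq_square)
    then show ?thesis using False by (simp add: divide_le_eq power2_norm_eq_inner)
  qed
  have "b v w = \<kappa> * (v \<bullet> w)" if w: "w \<in> S" for w
  proof -
    define c where "c = b v w - \<kappa> * (v \<bullet> w)"
    define e where "e = \<kappa> * (w \<bullet> w) - b w w"
    have ineq: "2 * t * c \<le> t\<^sup>2 * e" for t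
    proof -
      have "v + t *\<^sub>R w \<in> S" using vv(2) w S(1) by (intro subspace_add subspace_scale)
      note le_vw = le[OF this]
      have bvw: "b (v + t *\<^sub>R w) (v + t *\<^sub>R w) = \<kappa> + 2 * t * b v w + t\<^sup>2 * b w w"
        by (simp add: bilinear_ladd[OF b(1)] bilinear_radd[OF b(1)] bilinear_lmul[OF b(1)]
            bilinear_rmul[OF b(1)] b(2)[of w v] \<kappa>_def power2_eq_square distrib_left)
      have ivw: "(v + t *\<^sub>R w) \<bullet> (v + t *\<^sub>R w) = 1 + 2 * t * (v \<bullet> w) + t\<^sup>2 * (w \<bullet> w)"
        by (simp add: inner_add_left inner_add_right vv(1) inner_commute[of w v] power2_eq_square distrib_left)
      show ?thesis using le_vw unfolding bvw ivw by (simp add: c_def e_def algebra_simps)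
    qed
    have e0: "e \<ge> 0" using le[OF w] by (simp add: e_def)
    \<comment> \<open>This \<open>t\<close> turns \<open>ineq\<close> into
      \<open>2 * t\<^sup>2 * (1 + e) \<le> t\<^sup>2 * e\<close>, which forces \<open>t = 0\<close>;
      the denominator is positive even if \<open>e = 0\<close>.\<close>
    define t where "t = c / (1 + e)"
    have c: "c = t * (1 + e)" using e0 by (simp add: t_def)
    have "t\<^sup>2 * (2 + e) \<le> 0" using ineq[of t] unfolding c by (simp add: algebra_simps power2_eq_square)
    then have "t = 0" using e0 by (auto simp: mult_le_0_iff)
    then show ?thesis using c by (simp add: c_def)
  qed
  moreover have "v \<noteq> 0" using vv by auto
  ultimately show ?thesis using that vv(2) by blast
qed

text \<open>Each member is orthogonal to the span of the others and so meets it only in 0;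
  dimensions of direct sums add.\<close>

lemma orthogonal_family_dim:
  fixes E :: "'i \<Rightarrow> 'a::euclidean_space set"
  assumes "finite A" "\<And>i. i \<in> A \<Longrightarrow> subspace (E i)"
    and "\<And>i j v w. i \<in> A \<Longrightarrow> j \<in> A \<Longrightarrow> i \<noteq> j \<Longrightarrow> v \<in> E i \<Longrightarrow> w \<in> E j \<Longrightarrow> v \<bullet> w = 0"
  shows "dim (span (\<Union>i\<in>A. E i)) = (\<Sum>i\<in>A. dim (E i))"
  using assms
proof (induction A rule: finite_induct)
  case empty
  then show ?case by simp
next
  case (insert a A)
  let ?U = "span (\<Union>i\<in>A. E i)"
  have orth: "v \<bullet> w = 0" if v: "v \<in> E a" and w: "w \<in> ?U" for v w
    using w
  proof (induction rule: span_induct_alt)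
    case (step c x y)
    then obtain i where "i \<in> A" "x \<in> E i" by blast
    then have "v \<bullet> x = 0" using insert.prems(2)[of a i v x] insert.hyps v by auto
    then show ?case using step by (simp add: inner_add_right)
  qed simp
  have sub: "subspace (E a)" "subspace ?U" using insert.prems(1) by auto
  have "v = 0" if "v \<in> E a" "v \<in> ?U" for v using orth[OF that] by simp
  then have int: "E a \<inter> ?U = {0}" using subspace_0[OF sub(1)] subspace_0[OF sub(2)] by blast
  have "span (\<Union>i\<in>insert a A. E i) = {x + y |x y. x \<in> E a \<and> y \<in> ?U}"
    using span_Un[of "E a" "\<Union>i\<in>A. E i"] span_eq_iff[THEN iffD2, OF sub(1)] by auto
  then have "dim (span (\<Union>i\<in>insert a A. E i)) + dim (E a \<inter> ?U) = dim (E a) + dim ?U"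
    using dim_sums_Int[OF sub] by simp
  moreover have "dim ?U = (\<Sum>i\<in>A. dim (E i))"
    by (rule insert.IH) (use insert.prems in blast)+
  ultimately show ?case using insert.hyps int by simp
qed

section \<open>The shape operator and its eigenspaces\<close>

context sphere_polynomial
begin

text \<open>The unit normal has constant length, so its derivative has no component along the
  normal, and the projection removes the radial one. What remains pairs with level vectors through
  \<open>hess\<close>, which makes the shape operator symmetric.\<close>

lemma shape_op_r:
  assumes x: "norm x = 1" and gx: "\<gamma> x \<noteq> 0" and v: "v \<in> level_tangent r x"
  shows "shape_op r x v \<in> level_tangent r x"
    "\<And>w. w \<in> level_tangent r x \<Longrightarrow> shape_op r x v \<bullet> w = - hess x v w / norm (\<gamma> x)"
proof -
  have sx: "sgn x = x" "x \<noteq> 0" using x by (auto simp: sgn_div_norm)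
  have xx: "x \<bullet> x = 1" using x by (simp add: norm_eq_1)
  have vx: "v \<bullet> x = 0" "v \<bullet> \<gamma> x = 0" using v gradS_r[OF x] by (auto simp: level_tangent_def sphere_tangent_def)
  let ?d = "(1 / norm (\<gamma> x)) *\<^sub>R (\<gamma>' x v - (\<gamma>' x v \<bullet> sgn (\<gamma> x)) *\<^sub>R sgn (\<gamma> x))"
  have dg: "((\<lambda>y. \<gamma> (sgn y)) has_derivative (\<lambda>v. \<gamma>' (sgn x) (v - (v \<bullet> x) *\<^sub>R x))) (at x)"
    by (rule has_derivative_compose[OF sgn_derivative_tangent[OF x] gamma_derivative])
  have "\<gamma> (sgn x) \<noteq> 0" using gx sx by simp
  from has_derivative_compose[OF dg sgn_has_derivative[OF this]]
  have "((\<lambda>y. sgn (\<gamma> (sgn y))) has_derivative (\<lambda>v. (1 / norm (\<gamma> (sgn x))) *\<^sub>R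
      (\<gamma>' (sgn x) (v - (v \<bullet> x) *\<^sub>R x) - (\<gamma>' (sgn x) (v - (v \<bullet> x) *\<^sub>R x) \<bullet> sgn (\<gamma> (sgn x))) *\<^sub>R sgn (\<gamma> (sgn x))))) (at x)"
    .
  note * = dS_eqI[of "- {0}" "sphere 0 1" x, OF _ _ _ this, of "\<lambda>y. sgn (gradS r y)" v]
  have "dS (sphere 0 1) (\<lambda>y. sgn (gradS r y)) x v = (1 / norm (\<gamma> (sgn x))) *\<^sub>R
      (\<gamma>' (sgn x) (v - (v \<bullet> x) *\<^sub>R x) - (\<gamma>' (sgn x) (v - (v \<bullet> x) *\<^sub>R x) \<bullet> sgn (\<gamma> (sgn x))) *\<^sub>R sgn (\<gamma> (sgn x)))"
  proof -
    have "open (- {0 :: 'a})" "- {0} \<subseteq> sgn -` sphere (0 :: 'a) 1" by (auto simp: norm_sgn)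
    with * show ?thesis using sx gradS_r by (simp add: norm_sgn)
  qed
  then have d: "dS (sphere 0 1) (\<lambda>y. sgn (gradS r y)) x v = ?d" using sx vx by simp
  have sh: "shape_op r x v = - (?d - (?d \<bullet> x) *\<^sub>R x)"
    unfolding shape_op_def d orth_proj_tangent[OF x] ..
  have "?d \<bullet> sgn (\<gamma> x) = 0"
    using gx norm_sgn[of "\<gamma> x"] by (simp add: inner_diff_left norm_eq_1)
  moreover have "\<gamma> x = norm (\<gamma> x) *\<^sub>R sgn (\<gamma> x)" using gx by (simp add: sgn_div_norm)
  moreover have "?d \<bullet> (norm (\<gamma> x) *\<^sub>R sgn (\<gamma> x)) = norm (\<gamma> x) * (?d \<bullet> sgn (\<gamma> x))"
    by (rule inner_scaleR_right)
  ultimately have "?d \<bullet> \<gamma> x = 0" by (simp only: mult_zero_right)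
  then show "shape_op r x v \<in> level_tangent r x"
    unfolding sh level_tangent_def sphere_tangent_def gradS_r[OF x]
    using gamma_tangent[OF x] xx by (simp add: inner_diff_left inner_commute[of x "\<gamma> x"])
  fix w assume "w \<in> level_tangent r x"
  then have w: "w \<bullet> x = 0" "w \<bullet> \<gamma> x = 0"
    using gradS_r[OF x] by (auto simp: level_tangent_def sphere_tangent_def)
  then have "sgn (\<gamma> x) \<bullet> w = 0" "x \<bullet> w = 0" by (auto simp: sgn_div_norm inner_commute)
  then show "shape_op r x v \<bullet> w = - hess x v w / norm (\<gamma> x)"
    unfolding sh using gamma'_hess[OF w(1), of v] by (simp add: inner_diff_left)
qed

text \<open>The principal spaces are the eigenspaces of the symmetric form \<open>b\<close> on
  \<open>L\<close>, hence mutually orthogonal. If their span \<open>U\<close> were smaller than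
  \<open>L\<close>, then \<open>b\<close> would have an eigenvector in the orthogonal complement
  \<open>S\<close> of \<open>U\<close> in \<open>L\<close>; its eigenvalue would be a principal
  curvature, so the vector would lie in \<open>U\<close> after all. \<open>L\<close> is orthogonal
  to \<open>x\<close> and \<open>\<gamma> x\<close>, which gives the 2.\<close>

lemma multiplicities_sum:
  fixes \<kappa> :: "nat \<Rightarrow> real"
  assumes x: "norm x = 1" and gx: "\<gamma> x \<noteq> 0"
    and inj: "inj_on \<kappa> A" and A: "finite A" "principal_curvatures r x = \<kappa> ` A"
  shows "(\<Sum>i\<in>A. dim (principal_space r x (\<kappa> i))) = DIM('a) - 2"
proof -
  define L where "L = level_tangent r x"
  define b where "b v w = - hess x v w / norm (\<gamma> x)" for v w
  have b: "bilinear b" "\<And>v w. b v w = b w v"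
    using hess_sym[of x] unfolding b_def
    by (auto simp: bilinear_def bilinear_ladd[OF hess_bilinear] bilinear_radd[OF hess_bilinear]
        bilinear_lmul[OF hess_bilinear] bilinear_rmul[OF hess_bilinear] add_divide_distrib intro!: linearI)
  have L_eq: "L = {v. \<forall>w\<in>{x, \<gamma> x}. v \<bullet> w = 0}"
    using gradS_r[OF x] by (auto simp: L_def level_tangent_def sphere_tangent_def)
  have L: "subspace L" unfolding L_eq by (auto simp: subspace_def inner_add_left)
  have E_eq: "principal_space r x c = {v \<in> L. \<forall>w\<in>L. b v w = c * (v \<bullet> w)}" for c
  proof -
    have "shape_op r x v = c *\<^sub>R v \<longleftrightarrow> (\<forall>w\<in>L. b v w = c * (v \<bullet> w))" if v: "v \<in> L" for v
    proof
      assume "shape_op r x v = c *\<^sub>R v"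
      then show "\<forall>w\<in>L. b v w = c * (v \<bullet> w)"
        using shape_op_r(2)[OF x gx, of v] v by (auto simp: L_def b_def)
    next
      assume *: "\<forall>w\<in>L. b v w = c * (v \<bullet> w)"
      let ?z = "shape_op r x v - c *\<^sub>R v"
      have "?z \<in> L" using shape_op_r(1)[OF x gx] v L by (auto simp: L_def intro: subspace_diff subspace_scale)
      then have "?z \<bullet> ?z = 0"
        using * shape_op_r(2)[OF x gx, of v ?z] v by (auto simp: L_def b_def inner_diff_left)
      then show "shape_op r x v = c *\<^sub>R v" by simp
    qed
    then show ?thesis by (auto simp: principal_space_def L_def)
  qed
  have subE: "subspace (principal_space r x c)" for c
    unfolding E_eq using L bilinear_lzero[OF b(1)]
    by (auto simp: subspace_def bilinear_ladd[OF b(1)] bilinear_lmul[OF b(1)] inner_add_left algebra_simps)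
  have orth: "v \<bullet> w = 0" if "c \<noteq> d" "v \<in> principal_space r x c" "w \<in> principal_space r x d" for c d v w
  proof -
    have "b v w = c * (v \<bullet> w)" "b w v = d * (w \<bullet> v)" using that by (auto simp: E_eq)
    then have "c * (v \<bullet> w) = d * (v \<bullet> w)" using b(2)[of v w] by (auto simp: inner_commute)
    then show ?thesis using that(1) by simp
  qed
  define U where "U = span (\<Union>i\<in>A. principal_space r x (\<kappa> i))"
  have dimU: "dim U = (\<Sum>i\<in>A. dim (principal_space r x (\<kappa> i)))"
    unfolding U_def
  proof (rule orthogonal_family_dim[OF A(1) subE])
    fix i j v w
    assume "i \<in> A" "j \<in> A" "i \<noteq> j" and vw: "v \<in> principal_space r x (\<kappa> i)" "w \<in> principal_space r x (\<kappa> j)"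
    then have "\<kappa> i \<noteq> \<kappa> j" using inj by (meson inj_onD)
    then show "v \<bullet> w = 0" using vw by (rule orth)
  qed
  have UL: "U \<subseteq> L" unfolding U_def using L by (intro span_minimal) (auto simp: E_eq)
  have "U = L"
  proof (rule ccontr)
    assume "U \<noteq> L"
    define S where "S = {v \<in> L. \<forall>u\<in>U. v \<bullet> u = 0}"
    have S: "subspace S" using L by (auto simp: S_def subspace_def inner_add_left)
    have decomp: "\<exists>y\<in>U. \<exists>z\<in>S. w = y + z" if w: "w \<in> L" for w
    proof -
      obtain y z where yz: "y \<in> span U" "\<And>w. w \<in> span U \<Longrightarrow> orthogonal z w" "w = y + z"
        using orthogonal_subspace_decomp_exists[of U w] by metis
      have spU: "span U = U" unfolding U_def by (rule span_span)
      note yz' = yz(1)[unfolded spU] yz(2)[unfolded spU]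
      have "w - y \<in> L" using w yz'(1) UL by (intro subspace_diff[OF L]) auto
      then have "z \<in> S" using yz(3) yz'(2) by (simp add: S_def orthogonal_def)
      then show ?thesis using yz'(1) yz(3) by blast
    qed
    have "S \<noteq> {0}"
    proof -
      obtain l where l: "l \<in> L" "l \<notin> U" using UL \<open>U \<noteq> L\<close> by blast
      then show ?thesis using decomp[of l] by fastforce
    qed
    then obtain v c where v: "v \<in> S" "v \<noteq> 0" "\<And>w. w \<in> S \<Longrightarrow> b v w = c * (v \<bullet> w)"
      using bilinear_eigenvector[OF S _ b] by blast
    \<comment> \<open>\<open>b\<close> has no mixed terms between \<open>S\<close> and
      \<open>U\<close>, so an eigenvector relative to \<open>S\<close> is one relative to all of
      \<open>L\<close>.\<close>
    have bU: "b v u = 0" if "u \<in> U" for u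
      using that unfolding U_def
    proof (induction rule: span_induct_alt)
      case (step t y z)
      then obtain i where i: "i \<in> A" "y \<in> principal_space r x (\<kappa> i)" by blast
      then have "y \<in> U" unfolding U_def by (intro span_base) blast
      then have "b y v = 0" using i v(1) by (auto simp: E_eq S_def inner_commute)
      then show ?case using step b(2)[of v y] by (simp add: bilinear_radd[OF b(1)] bilinear_rmul[OF b(1)])
    qed (simp add: bilinear_rzero[OF b(1)])
    have "b v w = c * (v \<bullet> w)" if w: "w \<in> L" for w
    proof -
      obtain y z where y: "y \<in> U" and z: "z \<in> S" and yz: "w = y + z" using decomp[OF w] by blast
      then show ?thesis
        using bU[OF y] v(1) v(3)[OF z] by (auto simp: yz S_def bilinear_radd[OF b(1)] inner_add_right)
    qed
    then have "v \<in> principal_space r x c" using v(1) by (auto simp: E_eq S_def)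
    moreover from this have "c \<in> \<kappa> ` A" using v(2) A(2) by (auto simp: principal_curvatures_def)
    ultimately have "v \<in> U" unfolding U_def by (auto intro: span_base)
    then show False using v(1,2) by (auto simp: S_def)
  qed
  moreover have "dim L = DIM('a) - 2"
  proof -
    have "L = {y. \<forall>w\<in>span {x, \<gamma> x}. orthogonal w y}"
    proof (intro set_eqI iffI)
      fix y assume y: "y \<in> L"
      have "orthogonal y w" if "w \<in> span {x, \<gamma> x}" for w
        by (rule orthogonal_to_span[OF that]) (use y in \<open>auto simp: L_eq orthogonal_def\<close>)
      then show "y \<in> {y. \<forall>w\<in>span {x, \<gamma> x}. orthogonal w y}" by (simp add: orthogonal_commute)
    next
      fix y assume "y \<in> {y. \<forall>w\<in>span {x, \<gamma> x}. orthogonal w y}"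
      then show "y \<in> L" using span_base[of _ "{x, \<gamma> x}"] by (auto simp: L_eq orthogonal_def inner_commute)
    qed
    then have "dim L + dim (span {x, \<gamma> x}) = DIM('a)"
      using dim_subspace_orthogonal_to_vectors[of "span {x, \<gamma> x}" UNIV] by (simp add: subspace_UNIV)
    moreover have "dim {x, \<gamma> x} = 2"
    proof -
      have "pairwise orthogonal {x, \<gamma> x}" "0 \<notin> {x, \<gamma> x}"
        using gamma_tangent[OF x] gx x by (auto simp: pairwise_def orthogonal_def inner_commute)
      then have "independent {x, \<gamma> x}" by (rule pairwise_orthogonal_independent)
      moreover have "x \<noteq> \<gamma> x" using gamma_tangent[OF x] gx by (metis inner_eq_zero_iff)
      ultimately show ?thesis using dim_eq_card_independent[of "{x, \<gamma> x}"] by simp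
    qed
    ultimately show ?thesis by simp
  qed
  ultimately show ?thesis using dimU by simp
qed

end

section \<open>Classification\<close>


lemma muenzner_normalizedD:
  assumes "muenzner_normalized n k mu r"
  shows "\<exists>F. real_polynomial_function F \<and> (\<forall>c x. F (c *\<^sub>R x) = c ^ k * F x) \<and> (\<forall>x\<in>sphere 0 1. r x = F x)"
    "k \<in> {1, 2, 3, 4, 6}"
    "\<forall>c. regular_value r c \<longrightarrow>
        (\<exists>\<kappa> :: nat \<Rightarrow> real. (\<forall>i\<in>{1..k}. \<forall>j\<in>{1..k}. i < j \<longrightarrow> \<kappa> j < \<kappa> i) \<and>
           (\<forall>x\<in>sphere 0 1. r x = c \<longrightarrow>
              principal_curvatures r x = \<kappa> ` {1..k} \<and>
              (\<forall>i\<in>{1..k}. dim (principal_space r x (\<kappa> i)) = mu i)))"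
    "k \<in> {2, 4} \<longrightarrow> (\<forall>i\<in>{1..k}. mu i = (if odd i then mu 1 else mu 2))"
    "\<forall>x\<in>sphere 0 1. (norm (gradS r x))\<^sup>2 = (real k)\<^sup>2 * (1 - (r x)\<^sup>2)"
    "\<forall>x\<in>sphere 0 1. laplS r x =
        (if k \<in> {2, 4} then real (mu 2) - real (mu 1) else 0) / 2 * (real k)\<^sup>2
          - real k * (real n + real k - 1) * r x"
  using assms unfolding muenzner_normalized_def by - (elim conjE, assumption)+

context sphere_polynomial
begin

text \<open>The norm of the gradient is non-zero on levels strictly between -1 and 1, so the level
  \<open>s\<close> is regular. Multiplicities are positive because every principal curvature has a
  non-zero eigenvector.\<close>

lemma multiplicities:
  assumes DIM: "DIM('a) = n + 1" and M: "muenzner_normalized n k mu r" and s: "s \<in> r ` sphere 0 1" "-1 < s" "s < 1"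
  shows "(\<Sum>i\<in>{1..k}. mu i) = n - 1" "\<And>i. i \<in> {1..k} \<Longrightarrow> mu i > 0"
proof -
  have k: "k > 0" using muenzner_normalizedD(2)[OF M] by auto
  obtain x where x: "norm x = 1" "r x = s" using s(1) by auto
  have gx: "\<gamma> y \<noteq> 0" if "norm y = 1" "r y = s" for y
  proof
    assume "\<gamma> y = 0"
    then have "(real k)\<^sup>2 * (1 - s\<^sup>2) = 0" using gamma_norm[OF that(1)] rF[of y] that by simp
    then show False using k s(2,3) abs_square_less_1[of s] by auto
  qed
  then have regular: "regular_value r s" unfolding regular_value_def using s(1) gradS_r by auto
  obtain \<kappa> :: "nat \<Rightarrow> real" where \<kappa>: "\<forall>i\<in>{1..k}. \<forall>j\<in>{1..k}. i < j \<longrightarrow> \<kappa> j < \<kappa> i"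
    "\<forall>x\<in>sphere 0 1. r x = s \<longrightarrow> principal_curvatures r x = \<kappa> ` {1..k} \<and>
       (\<forall>i\<in>{1..k}. dim (principal_space r x (\<kappa> i)) = mu i)"
    using muenzner_normalizedD(3)[OF M, rule_format, OF regular] by (elim exE conjE)
  have px: "principal_curvatures r x = \<kappa> ` {1..k}" "\<And>i. i \<in> {1..k} \<Longrightarrow> dim (principal_space r x (\<kappa> i)) = mu i"
    using \<kappa>(2) x by auto
  have "inj_on \<kappa> {1..k}"
  proof (rule inj_onI, rule ccontr)
    fix i j assume ij: "i \<in> {1..k}" "j \<in> {1..k}" "\<kappa> i = \<kappa> j" "i \<noteq> j"
    then consider "i < j" | "j < i" by linarith
    then show False
      using ij(3) \<kappa>(1)[rule_format, OF ij(1,2)] \<kappa>(1)[rule_format, OF ij(2,1)] by cases auto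
  qed
  from multiplicities_sum[OF x(1) gx[OF x] this _ px(1)]
  show "(\<Sum>i\<in>{1..k}. mu i) = n - 1" using px(2) DIM by simp
  show "mu i > 0" if i: "i \<in> {1..k}" for i
  proof -
    have "\<kappa> i \<in> principal_curvatures r x" using px(1) i by auto
    then obtain v where "v \<in> principal_space r x (\<kappa> i)" "v \<noteq> 0" by (auto simp: principal_curvatures_def)
    then have "dim (principal_space r x (\<kappa> i)) \<noteq> 0" using dim_eq_0 by blast
    then show ?thesis using px(2)[OF i] by simp
  qed
qed

end

lemma interval_interior:
  fixes J :: "real set"
  assumes J: "is_interval J" "J \<subseteq> {p..q}" "\<exists>x\<in>J. \<exists>y\<in>J. x < y"
  obtains l u where "p \<le> l" "l < u" "u \<le> q" "{l<..<u} \<subseteq> J" "J \<subseteq> {l..u}"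
proof -
  have ne: "J \<noteq> {}" using J(3) by blast
  have bdd: "bdd_below J" "bdd_above J"
    using bdd_below_mono[OF bdd_below_Icc J(2)] bdd_above_mono[OF bdd_above_Icc J(2)] by auto
  have "{Inf J<..<Sup J} \<subseteq> J"
  proof
    fix s assume "s \<in> {Inf J<..<Sup J}"
    then obtain a b where "a \<in> J" "a < s" "b \<in> J" "s < b"
      using cInf_less_iff[OF ne bdd(1)] less_cSup_iff[OF ne bdd(2)] by auto
    then show "s \<in> J" using mem_is_interval_1_I[OF J(1), of a b s] by simp
  qed
  moreover have sub: "J \<subseteq> {Inf J..Sup J}" using bdd by (auto intro: cInf_lower cSup_upper)
  moreover have "Inf J < Sup J"
  proof -
    obtain x y where "x \<in> J" "y \<in> J" "x < y" using J(3) by blast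
    then show ?thesis using subsetD[OF sub, of x] subsetD[OF sub, of y] by simp
  qed
  moreover have "p \<le> Inf J" by (rule cInf_greatest[OF ne]) (use J(2) in auto)
  moreover have "Sup J \<le> q" by (rule cSup_least[OF ne]) (use J(2) in auto)
  ultimately show ?thesis using that by blast
qed

text \<open>This rules out blow-up of \<open>V'\<close> at an end point that belongs to
  \<open>J\<close>.\<close>

lemma not_at_infinity_if_continuous:
  fixes w :: "real \<Rightarrow> real"
  assumes "continuous (at x within J) w" "at x within A \<noteq> bot" "A \<subseteq> J" "filterlim w at_infinity (at x within A)"
  shows False
proof -
  have "(w \<longlongrightarrow> w x) (at x within A)"
    using assms(1,3) by (auto simp: continuous_within intro: tendsto_within_subset)
  then show False using not_tendsto_and_filterlim_at_infinity assms(2,4) by blast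
qed

theorem theorem1p1:
  fixes r :: "'a::euclidean_space \<Rightarrow> real"
    and n k m :: nat and mu :: "nat \<Rightarrow> nat"
    and R :: real and V :: "real \<Rightarrow> real" and J I :: "real set"
    and M :: "'a set" and u :: "'a \<Rightarrow> real" and f :: "real \<Rightarrow> 'a \<Rightarrow> 'a \<times> real"
  assumes "DIM('a) = n + 1" and "n \<ge> 2"
    and "muenzner_normalized n k mu r"
    and "m = mu k"
    and "R = (if k \<in> {2, 4} then - 1 + real k * real m / (real n - 1) else 0)"
    and "is_interval J" and "\<exists>x\<in>J. \<exists>y\<in>J. x < y" and "J \<subseteq> r ` sphere 0 1"
    and "smooth_on_interval J V"
    and "M = {x \<in> sphere 0 1. r x \<in> J}" and "u = V \<circ> r"
    and "mean_curvature_flow_from_graph M u I f"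
    and "is_translating_soliton M I f"
  shows "-1 < R \<and> R < 1 \<and>
    (\<exists>(Jh :: real set) (Vh :: real \<Rightarrow> real) (W :: real \<Rightarrow> real) (a :: real) (b :: real).
       J \<subseteq> Jh \<and> smooth_on_interval Jh Vh \<and> (\<forall>s\<in>J. Vh s = V s) \<and>
       (\<forall>s\<in>Jh. (Vh has_real_derivative W s) (at s within Jh)) \<and>
       -1 < a \<and> a < R \<and> R < b \<and> b < 1 \<and>
       ( (Jh = {a<..<b} \<and> (\<forall>s\<in>{a<..<R}. W s < 0) \<and> W R = 0 \<and> (\<forall>s\<in>{R<..<b}. W s > 0) \<and>
            filterlim W at_bot (at_right a) \<and> filterlim W at_top (at_left b))
       \<or> (Jh = {a<..<b} \<and> (\<exists>c\<in>{a<..<R}. (\<forall>s\<in>{a<..<c}. W s < 0) \<and> W c = 0 \<and> (\<forall>s\<in>{c<..<b}. W s > 0)) \<and>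
            filterlim W at_bot (at_right a) \<and> filterlim W at_top (at_left b))
       \<or> (Jh = {a<..<b} \<and> (\<exists>c\<in>{R<..<b}. (\<forall>s\<in>{a<..<c}. W s < 0) \<and> W c = 0 \<and> (\<forall>s\<in>{c<..<b}. W s > 0)) \<and>
            filterlim W at_bot (at_right a) \<and> filterlim W at_top (at_left b))
       \<or> (Jh = {a<..<b} \<and> (\<forall>s\<in>{a<..<b}. W s > 0) \<and>
            filterlim W at_top (at_right a) \<and> filterlim W at_top (at_left b))
       \<or> (Jh = {a<..<b} \<and> (\<forall>s\<in>{a<..<b}. W s < 0) \<and>
            filterlim W at_bot (at_right a) \<and> filterlim W at_bot (at_left b))
       \<or> (Jh = {-1..<b} \<and> (\<forall>s\<in>{-1..<b}. W s > 0) \<and> filterlim W at_top (at_left b))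
       \<or> (Jh = {a<..1} \<and> (\<forall>s\<in>{a<..1}. W s < 0) \<and> filterlim W at_bot (at_right a))))"
proof -
  note DIM = assms(1) and n = assms(2) and normalized = assms(3)
  have k: "k \<in> {1, 2, 3, 4, 6}" by (rule muenzner_normalizedD(2)[OF normalized])
  then have k1: "real k \<ge> 1" by auto
  obtain F where F: "real_polynomial_function F" "\<And>c x. F (c *\<^sub>R x) = c ^ k * F x" "\<And>x. x \<in> sphere 0 1 \<Longrightarrow> r x = F x"
    using muenzner_normalizedD(1)[OF normalized] by blast
  have grad: "(norm (gradS r x))\<^sup>2 = (real k)\<^sup>2 * (1 - (r x)\<^sup>2)" if "x \<in> sphere 0 1" for x
    using muenzner_normalizedD(5)[OF normalized] that by blast
  define c where "c = (if k \<in> {2, 4} then real (mu 2) - real (mu 1) else 0)"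
  have lapl: "laplS r x = c / 2 * (real k)\<^sup>2 - real k * (real n + real k - 1) * r x" if "x \<in> sphere 0 1" for x
    unfolding c_def using muenzner_normalizedD(6)[OF normalized] that by blast
  obtain g H where gH: "\<And>x. (F has_derivative (\<lambda>v. g x \<bullet> v)) (at x)"
    "\<And>x. (g has_derivative H x) (at x)" "\<And>x v w. H x v \<bullet> w = H x w \<bullet> v"
    using real_polynomial_function_gradient_hessian[OF F(1)] by metis
  interpret sp: sphere_polynomial r F g H k
    by unfold_locales (use gH F grad in auto)
  have range: "J \<subseteq> {-1..1}"
  proof
    fix s assume "s \<in> J"
    then obtain x where x: "x \<in> sphere 0 1" "r x = s" using assms(8) by blast
    have "(real k)\<^sup>2 * (1 - s\<^sup>2) \<ge> 0" using grad[OF x(1)] x(2) zero_le_power2[of "norm (gradS r x)"] by simp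
    then have "s\<^sup>2 \<le> 1" using k1 by (simp add: zero_le_mult_iff)
    then show "s \<in> {-1..1}" using abs_square_le_1[of s] by auto
  qed
  obtain l q where lq: "-1 \<le> l" "l < q" "q \<le> 1" "{l<..<q} \<subseteq> J" "J \<subseteq> {l..q}"
    using interval_interior[OF assms(6) range assms(7)] by blast
  \<comment> \<open>A level strictly between -1 and 1: it supplies the multiplicities and later
    fixes the constant of integration of \<open>Vh\<close>.\<close>
  define s0 where "s0 = (l + q) / 2"
  have s0: "l < s0" "s0 < q" using lq by (auto simp: s0_def)
  then have s0J: "s0 \<in> J" using lq by auto
  have s01: "-1 < s0" "s0 < 1" using s0 lq by linarith+
  have s0r: "s0 \<in> r ` sphere 0 1" using s0J assms(8) by blast
  note mult = sp.multiplicities[OF DIM normalized s0r s01]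
  define N where "N = real k * (real n - 1)"
  \<comment> \<open>For \<open>k = 2, 4\<close> the multiplicities alternate and add up to
    \<open>n - 1\<close>, so \<open>2 * (n - 1) = k * (mu 1 + mu 2)\<close>. This identifies
    \<open>N * R\<close> with the constant term of the Laplacian, and positivity of both
    multiplicities gives the strict bounds on \<open>R\<close>.\<close>
  have NR: "N * R = c * (real k)\<^sup>2 / 2 \<and> -1 < R \<and> R < 1"
  proof (cases "k \<in> {2, 4}")
    case True
    have odd_even: "mu i = (if odd i then mu 1 else mu 2)" if "i \<in> {1..k}" for i
      using muenzner_normalizedD(4)[OF normalized] True that by blast
    have "m = mu 2" using odd_even[of k] True assms(4) by auto
    have pos: "mu 1 > 0" "mu 2 > 0" using mult(2)[of 1] mult(2)[of 2] True by auto
    have "(\<Sum>i\<in>{1..k}. mu i) = (\<Sum>i\<in>{1..k}. if odd i then mu 1 else mu 2)"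
      using odd_even by (intro sum.cong) auto
    also have "2 * \<dots> = k * (mu 1 + mu 2)"
    proof -
      have "{1..2::nat} = {1, 2}" "{1..4::nat} = {1, 2, 3, 4}" by auto
      then show ?thesis using True by auto
    qed
    finally have "2 * (n - 1) = k * (mu 1 + mu 2)" using mult(1) by simp
    then have "real (2 * (n - 1)) = real (k * (mu 1 + mu 2))" by simp
    then have sum: "2 * (real n - 1) = real k * (real (mu 1) + real (mu 2))" using n by (simp add: of_nat_diff)
    have n1: "real n - 1 > 0" using n by simp
    have R: "R = -1 + real k * real (mu 2) / (real n - 1)" using assms(5) True \<open>m = mu 2\<close> by simp
    have R2: "2 * ((real n - 1) * R) = real k * c"
      using n1 sum True unfolding R c_def by (simp add: field_simps)
    have kp: "real k * real (mu 1) > 0" "real k * real (mu 2) > 0" using k1 pos by auto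
    have "2 * ((real n - 1) * R) < 2 * (real n - 1)" "- (2 * (real n - 1)) < 2 * ((real n - 1) * R)"
      unfolding R2 sum using kp True by (auto simp: c_def algebra_simps)
    then have "(real n - 1) * R < (real n - 1) * 1" "(real n - 1) * (-1) < (real n - 1) * R" by linarith+
    then have "R < 1" "-1 < R"
      using mult_less_cancel_left_pos[OF n1, of R 1] mult_less_cancel_left_pos[OF n1, of "-1" R] by blast+
    moreover have "N * R = real k * (2 * ((real n - 1) * R)) / 2" by (simp add: N_def)
    then have "N * R = c * (real k)\<^sup>2 / 2" unfolding R2 by (simp add: power2_eq_square)
    ultimately show ?thesis by simp
  qed (use assms(5) in \<open>auto simp: c_def\<close>)
  interpret ode: translator_ode "real k" N R
  proof
    have "1 * 1 \<le> real k * (real n - 1)" using k1 n by (intro mult_mono) auto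
    then show "1 \<le> N" by (simp add: N_def)
  qed (use k1 NR in auto)
  obtain D :: "nat \<Rightarrow> real \<Rightarrow> real" where D: "\<And>s. s \<in> J \<Longrightarrow> D 0 s = V s"
    "\<And>j s. s \<in> J \<Longrightarrow> (D j has_real_derivative D (Suc j) s) (at s within J)"
    using assms(9) unfolding smooth_on_interval_def by blast
  have Dint: "(D j has_real_derivative D (Suc j) s) (at s)" if "s \<in> interior J" for s j
    using D(2)[of s j] that interior_subset[of J] at_within_interior[of s J] by auto
  have Vint: "(V has_real_derivative D 1 s) (at s)" if "s \<in> interior J" for s
  proof -
    have "(D 0 has_real_derivative D 1 s) (at s)" using Dint[OF that, of 0] by simp
    then show ?thesis
      by (rule has_field_derivative_transform_within_open[of _ _ _ "interior J"])
        (use that D(1) interior_subset[of J] in auto)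
  qed
  have int: "{l<..<q} \<subseteq> interior J" using lq by (intro interior_maximal) auto
  have sol: "ode.sol (D 1) {l<..<q}"
    unfolding cubic_solution_def
  proof
    fix s assume s: "s \<in> {l<..<q}"
    then have sJ: "s \<in> interior J" "s \<in> J" using int lq by auto
    then obtain x where x: "x \<in> sphere 0 1" "r x = s" using assms(8) by blast
    have Fx: "F x = s" using F(3) x by simp
    have \<alpha>: "ode.\<alpha> s > 0" using ode.alpha_pos[of s] s lq by auto
    have lap: "laplS r x = - (N * (s - R) + (real k)\<^sup>2 * s)"
      using lapl[OF x(1)] NR x(2) by (simp add: N_def algebra_simps power2_eq_square)
    have D2: "(D 1 has_real_derivative D 2 t) (at t)" if "t \<in> interior J" for t
      using Dint[OF that, of 1] by (simp add: numeral_2_eq_2)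
    have x': "norm x = 1" "F x \<in> interior J" using x Fx sJ by auto
    have eq: "ode.\<alpha> s * D 2 s = (1 + (N * (s - R) + (real k)\<^sup>2 * s) * D 1 s) * (1 + ode.\<alpha> s * (D 1 s)\<^sup>2)
        - (real k)\<^sup>2 * s * ode.\<alpha> s * (D 1 s) ^ 3"
      using sp.translating_soliton_equation[OF Vint D2 assms(10) x' assms(12)[unfolded assms(11)] assms(13)]
      unfolding Fx lap mult_minus_left diff_minus_eq_add .
    define A where "A = ode.\<alpha> s"
    \<comment> \<open>The terms \<open>(real k)\<^sup>2 * s * A * (D 1 s) ^ 3\<close> cancel, so
      only \<open>N * (s - R)\<close> is left in the cubic coefficient.\<close>
    have "A * D 2 s = (1 + (N * (s - R) + (real k)\<^sup>2 * s) * D 1 s) + A * ((D 1 s)\<^sup>2 * (1 + N * (s - R) * D 1 s))"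
      using eq unfolding A_def[symmetric] by (simp add: algebra_simps power2_eq_square power3_eq_cube)
    then have "D 2 s = cubic (soliton_coeff (real k) N R) s (D 1 s)"
      using \<alpha> unfolding cubic_soliton_coeff A_def[symmetric] by (simp add: field_simps)
    then show "(D 1 has_real_derivative cubic (soliton_coeff (real k) N R) s (D 1 s)) (at s)"
      using Dint[OF sJ(1), of 1] by (simp add: numeral_2_eq_2)
  qed
  obtain Jh W a b where shape: "soliton_shape R Jh W a b" and ck: "\<And>j. ck_on j W Jh"
    and sub: "{l<..<q} \<subseteq> Jh" and W: "\<And>s. s \<in> {l<..<q} \<Longrightarrow> W s = D 1 s"
    and right: "q \<notin> Jh \<Longrightarrow> filterlim (D 1) at_infinity (at_left q)"
    and left: "l \<notin> Jh \<Longrightarrow> filterlim (D 1) at_infinity (at_right l)"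
    using ode.soliton_classification[OF sol lq(1-3)] by blast
  have cont1: "continuous (at s within J) (D 1)" if "s \<in> J" for s
    using D(2)[OF that, of 1] by (rule DERIV_continuous)
  \<comment> \<open>If \<open>q\<close> belongs to \<open>J\<close> then \<open>D 1\<close> has a
    finite limit there, whereas \<open>q \<notin> Jh\<close> would mean blow-up.\<close>
  have "q \<in> Jh" if "q \<in> J"
  proof (rule ccontr)
    assume "q \<notin> Jh"
    have "at q within {l<..<q} = at_left q" by (rule at_within_nhd[of q "{l<..}"]) (use lq in auto)
    with not_at_infinity_if_continuous[OF cont1[OF that] _ lq(4)] right[OF \<open>q \<notin> Jh\<close>]
    show False by simp
  qed
  moreover have "l \<in> Jh" if "l \<in> J"
  proof (rule ccontr)
    assume "l \<notin> Jh"
    have "at l within {l<..<q} = at_right l" by (rule at_within_nhd[of l "{..<q}"]) (use lq in auto)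
    with not_at_infinity_if_continuous[OF cont1[OF that] _ lq(4)] left[OF \<open>l \<notin> Jh\<close>]
    show False by simp
  qed
  ultimately have JJh: "J \<subseteq> Jh"
    using lq(5) sub by (metis atLeastAtMost_iff greaterThanLessThan_iff order_less_le subset_iff)
  have Jh: "is_interval Jh" 
    using shape unfolding soliton_shape_def
    by (elim conjE disjE) (simp_all add: is_interval_oo is_interval_co is_interval_oc)
  obtain A where A: "\<And>s. s \<in> Jh \<Longrightarrow> (A has_real_derivative W s) (at s within Jh)"
    using antiderivative_on_interval[OF Jh ck_on_continuous[OF ck]] by blast
  \<comment> \<open>The constant makes \<open>Vh\<close> and \<open>V\<close> agree at
    \<open>s0\<close>. They agree on \<open>J\<close> because \<open>W = D 1\<close> on
    \<open>{l<..<q}\<close> and both functions are continuous up to the end points in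
    \<open>J\<close>.\<close>
  define Vh where "Vh s = A s + (V s0 - A s0)" for s
  have Vh: "(Vh has_real_derivative W s) (at s within Jh)" if "s \<in> Jh" for s
    unfolding Vh_def using A[OF that] by (auto intro!: derivative_eq_intros)
  have "smooth_on_interval Jh Vh"
  proof (rule smooth_on_interval_if_ck_on)
    have "ck_on (Suc j) Vh Jh" for j using Vh ck by auto
    then show "ck_on j Vh Jh" for j by (rule ck_on_SucD)
    show "at s within Jh \<noteq> bot" if "s \<in> Jh" for s
    proof -
      have "Jh \<noteq> {t}" for t using assms(7) JJh by auto
      then show ?thesis
        using connected_imp_perfect[of Jh s] that Jh by (auto simp: is_interval_connected trivial_limit_within)
    qed
  qed
  moreover have "Vh s = V s" if s: "s \<in> J" for s
  proof -
    define h where "h t = Vh t - V t" for t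
    have "(V has_real_derivative D 1 t) (at t within J)" if "t \<in> J" for t
    proof -
      have "(D 0 has_real_derivative D 1 t) (at t within J)" using D(2)[OF that, of 0] by simp
      then show ?thesis
        by (rule has_field_derivative_transform_within[of _ _ _ _ 1]) (use that D(1) in auto)
    qed
    then have "continuous_on J V" by (meson DERIV_continuous continuous_on_eq_continuous_within)
    moreover have "continuous_on J Vh"
      using Vh JJh by (meson DERIV_continuous continuous_on_eq_continuous_within continuous_on_subset)
    ultimately have hc: "continuous_on J h" unfolding h_def by (intro continuous_intros)
    have hd: "(h has_real_derivative 0) (at t)" if t: "t \<in> {l<..<q}" for t
    proof -
      have "at t within Jh = at t" by (rule at_within_open_subset[OF t _ sub]) auto
      then have "(Vh has_real_derivative D 1 t) (at t)" using Vh[of t] sub t W[OF t] by auto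
      from DERIV_diff[OF this Vint] show ?thesis using int t by (auto simp: h_def[abs_def])
    qed
    have const: "h y = h x" if "x \<in> J" "y \<in> J" "x < y" for x y
    proof (rule DERIV_isconst2[OF that(3)])
      have "{x..y} \<subseteq> J" using assms(6) that by (meson atLeastAtMost_iff mem_is_interval_1_I subsetI)
      then show "continuous_on {x..y} h" using hc continuous_on_subset by blast
      show "(h has_real_derivative 0) (at z)" if "x < z" "z < y" for z
        using that \<open>x \<in> J\<close> \<open>y \<in> J\<close> lq(5) by (intro hd) force
    qed (use that in auto)
    have "h s = h s0" using const[of s s0] const[of s0 s] s s0J by (metis linorder_neqE_linordered_idom)
    then show ?thesis by (simp add: h_def Vh_def)
  qed
  ultimately have V: "smooth_on_interval Jh Vh" "\<forall>s\<in>J. Vh s = V s" by blast+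
  have W: "\<forall>s\<in>Jh. (Vh has_real_derivative W s) (at s within Jh)" using Vh by blast
  show ?thesis
    by (intro conjI exI[of _ Jh] exI[of _ Vh] exI[of _ W] exI[of _ a] exI[of _ b])
      (rule JJh V W NR[THEN conjunct2, THEN conjunct1] NR[THEN conjunct2, THEN conjunct2]
        shape[unfolded soliton_shape_def, THEN conjunct1]
        shape[unfolded soliton_shape_def, THEN conjunct2, THEN conjunct1]
        shape[unfolded soliton_shape_def, THEN conjunct2, THEN conjunct2, THEN conjunct1]
        shape[unfolded soliton_shape_def, THEN conjunct2, THEN conjunct2, THEN conjunct2, THEN conjunct1]
        shape[unfolded soliton_shape_def, THEN conjunct2, THEN conjunct2, THEN conjunct2, THEN conjunct2])+
qed

end
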